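(* Let $\mathcal{E}=\{|\varphi_i\rangle,p_i\}_{i\in\mathcal I}$ be a finite ensemble of pure states on $\mathbb{C}^d$, and let $n\ge1$, $R\ge0$, $\epsilon>0$. Let $\Gamma$ be a CPTP map from operators on $(\mathbb{C}^d)^{\otimes n}$ (system $B$) to operators on $(\mathbb{C}^d)^{\otimes n}\otimes\mathcal H_C$ (system $BC$), where $\mathcal H_C$ is a classical register. That is, for each $I$, $\Gamma(\varphi_I)=\sum_jp(j|I)\,\tilde\varphi_{I,j}\otimes|j\rangle\langle j|$ for a fixed orthonormal basis $\{|j\rangle\}$ of $\mathcal H_C$. Suppose: 1. $H(I:j)\ge nR$, where $H(I:j)$ is the classical mutual information of the joint distribution $p_Ip(j|I)$. 2. The mean letterwise fidelity satisfies $\sum_Ip_I\frac1n\sum_{k=1}^nF\big(\varphi_{i_k},\mathrm{Tr}_{\neq k}\mathrm{Tr}_C\Gamma(\varphi_I)\big)\ge1-\epsilon$. Then $S(\mathcal{E})\ge X_\epsilon(\mathcal{E},R)$. Moreover, the Holevo quantity of the ensemble $\mathcal F^{BC}=\{\Gamma(\varphi_I),p_I\}_{I\in\mathcal I^n}$ satisfies $\chi(\mathcal F^{BC})\ge nX_\epsilon(\mathcal{E},R)$.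
   Context: Notation: - $\varphi_i=|\varphi_i\rangle\langle\varphi_i|$; $\varphi_I=\varphi_{i_1}\otimes\cdots\otimes\varphi_{i_n}$ and $p_I=\prod_kp_{i_k}$ for $I=i_1\dots i_n$. - $\mathrm{Tr}_{\neq k}$ traces out all tensor factors of $(\mathbb{C}^d)^{\otimes n}$ except the $k$-th. - $F(\psi,\sigma)=\mathrm{Tr}(\psi\sigma)$ for pure $\psi$. - $S(\mathcal{E})=S(\sum_ip_i\varphi_i)$, with von Neumann entropy in base 2. - The Holevo quantity is $\chi(\{\rho_x,s_x\})=S(\sum_xs_x\rho_x)-\sum_xs_xS(\rho_x)$. $X_\epsilon(\mathcal{E},R)=R+M_\epsilon(\mathcal{E},R)$, where $M_\epsilon$ is defined as follows. - An encoding map $E$ assigns to each $i\in\mathcal I$ a state $E(i)=\sum_jp(j|i)\,\omega_{i,j}\otimes|j\rangle\langle j|$ on $\mathcal H_{B'}\otimes\mathcal H_{C'}$ (finite-dimensional, $\{|j\rangle\}$ orthonormal). - With $\rho^{ABC}=\sum_ip_i|i\rangle\langle i|\otimes E(i)$, let $S(A:C)=S(A)+S(C)-S(AC)$ and $S(A:B|C)=S(AC)+S(BC)-S(ABC)-S(C)$. - $T_\epsilon(\mathcal{E},R)$ is the set of encoding maps with $S(A:C)\le R$ for which some CPTP $D$ into operators on $\mathbb{C}^d$ satisfies $\sum_ip_i\langle\varphi_i|D(E(i))|\varphi_i\rangle\ge1-\epsilon$. - $M_\epsilon(\mathcal{E},R)=\inf\{S(A:B|C):E\in T_\epsilon(\mathcal{E},R)\}$.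 *)

theory Defs
  imports "Jordan_Normal_Form.Jordan_Normal_Form" "HOL-Library.Extended_Real"
begin

text \<open>Operators on C^n are n x n complex matrices (JNF type complex mat).
  Tensor products use the Kronecker product with the first factor most significant,
  i.e. basis index (x,y) of C^a (x) C^b is x*b+y.\<close>

definition kron :: "complex mat \<Rightarrow> complex mat \<Rightarrow> complex mat" where
  "kron A B = mat (dim_row A * dim_row B) (dim_col A * dim_col B)
     (\<lambda>(i,j). A $$ (i div dim_row B, j div dim_col B) * B $$ (i mod dim_row B, j mod dim_col B))"

definition proj :: "complex vec \<Rightarrow> complex mat" where
  "proj v = mat (dim_vec v) (dim_vec v) (\<lambda>(i,j). v $ i * cnj (v $ j))"

definition ket_proj :: "nat \<Rightarrow> nat \<Rightarrow> complex mat" where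
  "ket_proj c j = mat c c (\<lambda>(a,b). if a = j \<and> b = j then 1 else 0)"

definition msum :: "nat \<Rightarrow> ('a \<Rightarrow> complex mat) \<Rightarrow> 'a set \<Rightarrow> complex mat" where
  "msum n f A = mat n n (\<lambda>(r,s). \<Sum>x\<in>A. f x $$ (r,s))"

definition mtrace :: "complex mat \<Rightarrow> complex" where
  "mtrace A = (\<Sum>i<dim_row A. A $$ (i,i))"

definition psd :: "nat \<Rightarrow> complex mat \<Rightarrow> bool" where
  "psd n A \<longleftrightarrow> A \<in> carrier_mat n n \<and>
     (\<forall>v \<in> carrier_vec n. Im ((A *\<^sub>v v) \<bullet>c v) = 0 \<and> Re ((A *\<^sub>v v) \<bullet>c v) \<ge> 0)"

definition density :: "nat \<Rightarrow> complex mat \<Rightarrow> bool" where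
  "density n \<rho> \<longleftrightarrow> psd n \<rho> \<and> mtrace \<rho> = 1"

definition ptrace_mid :: "nat \<Rightarrow> nat \<Rightarrow> nat \<Rightarrow> complex mat \<Rightarrow> complex mat" where
  "ptrace_mid a b c \<rho> = mat (a*c) (a*c) (\<lambda>(i,j).
     \<Sum>y<b. \<rho> $$ ((i div c * b + y) * c + i mod c, (j div c * b + y) * c + j mod c))"

definition keep_mid :: "nat \<Rightarrow> nat \<Rightarrow> nat \<Rightarrow> complex mat \<Rightarrow> complex mat" where
  "keep_mid a b c \<rho> = mat b b (\<lambda>(i,j).
     \<Sum>x<a. \<Sum>z<c. \<rho> $$ ((x * b + i) * c + z, (x * b + j) * c + z))"

text \<open>von Neumann entropy (base 2): -sum lambda log2 lambda over the eigenvalues counted with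
  algebraic multiplicity (roots of the characteristic polynomial); 0 log 0 = 0 since log 2 0 = 0.\<close>
definition vn_entropy :: "complex mat \<Rightarrow> real" where
  "vn_entropy \<rho> = - (\<Sum>z\<in>{z. poly (char_poly \<rho>) z = 0}.
      real (order z (char_poly \<rho>)) * (Re z * log 2 (Re z)))"

definition fid :: "complex vec \<Rightarrow> complex mat \<Rightarrow> real" where
  "fid \<phi> \<sigma> = Re (mtrace (proj \<phi> * \<sigma>))"

definition lin_map :: "nat \<Rightarrow> nat \<Rightarrow> (complex mat \<Rightarrow> complex mat) \<Rightarrow> bool" where
  "lin_map din dout \<Phi> \<longleftrightarrow>
     (\<forall>X \<in> carrier_mat din din. \<Phi> X \<in> carrier_mat dout dout) \<and>
     (\<forall>X \<in> carrier_mat din din. \<forall>Y \<in> carrier_mat din din. \<Phi> (X + Y) = \<Phi> X + \<Phi> Y) \<and>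
     (\<forall>X \<in> carrier_mat din din. \<forall>c. \<Phi> (c \<cdot>\<^sub>m X) = c \<cdot>\<^sub>m \<Phi> X)"

text \<open>(id_k (x) Phi)(X), applied blockwise: X = sum |a><b| (x) X_ab  maps to  sum |a><b| (x) Phi(X_ab)\<close>
definition ampl :: "nat \<Rightarrow> nat \<Rightarrow> nat \<Rightarrow> (complex mat \<Rightarrow> complex mat) \<Rightarrow> complex mat \<Rightarrow> complex mat" where
  "ampl k din dout \<Phi> X = mat (k*dout) (k*dout) (\<lambda>(i,j).
     \<Phi> (mat din din (\<lambda>(r,s). X $$ ((i div dout) * din + r, (j div dout) * din + s)))
       $$ (i mod dout, j mod dout))"

definition cptp :: "nat \<Rightarrow> nat \<Rightarrow> (complex mat \<Rightarrow> complex mat) \<Rightarrow> bool" where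
  "cptp din dout \<Phi> \<longleftrightarrow> lin_map din dout \<Phi> \<and>
     (\<forall>X \<in> carrier_mat din din. mtrace (\<Phi> X) = mtrace X) \<and>
     (\<forall>k X. psd (k*din) X \<longrightarrow> psd (k*dout) (ampl k din dout \<Phi> X))"

definition shannon :: "('a \<Rightarrow> real) \<Rightarrow> 'a set \<Rightarrow> real" where
  "shannon P A = - (\<Sum>x\<in>A. P x * log 2 (P x))"

definition classical_mi :: "('a \<times> 'b \<Rightarrow> real) \<Rightarrow> 'a set \<Rightarrow> 'b set \<Rightarrow> real" where
  "classical_mi P A B = shannon (\<lambda>x. \<Sum>y\<in>B. P (x,y)) A + shannon (\<lambda>y. \<Sum>x\<in>A. P (x,y)) B
     - shannon P (A \<times> B)"

definition ensemble :: "nat \<Rightarrow> nat \<Rightarrow> (nat \<Rightarrow> complex vec) \<Rightarrow> (nat \<Rightarrow> real) \<Rightarrow> bool" where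
  "ensemble d m \<phi> p \<longleftrightarrow> (\<forall>i<m. \<phi> i \<in> carrier_vec d \<and> \<phi> i \<bullet>c \<phi> i = 1 \<and> p i \<ge> 0)
      \<and> (\<Sum>i<m. p i) = 1"

definition ens_state :: "nat \<Rightarrow> nat \<Rightarrow> (nat \<Rightarrow> complex vec) \<Rightarrow> (nat \<Rightarrow> real) \<Rightarrow> complex mat" where
  "ens_state d m \<phi> p = msum d (\<lambda>i. complex_of_real (p i) \<cdot>\<^sub>m proj (\<phi> i)) {..<m}"

definition ens_entropy :: "nat \<Rightarrow> nat \<Rightarrow> (nat \<Rightarrow> complex vec) \<Rightarrow> (nat \<Rightarrow> real) \<Rightarrow> real" where
  "ens_entropy d m \<phi> p = vn_entropy (ens_state d m \<phi> p)"

definition seqs :: "nat \<Rightarrow> nat \<Rightarrow> nat list set" where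
  "seqs m n = {I. length I = n \<and> set I \<subseteq> {..<m}}"

definition phiI :: "(nat \<Rightarrow> complex vec) \<Rightarrow> nat list \<Rightarrow> complex mat" where
  "phiI \<phi> I = foldr (\<lambda>i M. kron (proj (\<phi> i)) M) I (1\<^sub>m 1)"

definition pI :: "(nat \<Rightarrow> real) \<Rightarrow> nat list \<Rightarrow> real" where
  "pI p I = prod_list (map p I)"

text \<open>An encoding map E is given by finite dimensions dB (of H_B') and dC (of H_C'),
  conditional probabilities q i j = p(j|i) and states omega i j on H_B'.\<close>
definition valid_encoding :: "nat \<Rightarrow> nat \<Rightarrow> nat \<Rightarrow> (nat \<Rightarrow> nat \<Rightarrow> real) \<Rightarrow> (nat \<Rightarrow> nat \<Rightarrow> complex mat) \<Rightarrow> bool" where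
  "valid_encoding m dB dC q \<omega> \<longleftrightarrow> (\<forall>i<m. (\<forall>j<dC. q i j \<ge> 0 \<and> density dB (\<omega> i j)) \<and> (\<Sum>j<dC. q i j) = 1)"

definition enc_map :: "nat \<Rightarrow> nat \<Rightarrow> (nat \<Rightarrow> nat \<Rightarrow> real) \<Rightarrow> (nat \<Rightarrow> nat \<Rightarrow> complex mat) \<Rightarrow> nat \<Rightarrow> complex mat" where
  "enc_map dB dC q \<omega> i = msum (dB*dC) (\<lambda>j. complex_of_real (q i j) \<cdot>\<^sub>m kron (\<omega> i j) (ket_proj dC j)) {..<dC}"

definition rhoABC :: "nat \<Rightarrow> (nat \<Rightarrow> real) \<Rightarrow> nat \<Rightarrow> nat \<Rightarrow> (nat \<Rightarrow> nat \<Rightarrow> real) \<Rightarrow> (nat \<Rightarrow> nat \<Rightarrow> complex mat) \<Rightarrow> complex mat" where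
  "rhoABC m p dB dC q \<omega> = msum (m*dB*dC)
     (\<lambda>i. complex_of_real (p i) \<cdot>\<^sub>m kron (ket_proj m i) (enc_map dB dC q \<omega> i)) {..<m}"

definition mi_AC :: "nat \<Rightarrow> (nat \<Rightarrow> real) \<Rightarrow> nat \<Rightarrow> nat \<Rightarrow> (nat \<Rightarrow> nat \<Rightarrow> real) \<Rightarrow> (nat \<Rightarrow> nat \<Rightarrow> complex mat) \<Rightarrow> real" where
  "mi_AC m p dB dC q \<omega> = (let \<rho> = rhoABC m p dB dC q \<omega> in
      vn_entropy (ptrace_mid m (dB*dC) 1 \<rho>) + vn_entropy (ptrace_mid 1 (m*dB) dC \<rho>)
      - vn_entropy (ptrace_mid m dB dC \<rho>))"

definition cmi_ABC :: "nat \<Rightarrow> (nat \<Rightarrow> real) \<Rightarrow> nat \<Rightarrow> nat \<Rightarrow> (nat \<Rightarrow> nat \<Rightarrow> real) \<Rightarrow> (nat \<Rightarrow> nat \<Rightarrow> complex mat) \<Rightarrow> real" where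
  "cmi_ABC m p dB dC q \<omega> = (let \<rho> = rhoABC m p dB dC q \<omega> in
      vn_entropy (ptrace_mid m dB dC \<rho>) + vn_entropy (ptrace_mid 1 m (dB*dC) \<rho>)
      - vn_entropy \<rho> - vn_entropy (ptrace_mid 1 (m*dB) dC \<rho>))"

definition in_T :: "nat \<Rightarrow> nat \<Rightarrow> (nat \<Rightarrow> complex vec) \<Rightarrow> (nat \<Rightarrow> real) \<Rightarrow> real \<Rightarrow> real \<Rightarrow>
     nat \<Rightarrow> nat \<Rightarrow> (nat \<Rightarrow> nat \<Rightarrow> real) \<Rightarrow> (nat \<Rightarrow> nat \<Rightarrow> complex mat) \<Rightarrow> bool" where
  "in_T d m \<phi> p \<epsilon> R dB dC q \<omega> \<longleftrightarrow> valid_encoding m dB dC q \<omega> \<and> mi_AC m p dB dC q \<omega> \<le> R \<and>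
     (\<exists>D. cptp (dB*dC) d D \<and> (\<Sum>i<m. p i * fid (\<phi> i) (D (enc_map dB dC q \<omega> i))) \<ge> 1 - \<epsilon>)"

text \<open>M_epsilon(E,R): infimum in the extended reals (inf of the empty set is +infinity)\<close>
definition M_eps :: "nat \<Rightarrow> nat \<Rightarrow> (nat \<Rightarrow> complex vec) \<Rightarrow> (nat \<Rightarrow> real) \<Rightarrow> real \<Rightarrow> real \<Rightarrow> ereal" where
  "M_eps d m \<phi> p \<epsilon> R = Inf {ereal (cmi_ABC m p dB dC q \<omega>) | dB dC q \<omega>. in_T d m \<phi> p \<epsilon> R dB dC q \<omega>}"

definition X_eps :: "nat \<Rightarrow> nat \<Rightarrow> (nat \<Rightarrow> complex vec) \<Rightarrow> (nat \<Rightarrow> real) \<Rightarrow> real \<Rightarrow> real \<Rightarrow> ereal" where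
  "X_eps d m \<phi> p \<epsilon> R = ereal R + M_eps d m \<phi> p \<epsilon> R"

definition holevo :: "nat \<Rightarrow> ('a \<Rightarrow> complex mat) \<Rightarrow> ('a \<Rightarrow> real) \<Rightarrow> 'a set \<Rightarrow> real" where
  "holevo N \<rho> s A = vn_entropy (msum N (\<lambda>x. complex_of_real (s x) \<cdot>\<^sub>m \<rho> x) A)
     - (\<Sum>x\<in>A. s x * vn_entropy (\<rho> x))"

end

theory Submission
  imports Defs "Jordan_Normal_Form.Schur_Decomposition"
begin

text \<open>
  Write \<open>\<chi>\<close> for the Holevo quantity of \<open>\<F>\<^sup>B\<^sup>C\<close>. For a prefix \<open>J\<close> let \<open>\<sigma>\<^sub>J\<close> be the average of
  \<open>\<Gamma>(\<phi>\<^sub>I)\<close> over all \<open>I\<close> extending \<open>J\<close>. Sending a letter \<open>i\<close> to \<open>\<sigma>\<^sub>J\<^sub>i\<close>, with \<open>J\<close> drawn at random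
  (uniform length \<open>k < n\<close>, then product distribution) and recorded in the classical register,
  gives an encoding map. By telescoping over \<open>k\<close> its \<open>S(A:BC)\<close> is exactly \<open>\<chi>/n\<close> and its \<open>S(A:C)\<close> is
  exactly \<open>H(I:j)/n \<ge> R\<close>, and reading the letter at position \<open>k\<close> yields the mean letterwise fidelity.
  Withholding the value \<open>j\<close> from the register (it remains in the quantum part) with a suitable
  flagged probability lowers \<open>S(A:C)\<close> to \<open>R\<close> without changing \<open>S(A:BC)\<close>,
  so \<open>R + M\<^sub>\<epsilon> \<le> \<chi>/n\<close>.

  The remaining inequality \<open>\<chi> \<le> n S(\<E>)\<close> is the Holevo bound for pure input states. For eigenvalues
  \<open>a\<^sub>x\<close> of \<open>\<Gamma>(\<phi>)\<close> and \<open>b\<^sub>y\<close> of \<open>\<Gamma>(\<sigma>)\<close> with overlaps \<open>W\<^sub>x\<^sub>y\<close> of the eigenvectors, the quantity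
  \<open>\<Sum> W\<^sub>x\<^sub>y a\<^sub>x T b\<^sub>y / (a\<^sub>x + T b\<^sub>y)\<close> is the minimum over operators \<open>X\<close> of
  \<open>Tr \<Gamma>(\<phi>)(1-X)(1-X)\<^sup>* + T Tr \<Gamma>(\<sigma>)X\<^sup>*X\<close>, and the Schwarz inequality for the adjoint of \<open>\<Gamma>\<close> bounds this
  from below by the same minimum for \<open>\<phi>\<close> and \<open>\<sigma>\<close>. Dividing by \<open>T\<close> and integrating gives
  logarithms, and \<open>T \<rightarrow> \<infinity>\<close> gives the relative entropies.
\<close>


section \<open>Entropy and spectral decompositions\<close>

text \<open>The chain rule S(A:C) + S(A:B|C) = S(A:BC) explains why the rate must be tuned. So the
  excess is moved from the register to the quantum part while S(A:BC) stays fixed, which makes R +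
  S(A:B|C) equal to S(A:BC). Nothing is lost on the way, because a prefix J contributes f(J) minus
  the mean of f over one further letter, with f the von Neumann entropy in one case and the entropy
  of j in the other; such differences telescope in the length of J. Operators carry their
  probability as their trace, so the bookkeeping reduces to the product rule
  \<open>ent_mult\<close>. In the Holevo bound the obstacle is zero eigenvalues, for which relative
  entropies are delicate. A finite T acts as a regularization: with T = 1/\<epsilon> (an auxiliary
  \<epsilon>) only ln (\<epsilon> + s) and ln (\<epsilon> + b) occur. The limit is taken after
  averaging over the ensemble, when the overlap weights have collapsed to the eigenvalues
  themselves. Complete positivity enters through amplification by a two-dimensional system, which
  yields the Schwarz inequality.\<close>

definition ent :: "real \<Rightarrow> real" where
  "ent t = - (t * log 2 t)"

lemma ent_0 [simp]: "ent 0 = 0" and ent_1 [simp]: "ent 1 = 0"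
  by (simp_all add: ent_def)

text \<open>The convention 0 log 0 = 0 makes this product rule valid at zero as well. Every scaling,
  tensor and chain rule for entropies below comes down to it.\<close>

lemma ent_mult: "a \<ge> 0 \<Longrightarrow> b \<ge> 0 \<Longrightarrow> ent (a * b) = a * ent b + b * ent a"
  by (cases "a = 0 \<or> b = 0") (auto simp: ent_def log_mult algebra_simps)

lemma order_prod_linear:
  assumes "finite X"
  shows "Polynomial.order z (\<Prod>x\<in>X. [:- c x, 1:]) = card {x\<in>X. c x = (z :: complex)}"
  using assms
proof (induction X rule: finite_induct)
  case (insert x X)
  have nz: "(\<Prod>x\<in>X. [:- c x, 1:]) \<noteq> 0"
    using insert by (subst prod_zero_iff) auto
  have "Polynomial.order z (\<Prod>x\<in>insert x X. [:- c x, 1:]) = Polynomial.order z [:- c x, 1:] + Polynomial.order z (\<Prod>x\<in>X. [:- c x, 1:])"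
    using insert nz by (subst prod.insert, simp_all only:, subst order_mult)
      (auto simp del: mult_pCons_left)
  moreover have "Polynomial.order z [:- c x, 1:] = (if c x = z then 1 else 0)"
    using order_power_n_n[of "c x" 1] by (auto simp: order_0I)
  moreover have "{y \<in> insert x X. c y = z} = (if c x = z then insert x {y\<in>X. c y = z} else {y\<in>X. c y = z})"
    by auto
  ultimately show ?case using insert by (auto simp del: prod.insert)
qed (simp add: order_0I)

text \<open>\<open>vn_entropy\<close> sums over distinct roots with multiplicities. Grouping the
  indices x by the value \<open>c x\<close> turns such a sum into one over indexed eigenvalues,
  where repetitions need no care.\<close>

lemma sum_roots_prod_linear:
  assumes "finite X"
  shows "(\<Sum>z\<in>{z. poly (\<Prod>x\<in>X. [:- c x, 1:]) z = 0}. real (Polynomial.order z (\<Prod>x\<in>X. [:- c x, 1:])) * g z)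
    = (\<Sum>x\<in>X. g (c x :: complex))"
proof -
  have roots: "{z. poly (\<Prod>x\<in>X. [:- c x, 1:]) z = 0} = c ` X"
    using assms by (auto simp: poly_prod)
  have "(\<Sum>x\<in>X. g (c x)) = (\<Sum>z\<in>c ` X. \<Sum>x\<in>{x\<in>X. c x = z}. g (c x))"
    by (rule sum.image_gen[OF assms])
  also have "\<dots> = (\<Sum>z\<in>c ` X. real (Polynomial.order z (\<Prod>x\<in>X. [:- c x, 1:])) * g z)"
    by (rule sum.cong) (auto simp: order_prod_linear[OF assms])
  finally show ?thesis unfolding roots by simp
qed

text \<open>Eigenvectors are coordinate functions indexed by an arbitrary finite set, so that tensor
  products and direct sums can use product and sum indices without renumbering.\<close>
definition specdec :: "nat \<Rightarrow> complex mat \<Rightarrow> 'x set \<Rightarrow> ('x \<Rightarrow> nat \<Rightarrow> complex) \<Rightarrow> ('x \<Rightarrow> real) \<Rightarrow> bool" where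
  "specdec N A X u b \<longleftrightarrow> A \<in> carrier_mat N N \<and> finite X \<and> card X = N \<and>
     (\<forall>x\<in>X. \<forall>y\<in>X. (\<Sum>r<N. u x r * cnj (u y r)) = (if x = y then 1 else 0)) \<and>
     (\<forall>r<N. \<forall>s<N. A $$ (r,s) = (\<Sum>x\<in>X. of_real (b x) * u x r * cnj (u x s)))"

lemma specdecD:
  assumes "specdec N A X u b"
  shows "A \<in> carrier_mat N N" "finite X" "card X = N"
    "\<And>x y. x \<in> X \<Longrightarrow> y \<in> X \<Longrightarrow> (\<Sum>r<N. u x r * cnj (u y r)) = (if x = y then 1 else 0)"
    "\<And>r s. r < N \<Longrightarrow> s < N \<Longrightarrow> A $$ (r,s) = (\<Sum>x\<in>X. of_real (b x) * u x r * cnj (u x s))"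
  using assms unfolding specdec_def by auto

lemma orthonormal_unitary:
  fixes u :: "'x \<Rightarrow> nat \<Rightarrow> complex"
  assumes e: "bij_betw e {..<N} X"
    and on: "\<And>x y. x \<in> X \<Longrightarrow> y \<in> X \<Longrightarrow> (\<Sum>r<N. u x r * cnj (u y r)) = (if x = y then 1 else 0)"
  defines "U \<equiv> mat N N (\<lambda>(r,k). u (e k) r)" and "V \<equiv> mat N N (\<lambda>(k,r). cnj (u (e k) r))"
  shows "V * U = 1\<^sub>m N" "U * V = 1\<^sub>m N"
proof -
  show "V * U = 1\<^sub>m N"
  proof (rule eq_matI)
    fix k l assume "k < dim_row (1\<^sub>m N)" "l < dim_col (1\<^sub>m N)"
    then have kl: "k < N" "l < N" by auto
    then have "e k \<in> X" "e l \<in> X" "e k = e l \<longleftrightarrow> k = l"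
      using e by (auto simp: bij_betw_def inj_on_def)
    moreover have "(V * U) $$ (k,l) = (\<Sum>r<N. u (e l) r * cnj (u (e k) r))"
      using kl by (simp add: U_def V_def scalar_prod_def atLeast0LessThan mult.commute)
    ultimately show "(V * U) $$ (k,l) = 1\<^sub>m N $$ (k,l)" using kl on by auto
  qed (auto simp: U_def V_def)
  then show "U * V = 1\<^sub>m N"
    using mat_mult_left_right_inverse[of V N U] by (auto simp: U_def V_def)
qed

text \<open>N orthonormal vectors in dimension N form a square matrix with a left inverse, which is
  then also a right inverse; reading off its entries gives the resolution of the identity.\<close>

lemma orthonormal_complete:
  assumes "finite X" "card X = N"
    and on: "\<And>x y. x \<in> X \<Longrightarrow> y \<in> X \<Longrightarrow> (\<Sum>r<N. u x r * cnj (u y r)) = (if x = y then 1 else 0)"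
    and rs: "r < N" "s < N"
  shows "(\<Sum>x\<in>X. u x r * cnj (u x s)) = (if r = s then 1 else (0 :: complex))"
proof -
  obtain e where e: "bij_betw e {..<N} X"
    using ex_bij_betw_nat_finite[OF assms(1)] assms(2) by (auto simp: atLeast0LessThan)
  have UV: "mat N N (\<lambda>(r,k). u (e k) r) * mat N N (\<lambda>(k,r). cnj (u (e k) r)) = 1\<^sub>m N"
    using e on by (rule orthonormal_unitary(2))
  have "(\<Sum>x\<in>X. u x r * cnj (u x s)) = (\<Sum>k<N. u (e k) r * cnj (u (e k) s))"
    by (rule sum.reindex_bij_betw[OF e, symmetric])
  also have "\<dots> = (mat N N (\<lambda>(r,k). u (e k) r) * mat N N (\<lambda>(k,r). cnj (u (e k) r))) $$ (r,s)"
    using rs by (simp add: scalar_prod_def atLeast0LessThan)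
  also have "\<dots> = (if r = s then 1 else 0)"
    unfolding UV using rs by simp
  finally show ?thesis .
qed

lemma specdec_complete:
  assumes "specdec N A X u b" "r < N" "s < N"
  shows "(\<Sum>x\<in>X. u x r * cnj (u x s)) = (if r = s then 1 else 0)"
  using orthonormal_complete[of X N u r s] specdecD[OF assms(1)] assms(2,3) by auto

text \<open>A spectral decomposition exhibits A as similar to a diagonal matrix, so the
  characteristic polynomials agree. Hence any decomposition may be used to compute the
  entropy.\<close>

lemma specdec_entropy:
  assumes "specdec N A X u b"
  shows "vn_entropy A = (\<Sum>x\<in>X. ent (b x))"
proof -
  note sd = specdecD[OF assms]
  obtain e where e: "bij_betw e {..<N} X"
    using ex_bij_betw_nat_finite[OF sd(2)] sd(3) by (auto simp: atLeast0LessThan)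
  define U where "U = mat N N (\<lambda>(r,k). u (e k) r)"
  define V where "V = mat N N (\<lambda>(k,r). cnj (u (e k) r))"
  define B where "B = mat N N (\<lambda>(k,l). if k = l then complex_of_real (b (e k)) else 0)"
  have carr: "U \<in> carrier_mat N N" "V \<in> carrier_mat N N" "B \<in> carrier_mat N N"
    by (auto simp: U_def V_def B_def)
  have VU: "V * U = 1\<^sub>m N" and UV: "U * V = 1\<^sub>m N"
    unfolding U_def V_def using orthonormal_unitary[OF e sd(4)] by auto
  have "A = U * B * V"
  proof (rule eq_matI)
    fix r s assume "r < dim_row (U * B * V)" "s < dim_col (U * B * V)"
    then have rs: "r < N" "s < N" using carr by auto
    have UB: "(U * B) $$ (r,k) = u (e k) r * complex_of_real (b (e k))" if "k < N" for k
    proof -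
      have "(U * B) $$ (r,k) = (\<Sum>l<N. u (e l) r * (if l = k then complex_of_real (b (e l)) else 0))"
        using rs that by (simp add: U_def B_def scalar_prod_def atLeast0LessThan)
      also have "\<dots> = (\<Sum>l<N. if l = k then u (e l) r * complex_of_real (b (e l)) else 0)"
        by (rule sum.cong) auto
      finally show ?thesis using that by simp
    qed
    have "(U * B * V) $$ (r,s) = (\<Sum>k<N. (U * B) $$ (r,k) * V $$ (k,s))"
      using rs carr by (simp add: scalar_prod_def atLeast0LessThan del: assoc_mult_mat)
    also have "\<dots> = (\<Sum>k<N. of_real (b (e k)) * u (e k) r * cnj (u (e k) s))"
      using rs by (intro sum.cong) (auto simp: UB V_def)
    also have "\<dots> = A $$ (r,s)"
      using sum.reindex_bij_betw[OF e, of "\<lambda>x. of_real (b x) * u x r * cnj (u x s)"] sd(5)[OF rs]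
      by simp
    finally show "A $$ (r,s) = (U * B * V) $$ (r,s)" by simp
  qed (use sd(1) carr in auto)
  then have "similar_mat_wit A B U V"
    using carr UV VU sd(1) by (auto simp: similar_mat_wit_def Let_def)
  then have "char_poly A = char_poly B"
    by (intro char_poly_similar) (auto simp: similar_mat_def)
  also have "\<dots> = (\<Prod>a\<leftarrow>diag_mat B. [:- a, 1:])"
    by (rule char_poly_upper_triangular[OF carr(3)]) (auto simp: B_def)
  also have "\<dots> = (\<Prod>k<N. [:- complex_of_real (b (e k)), 1:])"
    by (auto simp: diag_mat_def B_def prod.list_conv_set_nth atLeast0LessThan intro!: prod.cong)
  also have "\<dots> = (\<Prod>x\<in>X. [:- complex_of_real (b x), 1:])"
    by (rule prod.reindex_bij_betw[OF e])
  finally have cp: "char_poly A = (\<Prod>x\<in>X. [:- complex_of_real (b x), 1:])" .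
  show ?thesis
    unfolding vn_entropy_def cp sum_roots_prod_linear[OF sd(2), of _ "\<lambda>z. Re z * log 2 (Re z)"]
    by (simp add: ent_def sum_negf)
qed

lemma sum_rotate3:
  "(\<Sum>x\<in>A. \<Sum>y\<in>B. \<Sum>z\<in>C. f x y z) = (\<Sum>z\<in>C. \<Sum>x\<in>A. \<Sum>y\<in>B. (f x y z :: 'a :: comm_monoid_add))"
proof -
  have "(\<Sum>x\<in>A. \<Sum>y\<in>B. \<Sum>z\<in>C. f x y z) = (\<Sum>x\<in>A. \<Sum>z\<in>C. \<Sum>y\<in>B. f x y z)"
    by (intro sum.cong refl sum.swap)
  also have "\<dots> = (\<Sum>z\<in>C. \<Sum>x\<in>A. \<Sum>y\<in>B. f x y z)" by (rule sum.swap)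
  finally show ?thesis .
qed

lemma sum_swap22:
  "(\<Sum>x\<in>A. \<Sum>y\<in>B. \<Sum>z\<in>C. \<Sum>w\<in>D. f x y z w)
    = (\<Sum>z\<in>C. \<Sum>w\<in>D. \<Sum>x\<in>A. \<Sum>y\<in>B. (f x y z w :: 'a :: comm_monoid_add))"
proof -
  have "(\<Sum>x\<in>A. \<Sum>y\<in>B. \<Sum>z\<in>C. \<Sum>w\<in>D. f x y z w) = (\<Sum>z\<in>C. \<Sum>x\<in>A. \<Sum>y\<in>B. \<Sum>w\<in>D. f x y z w)"
    by (rule sum_rotate3)
  also have "\<dots> = (\<Sum>z\<in>C. \<Sum>w\<in>D. \<Sum>x\<in>A. \<Sum>y\<in>B. f x y z w)"
    by (intro sum.cong refl sum_rotate3)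
  finally show ?thesis .
qed

section \<open>Quadratic forms, positive semidefiniteness and the spectral theorem\<close>

definition qform :: "nat \<Rightarrow> complex mat \<Rightarrow> (nat \<Rightarrow> complex) \<Rightarrow> complex" where
  "qform N A v = (\<Sum>r<N. \<Sum>s<N. cnj (v r) * A $$ (r,s) * v s)"

lemma qform_vec:
  assumes "A \<in> carrier_mat N N"
  shows "(A *\<^sub>v vec N v) \<bullet>c vec N v = qform N A v"
proof -
  have "(A *\<^sub>v vec N v) \<bullet>c vec N v = (\<Sum>r<N. (\<Sum>s<N. A $$ (r,s) * v s) * cnj (v r))"
    using assms by (simp add: scalar_prod_def atLeast0LessThan)
  also have "\<dots> = qform N A v"
    unfolding qform_def by (simp add: sum_distrib_left sum_distrib_right mult_ac)
  finally show ?thesis .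
qed

lemma psd_iff_qform:
  "psd N A \<longleftrightarrow> A \<in> carrier_mat N N \<and> (\<forall>v. Im (qform N A v) = 0 \<and> Re (qform N A v) \<ge> 0)"
proof (intro iffI conjI allI)
  fix v assume "psd N A"
  then have "A \<in> carrier_mat N N" "Im ((A *\<^sub>v vec N v) \<bullet>c vec N v) = 0" "Re ((A *\<^sub>v vec N v) \<bullet>c vec N v) \<ge> 0"
    unfolding psd_def by auto
  then show "Im (qform N A v) = 0" "Re (qform N A v) \<ge> 0" by (simp_all add: qform_vec)
next
  assume A: "A \<in> carrier_mat N N \<and> (\<forall>v. Im (qform N A v) = 0 \<and> Re (qform N A v) \<ge> 0)"
  show "psd N A" unfolding psd_def
  proof (intro conjI ballI)
    fix v :: "complex vec" assume v: "v \<in> carrier_vec N"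
    then have "v = vec N (vec_index v)" by auto
    then show "Im ((A *\<^sub>v v) \<bullet>c v) = 0" "Re ((A *\<^sub>v v) \<bullet>c v) \<ge> 0"
      using A qform_vec[of A N "vec_index v"] by auto
  qed (use A in auto)
qed (auto simp: psd_def)

lemma psd_carrier: "psd N A \<Longrightarrow> A \<in> carrier_mat N N"
  by (simp add: psd_def)

lemma qform_two:
  assumes "r < N" "s < N" "r \<noteq> s"
  shows "qform N A (\<lambda>k. if k = r then 1 else if k = s then c else 0)
    = A $$ (r,r) + c * A $$ (r,s) + cnj c * A $$ (s,r) + cnj c * c * A $$ (s,s)"
proof -
  define v where "v = (\<lambda>k. if k = r then 1 else if k = s then c else 0)"
  have *: "(\<Sum>k<N. f k) = (\<Sum>k\<in>{r,s}. f k)" if "\<And>k. k \<notin> {r,s} \<Longrightarrow> f k = 0" for f :: "nat \<Rightarrow> complex"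
    using assms that by (intro sum.mono_neutral_right) auto
  have "qform N A v = (\<Sum>k\<in>{r,s}. \<Sum>l\<in>{r,s}. cnj (v k) * A $$ (k,l) * v l)"
    unfolding qform_def by (subst *, simp add: v_def, rule sum.cong[OF refl], subst *) (auto simp: v_def)
  then show ?thesis using assms by (simp add: v_def algebra_simps)
qed

lemma qform_one:
  assumes "r < N"
  shows "qform N A (\<lambda>k. if k = r then 1 else 0) = A $$ (r,r)"
proof -
  have "qform N A (\<lambda>k. if k = r then 1 else 0) = (\<Sum>k<N. if k = r then \<Sum>l<N. if l = r then A $$ (k,l) else 0 else 0)"
    unfolding qform_def by (intro sum.cong refl) (simp add: if_distrib[of cnj] if_distrib[of "\<lambda>x. _ * x"] if_distrib[of "\<lambda>x. x * _"] cong: if_cong)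
  then show ?thesis using assms by simp
qed

text \<open>Polarization: since all values of the quadratic form are real, the test vectors with
  entries 1 and c at r and s give, for c = 1, opposite imaginary parts and, for c = \<i>, equal real
  parts of the two entries.\<close>

lemma psd_hermitian:
  assumes "psd N A" "r < N" "s < N"
  shows "A $$ (s,r) = cnj (A $$ (r,s))"
proof -
  have q: "Im (qform N A v) = 0" for v using assms(1) by (simp add: psd_iff_qform)
  have d: "Im (A $$ (k,k)) = 0" if "k < N" for k by (subst qform_one[OF that, of A, symmetric]) (rule q)
  show ?thesis
  proof (cases "r = s")
    case True
    then show ?thesis using d[OF assms(2)] by (auto simp: complex_eq_iff)
  next
    case False
    have "Im (A $$ (r,r) + 1 * A $$ (r,s) + cnj 1 * A $$ (s,r) + cnj 1 * 1 * A $$ (s,s)) = 0"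
      by (subst qform_two[OF assms(2,3) False, of A 1, symmetric]) (rule q)
    moreover have "Im (A $$ (r,r) + \<i> * A $$ (r,s) + cnj \<i> * A $$ (s,r) + cnj \<i> * \<i> * A $$ (s,s)) = 0"
      by (subst qform_two[OF assms(2,3) False, of A \<i>, symmetric]) (rule q)
    ultimately show ?thesis using d[OF assms(2)] d[OF assms(3)] by (simp add: complex_eq_iff)
  qed
qed

text \<open>Gram-Schmidt keeps the first vector of a completed basis, and the final normalization
  only rescales it; this accounts for the factor \<open>c\<close>.\<close>

lemma orthonormal_extension:
  assumes v: "v \<in> carrier_vec N" "v \<noteq> 0\<^sub>v N"
  obtains w :: "nat \<Rightarrow> nat \<Rightarrow> complex" and c where
    "\<And>k l. k < N \<Longrightarrow> l < N \<Longrightarrow> (\<Sum>r<N. w k r * cnj (w l r)) = (if k = l then 1 else 0)"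
    "\<And>r. r < N \<Longrightarrow> w 0 r = c * v $ r"
proof -
  interpret cof_vec_space N "TYPE(complex)" .
  define bs where "bs = basis_completion v"
  note bc = basis_completion[OF v, folded bs_def]
  define ws where "ws = gram_schmidt N bs"
  note gs = gram_schmidt_result[OF bc(2,4,5) ws_def]
  have len: "length ws = N" using gs bc by simp
  have N: "N > 0" using v by (cases N) auto
  have "hd ws = v"
    using bc N gram_schmidt_hd[of v "tl bs"] v unfolding ws_def by (cases bs) auto
  then have ws0: "ws ! 0 = v" using len N by (cases ws) auto
  have wsc: "ws ! k \<in> carrier_vec N" if "k < N" for k using gs(3) len that by (auto simp: subset_iff)
  have ip: "ws ! k \<bullet>c ws ! l = (\<Sum>r<N. ws ! k $ r * cnj (ws ! l $ r))" if "k < N" "l < N" for k l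
    using wsc[OF that(1)] wsc[OF that(2)] by (simp add: scalar_prod_def atLeast0LessThan)
  define nr where "nr k = (\<Sum>r<N. (cmod (ws ! k $ r))\<^sup>2)" for k
  have nr: "ws ! k \<bullet>c ws ! k = complex_of_real (nr k)" if "k < N" for k
    unfolding ip[OF that that] nr_def of_real_sum by (intro sum.cong refl) (metis complex_norm_square of_real_power)
  have nr0: "nr k > 0" if "k < N" for k
  proof -
    have "ws ! k \<bullet>c ws ! k \<noteq> 0" using corthogonalD[OF gs(2), of k k] that len by auto
    then have "nr k \<noteq> 0" using nr[OF that] by auto
    moreover have "nr k \<ge> 0" unfolding nr_def by (intro sum_nonneg) auto
    ultimately show ?thesis by simp
  qed
  define w where "w k r = of_real (1 / sqrt (nr k)) * ws ! k $ r" for k r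
  show ?thesis
  proof
    fix k l assume kl: "k < N" "l < N"
    have "(\<Sum>r<N. w k r * cnj (w l r))
        = complex_of_real (1 / sqrt (nr k)) * of_real (1 / sqrt (nr l)) * (ws ! k \<bullet>c ws ! l)"
      unfolding ip[OF kl] w_def by (simp add: sum_distrib_left mult_ac)
    also have "\<dots> = (if k = l then 1 else 0)"
    proof (cases "k = l")
      case True
      have "complex_of_real (1 / sqrt (nr k)) * complex_of_real (1 / sqrt (nr k)) * complex_of_real (nr k)
         = complex_of_real (1 / sqrt (nr k) * (1 / sqrt (nr k)) * nr k)"
        by (simp only: of_real_mult)
      also have "1 / sqrt (nr k) * (1 / sqrt (nr k)) * nr k = 1"
        using nr0[OF kl(1)] by (simp add: field_simps)
      finally have "complex_of_real (1 / sqrt (nr k)) * of_real (1 / sqrt (nr k)) * (ws ! k \<bullet>c ws ! k) = 1"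
        unfolding nr[OF kl(1)] by (simp only: of_real_1)
      then show ?thesis using True by (simp only: if_True refl)
    next
      case False
      then show ?thesis using corthogonalD[OF gs(2), of k l] kl len by auto
    qed
    finally show "(\<Sum>r<N. w k r * cnj (w l r)) = (if k = l then 1 else 0)" .
  next
    fix r assume "r < N"
    show "w 0 r = of_real (1 / sqrt (nr 0)) * v $ r" by (simp add: w_def ws0)
  qed
qed

text \<open>The completeness relation of \<open>w\<close> is inserted on both sides of A.\<close>

lemma change_of_basis:
  assumes w: "\<And>k l. k < N \<Longrightarrow> l < N \<Longrightarrow> (\<Sum>r<N. w k r * cnj (w l r)) = (if k = l then 1 else 0)"
    and B: "\<And>k l. B k l = (\<Sum>r<N. \<Sum>s<N. cnj (w k r) * A $$ (r,s) * w l s)"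
    and rs: "r < N" "s < N"
  shows "A $$ (r,s) = (\<Sum>k<N. \<Sum>l<N. w k r * B k l * cnj (w l s))"
proof -
  have compl: "(\<Sum>k<N. w k i * cnj (w k j)) = (if i = j then 1 else 0)" if "i < N" "j < N" for i j
    using orthonormal_complete[of "{..<N}" N w i j] w that by auto
  have "(\<Sum>k<N. \<Sum>l<N. w k r * B k l * cnj (w l s))
     = (\<Sum>k<N. \<Sum>l<N. \<Sum>i<N. \<Sum>j<N. (w k r * cnj (w k i)) * (A $$ (i,j) * (w l j * cnj (w l s))))"
    unfolding B by (simp add: sum_distrib_left sum_distrib_right mult_ac)
  also have "\<dots> = (\<Sum>i<N. \<Sum>j<N. \<Sum>k<N. \<Sum>l<N. (w k r * cnj (w k i)) * (A $$ (i,j) * (w l j * cnj (w l s))))"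
    by (rule sum_swap22)
  also have "\<dots> = (\<Sum>i<N. \<Sum>j<N. (\<Sum>k<N. w k r * cnj (w k i)) * (A $$ (i,j) * (\<Sum>l<N. w l j * cnj (w l s))))"
    by (intro sum.cong refl) (simp only: sum_distrib_left[of "A $$ _"] sum_product)
  also have "\<dots> = (\<Sum>i<N. \<Sum>j<N. (if r = i then 1 else 0) * (A $$ (i,j) * (if j = s then 1 else 0)))"
    using rs by (intro sum.cong refl) (simp add: compl)
  also have "\<dots> = A $$ (r,s)"
    using rs by (simp add: if_distrib[of "\<lambda>x. x * _"] if_distrib[of "\<lambda>x. _ * x"] cong: if_cong)
  finally show ?thesis by simp
qed

text \<open>Induction on the dimension. In an orthonormal basis that begins with an eigenvector, the
  first row and column of a Hermitian matrix vanish off the diagonal, so the remaining block is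
  again Hermitian and smaller by one.\<close>

lemma specdec_hermitian_exists:
  assumes "A \<in> carrier_mat N N" and "\<And>r s. r < N \<Longrightarrow> s < N \<Longrightarrow> A $$ (s,r) = cnj (A $$ (r,s))"
  shows "\<exists>u b. specdec N A {..<N} u b"
  using assms
proof (induction N arbitrary: A)
  case 0
  then show ?case by (auto simp: specdec_def)
next
  case (Suc n)
  let ?N = "Suc n"
  note A = Suc.prems(1) and herm = Suc.prems(2)
  have "\<not> constant (poly (char_poly A))"
    using degree_monic_char_poly[OF A] by (simp add: constant_degree)
  then obtain e where "poly (char_poly A) e = 0" using fundamental_theorem_of_algebra by blast
  then have "eigenvalue A e" using eigenvalue_root_char_poly[OF A] by simp
  then obtain v where v: "v \<in> carrier_vec ?N" "v \<noteq> 0\<^sub>v ?N" "A *\<^sub>v v = e \<cdot>\<^sub>v v"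
    using A unfolding eigenvalue_def eigenvector_def by auto
  obtain w c where w: "\<And>k l. k < ?N \<Longrightarrow> l < ?N \<Longrightarrow> (\<Sum>r<?N. w k r * cnj (w l r)) = (if k = l then 1 else 0)"
    and w0: "\<And>r. r < ?N \<Longrightarrow> w 0 r = c * v $ r"
    by (rule orthonormal_extension[OF v(1,2)]) (rule that; assumption)
  have eig: "(\<Sum>s<?N. A $$ (r,s) * w 0 s) = e * w 0 r" if "r < ?N" for r
  proof -
    have "(\<Sum>s<?N. A $$ (r,s) * w 0 s) = c * (\<Sum>s<?N. A $$ (r,s) * v $ s)"
      using w0 by (simp add: sum_distrib_left mult_ac del: sum.lessThan_Suc)
    also have "(\<Sum>s<?N. A $$ (r,s) * v $ s) = (A *\<^sub>v v) $ r"
      using A v(1) that by (simp add: scalar_prod_def atLeast0LessThan del: sum.lessThan_Suc)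
    also have "\<dots> = e * v $ r" using v that by simp
    finally show ?thesis using w0[OF that] by simp
  qed
  define B where "B k l = (\<Sum>r<?N. \<Sum>s<?N. cnj (w k r) * A $$ (r,s) * w l s)" for k l
  have Bherm: "B l k = cnj (B k l)" for k l
  proof -
    have "cnj (B k l) = (\<Sum>r<?N. \<Sum>s<?N. cnj (w l s) * A $$ (s,r) * w k r)"
      unfolding B_def cnj_sum
    proof (intro sum.cong refl)
      fix r s assume "r \<in> {..<?N}" "s \<in> {..<?N}"
      then have "A $$ (s,r) = cnj (A $$ (r,s))" by (intro herm) auto
      then show "cnj (cnj (w k r) * A $$ (r,s) * w l s) = cnj (w l s) * A $$ (s,r) * w k r"
        by simp
    qed
    also have "\<dots> = B l k" unfolding B_def by (rule sum.swap)
    finally show ?thesis by simp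
  qed
  have Bk0: "B k 0 = (if k = 0 then e else 0)" if "k < ?N" for k
  proof -
    have "B k 0 = (\<Sum>r<?N. cnj (w k r) * (\<Sum>s<?N. A $$ (r,s) * w 0 s))"
      unfolding B_def by (simp add: sum_distrib_left mult_ac del: sum.lessThan_Suc)
    also have "\<dots> = (\<Sum>r<?N. cnj (w k r) * (e * w 0 r))" by (intro sum.cong refl) (simp add: eig del: sum.lessThan_Suc)
    also have "\<dots> = e * (\<Sum>r<?N. w 0 r * cnj (w k r))" by (simp add: sum_distrib_left mult_ac del: sum.lessThan_Suc)
    also have "\<dots> = (if k = 0 then e else 0)" using w[of 0 k] that by simp
    finally show ?thesis .
  qed
  \<comment> \<open>The eigenvalue is the diagonal entry \<open>B 0 0\<close> of a Hermitian form,
    hence real.\<close>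
  have ereal: "e = complex_of_real (Re e)"
  proof -
    have "e = cnj e" using Bherm[of 0 0] unfolding Bk0[OF zero_less_Suc] by simp
    then have "Im e = - Im e" by (metis cnj.sel(2))
    then show ?thesis by (simp add: complex_eq_iff)
  qed
  have B0l: "B 0 (Suc l) = 0" if "l < n" for l
    using Bherm[of 0 "Suc l"] Bk0[of "Suc l"] that by simp
  define A' where "A' = mat n n (\<lambda>(k,l). B (Suc k) (Suc l))"
  have "\<exists>u b. specdec n A' {..<n} u b"
    by (rule Suc.IH) (auto simp: A'_def intro: Bherm)
  then obtain u b where sd: "specdec n A' {..<n} u b" by blast
  note sdD = specdecD[OF sd]
  \<comment> \<open>The eigenvectors of the block \<open>A'\<close> are coordinates with respect to
    \<open>w 1\<close>, ..., \<open>w n\<close>; \<open>u'\<close> writes them in the original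
    coordinates and puts the split-off eigenvector in front.\<close>
  define u' where "u' x r = (case x of 0 \<Rightarrow> w 0 r | Suc y \<Rightarrow> \<Sum>k<n. u y k * w (Suc k) r)" for x r
  define b' where "b' x = (case x of 0 \<Rightarrow> Re e | Suc y \<Rightarrow> b y)" for x
  have ip0: "(\<Sum>r<?N. w 0 r * cnj (\<Sum>k<n. u y k * w (Suc k) r)) = 0" if "y < n" for y
  proof -
    have "(\<Sum>r<?N. w 0 r * cnj (\<Sum>k<n. u y k * w (Suc k) r))
       = (\<Sum>k<n. cnj (u y k) * (\<Sum>r<?N. w 0 r * cnj (w (Suc k) r)))"
      unfolding cnj_sum sum_distrib_left by (subst sum.swap) (simp add: mult_ac del: sum.lessThan_Suc)
    also have "\<dots> = 0" by (intro sum.neutral ballI) (use w[of 0] in auto)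
    finally show ?thesis .
  qed
  have ip0': "(\<Sum>r<?N. (\<Sum>k<n. u y k * w (Suc k) r) * cnj (w 0 r)) = 0" if "y < n" for y
    using arg_cong[where f = cnj, OF ip0[OF that]] unfolding cnj_sum complex_cnj_mult complex_cnj_cnj
    by (simp add: mult.commute)
  have ip1: "(\<Sum>r<?N. (\<Sum>k<n. u x k * w (Suc k) r) * cnj (\<Sum>k<n. u y k * w (Suc k) r)) = (if x = y then 1 else 0)"
    if "x < n" "y < n" for x y
  proof -
    have "(\<Sum>r<?N. (\<Sum>k<n. u x k * w (Suc k) r) * cnj (\<Sum>k<n. u y k * w (Suc k) r))
       = (\<Sum>r<?N. \<Sum>k<n. \<Sum>l<n. u x k * cnj (u y l) * (w (Suc k) r * cnj (w (Suc l) r)))"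
      unfolding cnj_sum sum_product by (simp add: mult_ac del: sum.lessThan_Suc)
    also have "\<dots> = (\<Sum>k<n. \<Sum>l<n. u x k * cnj (u y l) * (\<Sum>r<?N. w (Suc k) r * cnj (w (Suc l) r)))"
      unfolding sum_distrib_left by (rule sum_rotate3[symmetric])
    also have "\<dots> = (\<Sum>k<n. \<Sum>l<n. if k = l then u x k * cnj (u y l) else 0)"
      by (intro sum.cong refl) (use w in auto)
    also have "\<dots> = (\<Sum>k<n. u x k * cnj (u y k))" by simp
    also have "\<dots> = (if x = y then 1 else 0)" using sdD(4) that by auto
    finally show ?thesis .
  qed
  have "specdec ?N A {..<?N} u' b'"
    unfolding specdec_def
  proof (intro conjI ballI allI impI)
    fix x y assume "x \<in> {..<?N}" "y \<in> {..<?N}"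
    then show "(\<Sum>r<?N. u' x r * cnj (u' y r)) = (if x = y then 1 else 0)"
      using ip0 ip0' ip1 w[of 0 0]
      by (cases x; cases y) (auto simp: u'_def simp del: sum.lessThan_Suc cnj_sum)
  next
    fix r s assume rs: "r < ?N" "s < ?N"
    have "A $$ (r,s) = (\<Sum>k<?N. \<Sum>l<?N. w k r * B k l * cnj (w l s))"
      by (rule change_of_basis[OF w _ rs]) (auto simp: B_def)
    also have "\<dots> = w 0 r * B 0 0 * cnj (w 0 s)
        + (\<Sum>k<n. \<Sum>l<n. w (Suc k) r * B (Suc k) (Suc l) * cnj (w (Suc l) s))"
      unfolding sum.lessThan_Suc_shift by (simp add: B0l Bk0)
    also have "(\<Sum>k<n. \<Sum>l<n. w (Suc k) r * B (Suc k) (Suc l) * cnj (w (Suc l) s))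
        = (\<Sum>k<n. \<Sum>l<n. \<Sum>x<n. of_real (b x) * (u x k * w (Suc k) r) * cnj (u x l * w (Suc l) s))"
    proof (intro sum.cong refl)
      fix k l assume kl: "k \<in> {..<n}" "l \<in> {..<n}"
      then have "B (Suc k) (Suc l) = (\<Sum>x<n. of_real (b x) * u x k * cnj (u x l))"
        using sdD(5)[of k l] by (simp add: A'_def)
      then show "w (Suc k) r * B (Suc k) (Suc l) * cnj (w (Suc l) s) =
         (\<Sum>x<n. of_real (b x) * (u x k * w (Suc k) r) * cnj (u x l * w (Suc l) s))"
        by (simp add: sum_distrib_left sum_distrib_right mult_ac)
    qed
    also have "\<dots> = (\<Sum>x<n. \<Sum>k<n. \<Sum>l<n. of_real (b x) * (u x k * w (Suc k) r) * cnj (u x l * w (Suc l) s))"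
      by (rule sum_rotate3)
    also have "\<dots> = (\<Sum>x<n. of_real (b x) * u' (Suc x) r * cnj (u' (Suc x) s))"
      unfolding u'_def cnj_sum nat.case sum_distrib_left sum_distrib_right
      by (rule sum.cong[OF refl], subst sum.swap) (rule refl)
    also have "w 0 r * B 0 0 * cnj (w 0 s) = of_real (b' 0) * u' 0 r * cnj (u' 0 s)"
      using ereal by (simp add: Bk0 u'_def b'_def)
    finally show "A $$ (r,s) = (\<Sum>x<?N. of_real (b' x) * u' x r * cnj (u' x s))"
      unfolding sum.lessThan_Suc_shift by (simp add: b'_def)
  qed (use A in auto)
  then show ?case by blast
qed

lemma specdec_qform:
  assumes "specdec N A X u b" "x \<in> X"
  shows "qform N A (u x) = complex_of_real (b x)"
proof -
  note sd = specdecD[OF assms(1)]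
  have "qform N A (u x) = (\<Sum>r<N. \<Sum>s<N. \<Sum>y\<in>X. of_real (b y) * (u y r * cnj (u x r)) * (u x s * cnj (u y s)))"
    unfolding qform_def by (intro sum.cong refl) (simp add: sd(5) sum_distrib_left sum_distrib_right mult_ac)
  also have "\<dots> = (\<Sum>y\<in>X. \<Sum>r<N. \<Sum>s<N. of_real (b y) * (u y r * cnj (u x r)) * (u x s * cnj (u y s)))"
    by (rule sum_rotate3)
  also have "\<dots> = (\<Sum>y\<in>X. of_real (b y) * (\<Sum>r<N. u y r * cnj (u x r)) * (\<Sum>s<N. u x s * cnj (u y s)))"
    by (simp add: sum_distrib_left sum_distrib_right mult_ac)
  also have "\<dots> = (\<Sum>y\<in>X. if y = x then complex_of_real (b y) else 0)"
    by (intro sum.cong refl) (use sd(4) assms(2) in auto)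
  also have "\<dots> = complex_of_real (b x)" using sd(2) assms(2) by simp
  finally show ?thesis .
qed

lemma specdec_nonneg: "specdec N A X u b \<Longrightarrow> psd N A \<Longrightarrow> x \<in> X \<Longrightarrow> b x \<ge> 0"
  using specdec_qform[of N A X u b x] unfolding psd_iff_qform by (metis Re_complex_of_real)

lemma specdec_psd_exists:
  assumes "psd N A"
  shows "\<exists>u b. specdec N A {..<N} u b \<and> (\<forall>x<N. b x \<ge> 0)"
  using specdec_hermitian_exists[of A N] psd_hermitian[OF assms] psd_carrier[OF assms]
    specdec_nonneg[OF _ assms] by (metis lessThan_iff)

lemma specdec_trace:
  assumes "specdec N A X u b"
  shows "mtrace A = complex_of_real (\<Sum>x\<in>X. b x)"
proof -
  note sd = specdecD[OF assms]
  have "mtrace A = (\<Sum>r<N. \<Sum>x\<in>X. of_real (b x) * (u x r * cnj (u x r)))"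
    unfolding mtrace_def using sd by (auto intro!: sum.cong simp: mult_ac)
  also have "\<dots> = (\<Sum>x\<in>X. of_real (b x) * (\<Sum>r<N. u x r * cnj (u x r)))"
    by (subst sum.swap) (simp add: sum_distrib_left)
  finally show ?thesis using sd(4) by simp
qed

section \<open>Sums, scalar multiples, traces and direct sums\<close>

lemma msum_carrier [simp]: "msum n f A \<in> carrier_mat n n"
  by (simp add: msum_def)

lemma msum_index [simp]: "r < n \<Longrightarrow> s < n \<Longrightarrow> msum n f A $$ (r,s) = (\<Sum>x\<in>A. f x $$ (r,s))"
  by (simp add: msum_def)

lemma msum_dim [simp]: "dim_row (msum n f A) = n" "dim_col (msum n f A) = n"
  by (simp_all add: msum_def)

lemma qform_msum: "qform N (msum N f A) v = (\<Sum>x\<in>A. qform N (f x) v)"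
proof -
  have "qform N (msum N f A) v = (\<Sum>r<N. \<Sum>s<N. \<Sum>x\<in>A. cnj (v r) * f x $$ (r,s) * v s)"
    unfolding qform_def by (intro sum.cong refl) (simp add: sum_distrib_left sum_distrib_right)
  also have "\<dots> = (\<Sum>x\<in>A. qform N (f x) v)"
    unfolding qform_def by (rule sum_rotate3)
  finally show ?thesis .
qed

lemma qform_smult:
  assumes "A \<in> carrier_mat N N"
  shows "qform N (c \<cdot>\<^sub>m A) v = c * qform N A v"
  using assms unfolding qform_def sum_distrib_left by (intro sum.cong refl) auto

lemma psd_smult: "psd N A \<Longrightarrow> c \<ge> 0 \<Longrightarrow> psd N (of_real c \<cdot>\<^sub>m A)"
  by (auto simp: psd_iff_qform qform_smult)

lemma psd_msum: "(\<And>x. x \<in> A \<Longrightarrow> psd N (f x)) \<Longrightarrow> psd N (msum N f A)"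
  by (auto simp: psd_iff_qform qform_msum intro!: sum_nonneg)

lemma psd_zero: "psd N (0\<^sub>m N N)"
  by (auto simp: psd_iff_qform qform_def)

lemma mtrace_smult: "A \<in> carrier_mat N N \<Longrightarrow> mtrace (c \<cdot>\<^sub>m A) = c * mtrace A"
  by (auto simp: mtrace_def sum_distrib_left)

lemma mtrace_msum:
  "(\<And>x. x \<in> A \<Longrightarrow> f x \<in> carrier_mat N N) \<Longrightarrow> mtrace (msum N f A) = (\<Sum>x\<in>A. mtrace (f x))"
proof -
  assume "\<And>x. x \<in> A \<Longrightarrow> f x \<in> carrier_mat N N"
  then have "(\<Sum>x\<in>A. mtrace (f x)) = (\<Sum>x\<in>A. \<Sum>i<N. f x $$ (i,i))"
    unfolding mtrace_def by (intro sum.cong) auto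
  also have "\<dots> = (\<Sum>i<N. \<Sum>x\<in>A. f x $$ (i,i))" by (rule sum.swap)
  finally show ?thesis by (simp add: mtrace_def)
qed

lemma psd_diag: "psd N A \<Longrightarrow> r < N \<Longrightarrow> A $$ (r,r) = complex_of_real (Re (A $$ (r,r))) \<and> Re (A $$ (r,r)) \<ge> 0"
proof -
  assume "psd N A" "r < N"
  then have "Im (A $$ (r,r)) = 0" "Re (A $$ (r,r)) \<ge> 0"
    unfolding psd_iff_qform by (metis qform_one)+
  then show ?thesis by (simp add: complex_eq_iff)
qed

lemma psd_mtrace_nonneg: "psd N A \<Longrightarrow> Re (mtrace A) \<ge> 0"
  using psd_carrier[of N A] psd_diag[of N A] by (auto simp: mtrace_def intro!: sum_nonneg)

lemma psd_mtrace_real: "psd N A \<Longrightarrow> mtrace A = complex_of_real (Re (mtrace A))"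
  using psd_carrier[of N A] psd_diag[of N A] by (auto simp: mtrace_def intro!: sum.cong)

lemma specdec_smult:
  assumes "specdec N A X u b"
  shows "specdec N (of_real c \<cdot>\<^sub>m A) X u (\<lambda>x. c * b x)"
  using assms unfolding specdec_def by (auto simp: sum_distrib_left mult_ac)

text \<open>Entropies of operators of arbitrary trace are needed because weights are absorbed into
  the operators. The term with \<open>ent c\<close> is the classical entropy of the weight.\<close>

lemma vn_entropy_smult:
  assumes "psd N A" "c \<ge> 0"
  shows "vn_entropy (of_real c \<cdot>\<^sub>m A) = c * vn_entropy A + ent c * Re (mtrace A)"
proof -
  obtain u b where sd: "specdec N A {..<N} u b" and b: "\<And>x. x < N \<Longrightarrow> b x \<ge> 0"
    using specdec_psd_exists[OF assms(1)] by blast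
  have "vn_entropy (of_real c \<cdot>\<^sub>m A) = (\<Sum>x<N. ent (c * b x))"
    by (rule specdec_entropy[OF specdec_smult[OF sd]])
  also have "\<dots> = (\<Sum>x<N. c * ent (b x) + ent c * b x)"
    using assms b by (intro sum.cong refl) (simp add: ent_mult)
  also have "\<dots> = c * vn_entropy A + ent c * Re (mtrace A)"
    by (simp add: specdec_entropy[OF sd] specdec_trace[OF sd] sum.distrib sum_distrib_left)
  finally show ?thesis .
qed

lemma vn_entropy_diag:
  assumes "A \<in> carrier_mat N N"
    and "\<And>r s. r < N \<Longrightarrow> s < N \<Longrightarrow> A $$ (r,s) = (if r = s then complex_of_real (t r) else 0)"
  shows "vn_entropy A = (\<Sum>r<N. ent (t r))"
proof (rule specdec_entropy)
  show "specdec N A {..<N} (\<lambda>x r. if x = r then 1 else 0) t"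
    unfolding specdec_def using assms
    by (auto simp: if_distrib[of cnj] if_distrib[of "\<lambda>x. x * _"] if_distrib[of "\<lambda>x. _ * x"] cong: if_cong)
qed

lemma vn_entropy_zero [simp]: "vn_entropy (0\<^sub>m N N) = 0"
  by (subst vn_entropy_diag[where N = N and t = "\<lambda>_. 0"]) auto

text \<open>The map \<open>g\<close> relabels the basis so that A becomes a direct sum, whose
  eigenvectors are those of the blocks extended by zero. Since \<open>g\<close> is arbitrary, a
  classical register may sit at any place in the tensor product.\<close>

lemma vn_entropy_block:
  fixes B :: "'y \<Rightarrow> complex mat"
  assumes fin: "finite Y" and psd: "\<And>y. y \<in> Y \<Longrightarrow> psd n (B y)"
    and g: "bij_betw (\<lambda>(y,r). g y r) (Y \<times> {..<n}) {..<N}" and A: "A \<in> carrier_mat N N"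
    and block: "\<And>y y' r r'. y \<in> Y \<Longrightarrow> y' \<in> Y \<Longrightarrow> r < n \<Longrightarrow> r' < n \<Longrightarrow>
      A $$ (g y r, g y' r') = (if y = y' then B y $$ (r,r') else 0)"
  shows "vn_entropy A = (\<Sum>y\<in>Y. vn_entropy (B y))"
proof -
  have "\<forall>y\<in>Y. \<exists>u b. specdec n (B y) {..<n} u b"
    using specdec_psd_exists[OF psd] by metis
  then obtain u b where sd: "\<And>y. y \<in> Y \<Longrightarrow> specdec n (B y) {..<n} (u y) (b y)"
    by metis
  define G where "G = inv_into (Y \<times> {..<n}) (\<lambda>(y,r). g y r)"
  have G: "G (g y r) = (y,r)" if "y \<in> Y" "r < n" for y r
    unfolding G_def using inv_into_f_f[of "\<lambda>(y,r). g y r" "Y \<times> {..<n}" "(y,r)"] g that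
    by (auto simp: bij_betw_def)
  have surj: "\<exists>y\<in>Y. \<exists>r<n. i = g y r" if "i < N" for i
  proof -
    have "i \<in> (\<lambda>(y,r). g y r) ` (Y \<times> {..<n})" using g that by (simp add: bij_betw_def)
    then show ?thesis by auto
  qed
  define U where "U z i = (if fst z = fst (G i) then u (fst z) (snd z) (snd (G i)) else 0)" for z i
  have U: "U (y,x) (g y' r) = (if y = y' then u y x r else 0)" if "y' \<in> Y" "r < n" for y x y' r
    by (simp add: U_def G that)
  have reindex: "(\<Sum>i<N. f i) = (\<Sum>y\<in>Y. \<Sum>r<n. f (g y r))" for f :: "nat \<Rightarrow> complex"
    using sum.reindex_bij_betw[OF g, of f] by (simp add: sum.cartesian_product split_def)
  have "specdec N A (Y \<times> {..<n}) U (\<lambda>z. b (fst z) (snd z))"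
    unfolding specdec_def
  proof (intro conjI ballI allI impI)
    show "card (Y \<times> {..<n}) = N" using bij_betw_same_card[OF g] by simp
  next
    fix z z' assume z: "z \<in> Y \<times> {..<n}" "z' \<in> Y \<times> {..<n}"
    obtain y x y' x' where zz: "z = (y,x)" "z' = (y',x')" by (cases z, cases z')
    have "(\<Sum>i<N. U z i * cnj (U z' i)) = (\<Sum>k\<in>Y. \<Sum>r<n. if k = y then (if y = y' then u y x r * cnj (u y x' r) else 0) else 0)"
      unfolding reindex zz by (intro sum.cong refl) (auto simp: U)
    also have "\<dots> = (\<Sum>k\<in>Y. if k = y then \<Sum>r<n. (if y = y' then u y x r * cnj (u y x' r) else 0) else 0)"
      by (intro sum.cong refl) auto
    also have "\<dots> = (\<Sum>r<n. (if y = y' then u y x r * cnj (u y x' r) else 0))"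
      using fin z zz by simp
    also have "\<dots> = (if z = z' then 1 else 0)"
      using specdecD(4)[OF sd, of y x x'] z zz by (cases "y = y'") auto
    finally show "(\<Sum>i<N. U z i * cnj (U z' i)) = (if z = z' then 1 else 0)" .
  next
    fix i j assume "i < N" "j < N"
    then obtain y r y' r' where ij: "y \<in> Y" "r < n" "i = g y r" "y' \<in> Y" "r' < n" "j = g y' r'"
      using surj by metis
    have "(\<Sum>z\<in>Y \<times> {..<n}. of_real (b (fst z) (snd z)) * U z i * cnj (U z j))
      = (\<Sum>k\<in>Y. \<Sum>x<n. of_real (b k x) * U (k,x) i * cnj (U (k,x) j))"
      by (simp add: sum.cartesian_product split_def)
    also have "\<dots> = (\<Sum>k\<in>Y. if k = y then (\<Sum>x<n. if y = y' then of_real (b y x) * u y x r * cnj (u y x r') else 0) else 0)"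
      unfolding ij(3,6) using ij by (intro sum.cong refl) (auto simp: U intro!: sum.cong)
    also have "\<dots> = (\<Sum>x<n. if y = y' then of_real (b y x) * u y x r * cnj (u y x r') else 0)"
      using fin ij by simp
    also have "\<dots> = A $$ (i,j)"
      unfolding ij(3,6) block[OF ij(1,4,2,5)] using specdecD(5)[OF sd[OF ij(1)] ij(2,5)] by (cases "y = y'") auto
    finally show "A $$ (i,j) = (\<Sum>z\<in>Y \<times> {..<n}. of_real (b (fst z) (snd z)) * U z i * cnj (U z j))"
      by simp
  qed (use A fin in auto)
  then have "vn_entropy A = (\<Sum>z\<in>Y \<times> {..<n}. ent (b (fst z) (snd z)))"
    by (rule specdec_entropy)
  also have "\<dots> = (\<Sum>y\<in>Y. \<Sum>x<n. ent (b y x))"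
    by (simp add: sum.cartesian_product split_def)
  also have "\<dots> = (\<Sum>y\<in>Y. vn_entropy (B y))"
    by (intro sum.cong refl) (simp add: specdec_entropy[OF sd])
  finally show ?thesis .
qed

section \<open>Tensor indices as digits, and Kronecker products\<close>

lemma mult_add_less: "(x::nat) < a \<Longrightarrow> y < b \<Longrightarrow> x * b + y < a * b"
proof -
  assume "x < a" "y < b"
  then have "x * b + y < Suc x * b" by simp
  also have "\<dots> \<le> a * b" using \<open>x < a\<close> by (intro mult_right_mono) auto
  finally show ?thesis .
qed

lemma div_mod_mult_add [simp]:
  assumes "(y::nat) < b"
  shows "(x * b + y) div b = x" "(x * b + y) mod b = y"
  using assms by (auto simp: div_mult_self3)

lemma bij_mult_add: "bij_betw (\<lambda>(x,y). x * b + y) ({..<a} \<times> {..<b}) {..<(a * b :: nat)}"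
  by (rule bij_betwI[where g = "\<lambda>i. (i div b, i mod b)"])
     (auto simp: mult_add_less less_mult_imp_div_less intro!: mod_less_divisor intro: gr0I)

lemma sum_mult_add: "(\<Sum>i<a * b. f i) = (\<Sum>x<a. \<Sum>y<(b::nat). f (x * b + y))"
  using sum.reindex_bij_betw[OF bij_mult_add, of f b a] by (simp add: sum.cartesian_product split_def)

lemma kron_carrier: "A \<in> carrier_mat N N \<Longrightarrow> B \<in> carrier_mat M M \<Longrightarrow> kron A B \<in> carrier_mat (N * M) (N * M)"
  by (auto simp: kron_def)

lemma kron_index:
  "A \<in> carrier_mat N N \<Longrightarrow> B \<in> carrier_mat M M \<Longrightarrow> i < N * M \<Longrightarrow> j < N * M \<Longrightarrow>
    kron A B $$ (i,j) = A $$ (i div M, j div M) * B $$ (i mod M, j mod M)"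
  by (auto simp: kron_def)

lemma specdec_kron:
  assumes "specdec N A X u b" "specdec M B Y v c"
  shows "specdec (N * M) (kron A B) (X \<times> Y) (\<lambda>(x,y) i. u x (i div M) * v y (i mod M)) (\<lambda>(x,y). b x * c y)"
proof -
  note A = specdecD[OF assms(1)] and B = specdecD[OF assms(2)]
  show ?thesis unfolding specdec_def
  proof (intro conjI ballI allI impI)
    fix z z' assume z: "z \<in> X \<times> Y" "z' \<in> X \<times> Y"
    obtain x y x' y' where zz: "z = (x,y)" "z' = (x',y')" by (cases z, cases z')
    have "(\<Sum>i<N * M. (case z of (x,y) \<Rightarrow> \<lambda>i. u x (i div M) * v y (i mod M)) i *
        cnj ((case z' of (x,y) \<Rightarrow> \<lambda>i. u x (i div M) * v y (i mod M)) i))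
      = (\<Sum>r<N. \<Sum>s<M. (u x r * cnj (u x' r)) * (v y s * cnj (v y' s)))"
      unfolding sum_mult_add zz by (intro sum.cong refl) (simp add: mult_ac)
    also have "\<dots> = (\<Sum>r<N. u x r * cnj (u x' r)) * (\<Sum>s<M. v y s * cnj (v y' s))"
      by (rule sum_product[symmetric])
    also have "\<dots> = (if z = z' then 1 else 0)" using A(4) B(4) z zz by auto
    finally show "(\<Sum>i<N * M. (case z of (x,y) \<Rightarrow> \<lambda>i. u x (i div M) * v y (i mod M)) i *
        cnj ((case z' of (x,y) \<Rightarrow> \<lambda>i. u x (i div M) * v y (i mod M)) i)) = (if z = z' then 1 else 0)" .
  next
    fix i j assume ij: "i < N * M" "j < N * M"
    then have M: "M > 0" by (cases M) auto
    have dm: "i div M < N" "j div M < N" "i mod M < M" "j mod M < M"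
      using ij M by (auto simp: less_mult_imp_div_less)
    have "kron A B $$ (i,j) = (\<Sum>x\<in>X. of_real (b x) * u x (i div M) * cnj (u x (j div M)))
       * (\<Sum>y\<in>Y. of_real (c y) * v y (i mod M) * cnj (v y (j mod M)))"
      using kron_index[OF A(1) B(1) ij] A(5)[OF dm(1,2)] B(5)[OF dm(3,4)] by simp
    also have "\<dots> = (\<Sum>z\<in>X \<times> Y. complex_of_real (case z of (x,y) \<Rightarrow> b x * c y) *
        (case z of (x,y) \<Rightarrow> \<lambda>i. u x (i div M) * v y (i mod M)) i *
        cnj ((case z of (x,y) \<Rightarrow> \<lambda>i. u x (i div M) * v y (i mod M)) j))"
      unfolding sum_product sum.cartesian_product by (intro sum.cong refl) (auto simp: mult_ac)
    finally show "kron A B $$ (i,j) = (\<Sum>z\<in>X \<times> Y. complex_of_real (case z of (x,y) \<Rightarrow> b x * c y) *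
        (case z of (x,y) \<Rightarrow> \<lambda>i. u x (i div M) * v y (i mod M)) i *
        cnj ((case z of (x,y) \<Rightarrow> \<lambda>i. u x (i div M) * v y (i mod M)) j))" .
  qed (use A B in \<open>auto simp: kron_carrier card_cartesian_product\<close>)
qed

text \<open>Products of eigenvalues are the eigenvalues of the tensor product, and
  \<open>ent_mult\<close> splits each of them. For traces equal to one this is additivity.\<close>

lemma vn_entropy_kron:
  assumes "psd N A" "psd M B"
  shows "vn_entropy (kron A B) = vn_entropy A * Re (mtrace B) + vn_entropy B * Re (mtrace A)"
proof -
  obtain u b where A: "specdec N A {..<N} u b" and b: "\<And>x. x < N \<Longrightarrow> b x \<ge> 0"
    using specdec_psd_exists[OF assms(1)] by blast
  obtain v c where B: "specdec M B {..<M} v c" and c: "\<And>x. x < M \<Longrightarrow> c x \<ge> 0"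
    using specdec_psd_exists[OF assms(2)] by blast
  have "vn_entropy (kron A B) = (\<Sum>z\<in>{..<N} \<times> {..<M}. ent (case z of (x,y) \<Rightarrow> b x * c y))"
    by (rule specdec_entropy[OF specdec_kron[OF A B]])
  also have "\<dots> = (\<Sum>x<N. \<Sum>y<M. ent (b x * c y))"
    by (simp add: sum.cartesian_product split_def)
  also have "\<dots> = (\<Sum>x<N. \<Sum>y<M. ent (b x) * c y + b x * ent (c y))"
    by (intro sum.cong refl) (simp add: ent_mult b c)
  also have "\<dots> = (\<Sum>x<N. ent (b x)) * (\<Sum>y<M. c y) + (\<Sum>x<N. b x) * (\<Sum>y<M. ent (c y))"
    by (simp only: sum.distrib sum_product)
  also have "\<dots> = vn_entropy A * Re (mtrace B) + vn_entropy B * Re (mtrace A)"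
    by (simp add: specdec_entropy[OF A] specdec_entropy[OF B] specdec_trace[OF A] specdec_trace[OF B])
  finally show ?thesis .
qed

lemma mtrace_kron:
  assumes "A \<in> carrier_mat N N" "B \<in> carrier_mat M M"
  shows "mtrace (kron A B) = mtrace A * mtrace B"
proof -
  have "mtrace (kron A B) = (\<Sum>i<N * M. kron A B $$ (i,i))"
    using kron_carrier[OF assms] by (simp add: mtrace_def)
  also have "\<dots> = (\<Sum>x<N. \<Sum>y<M. A $$ (x,x) * B $$ (y,y))"
    unfolding sum_mult_add by (intro sum.cong refl) (simp add: kron_index[OF assms] mult_add_less)
  finally show ?thesis using assms by (simp add: mtrace_def sum_product)
qed

section \<open>Completely positive maps\<close>

definition ip :: "nat \<Rightarrow> (nat \<Rightarrow> complex) \<Rightarrow> (nat \<Rightarrow> complex) \<Rightarrow> complex" where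
  "ip N u v = (\<Sum>r<N. cnj (u r) * v r)"

definition outer :: "nat \<Rightarrow> (nat \<Rightarrow> complex) \<Rightarrow> (nat \<Rightarrow> complex) \<Rightarrow> complex mat" where
  "outer N e f = mat N N (\<lambda>(r,s). e r * cnj (f s))"

lemma outer_carrier [simp]: "outer N e f \<in> carrier_mat N N"
  by (simp add: outer_def)

lemma mult_cnj_cmod: "z * cnj z = (complex_of_real (cmod z))\<^sup>2"
  by (metis complex_norm_square of_real_power)

lemma ip_self: "ip N v v = complex_of_real (\<Sum>r<N. (cmod (v r))\<^sup>2)"
  unfolding ip_def of_real_sum by (intro sum.cong refl) (simp add: mult_cnj_cmod mult.commute[of "cnj _"])

lemma cnj_ip: "cnj (ip N u v) = ip N v u"
  by (simp add: ip_def mult.commute)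

lemma qform_outer: "qform N (outer N e e) v = complex_of_real ((cmod (ip N e v))\<^sup>2)"
proof -
  have "qform N (outer N e e) v = (\<Sum>r<N. \<Sum>s<N. (cnj (v r) * e r) * (cnj (e s) * v s))"
    unfolding qform_def by (intro sum.cong refl) (simp add: outer_def)
  also have "\<dots> = ip N v e * ip N e v" unfolding ip_def by (rule sum_product[symmetric])
  also have "\<dots> = complex_of_real ((cmod (ip N e v))\<^sup>2)"
    unfolding cnj_ip[symmetric, of N v e] by (simp add: mult_cnj_cmod mult.commute[of "cnj _"])
  finally show ?thesis .
qed

lemma psd_outer: "psd N (outer N e e)"
  by (simp add: psd_iff_qform qform_outer)

lemma qform_specdec:
  assumes "specdec N A X u b"
  shows "qform N A v = complex_of_real (\<Sum>x\<in>X. b x * (cmod (ip N (u x) v))\<^sup>2)"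
proof -
  note sd = specdecD[OF assms]
  have "qform N A v = (\<Sum>r<N. \<Sum>s<N. \<Sum>x\<in>X. of_real (b x) * (cnj (v r) * u x r * (cnj (u x s) * v s)))"
    unfolding qform_def by (intro sum.cong refl) (simp add: sd(5) sum_distrib_left sum_distrib_right mult_ac)
  also have "\<dots> = (\<Sum>x\<in>X. \<Sum>r<N. \<Sum>s<N. of_real (b x) * (cnj (v r) * u x r * (cnj (u x s) * v s)))"
    by (rule sum_rotate3)
  also have "\<dots> = (\<Sum>x\<in>X. of_real (b x) * (ip N v (u x) * ip N (u x) v))"
    unfolding ip_def by (simp only: sum_product, simp only: sum_distrib_left)
  also have "\<dots> = (\<Sum>x\<in>X. complex_of_real (b x * (cmod (ip N (u x) v))\<^sup>2))"
    unfolding cnj_ip[symmetric, of N v]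
    by (intro sum.cong refl) (simp add: mult_cnj_cmod mult.commute[of "cnj _"])
  finally show ?thesis by simp
qed

text \<open>The eigenvectors of A also diagonalize the identity, with all eigenvalues 1, so this is
  the spectral form of its quadratic form.\<close>

lemma parseval:
  assumes "specdec N A X u b"
  shows "(\<Sum>r<N. (cmod (v r))\<^sup>2) = (\<Sum>x\<in>X. (cmod (ip N (u x) v))\<^sup>2)"
proof -
  have "specdec N (1\<^sub>m N) X u (\<lambda>_. 1)"
    using assms specdec_complete[OF assms] unfolding specdec_def by auto
  then have "qform N (1\<^sub>m N) v = complex_of_real (\<Sum>x\<in>X. (cmod (ip N (u x) v))\<^sup>2)"
    by (simp add: qform_specdec)
  moreover have "qform N (1\<^sub>m N) v = ip N v v"
    unfolding qform_def ip_def
    by (intro sum.cong refl) (simp add: if_distrib[of "\<lambda>x. x * _"] if_distrib[of "\<lambda>x. _ * x"] cong: if_cong)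
  ultimately show ?thesis unfolding ip_self by (metis of_real_eq_iff)
qed

lemma norm_orthonormal_comb:
  assumes "finite X" and "\<And>x y. x \<in> X \<Longrightarrow> y \<in> X \<Longrightarrow> (\<Sum>r<N. u x r * cnj (u y r)) = (if x = y then 1 else 0)"
  shows "(\<Sum>r<N. (cmod (\<Sum>x\<in>X. d x * u x r))\<^sup>2) = (\<Sum>x\<in>X. (cmod (d x))\<^sup>2)"
proof -
  have "complex_of_real (\<Sum>r<N. (cmod (\<Sum>x\<in>X. d x * u x r))\<^sup>2)
     = (\<Sum>r<N. (\<Sum>x\<in>X. d x * u x r) * cnj (\<Sum>x\<in>X. d x * u x r))"
    unfolding of_real_sum by (intro sum.cong refl) (simp add: mult_cnj_cmod del: cnj_sum)
  also have "\<dots> = (\<Sum>r<N. \<Sum>x\<in>X. \<Sum>y\<in>X. d x * cnj (d y) * (u x r * cnj (u y r)))"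
    unfolding cnj_sum sum_product by (intro sum.cong refl) (simp add: mult_ac)
  also have "\<dots> = (\<Sum>x\<in>X. \<Sum>y\<in>X. \<Sum>r<N. d x * cnj (d y) * (u x r * cnj (u y r)))"
    by (rule sum_rotate3[symmetric])
  also have "\<dots> = (\<Sum>x\<in>X. \<Sum>y\<in>X. if x = y then d x * cnj (d y) else 0)"
    unfolding sum_distrib_left[symmetric] by (intro sum.cong refl) (simp add: assms(2))
  also have "\<dots> = (\<Sum>x\<in>X. d x * cnj (d x))" using assms(1) by simp
  also have "\<dots> = complex_of_real (\<Sum>x\<in>X. (cmod (d x))\<^sup>2)"
    unfolding of_real_sum by (intro sum.cong refl) (simp add: mult_cnj_cmod)
  finally show ?thesis by (metis of_real_eq_iff)
qed

section \<open>Two-positivity and the Schwarz inequality\<close>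

lemma lin_map_carrier: "lin_map M N \<Phi> \<Longrightarrow> X \<in> carrier_mat M M \<Longrightarrow> \<Phi> X \<in> carrier_mat N N"
  by (auto simp: lin_map_def)

lemma lin_map_msum:
  assumes lin: "lin_map M N \<Phi>" and "finite A" and "\<And>x. x \<in> A \<Longrightarrow> B x \<in> carrier_mat M M"
  shows "\<Phi> (msum M (\<lambda>x. c x \<cdot>\<^sub>m B x) A) = msum N (\<lambda>x. c x \<cdot>\<^sub>m \<Phi> (B x)) A"
  using assms(2,3)
proof (induction A rule: finite_induct)
  case empty
  have "\<Phi> (0 \<cdot>\<^sub>m 0\<^sub>m M M) = 0 \<cdot>\<^sub>m \<Phi> (0\<^sub>m M M)"
    using lin unfolding lin_map_def by (metis zero_carrier_mat)
  moreover have "(0 :: complex) \<cdot>\<^sub>m 0\<^sub>m M M = msum M (\<lambda>x. c x \<cdot>\<^sub>m B x) {}" by (intro eq_matI) auto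
  moreover have "0 \<cdot>\<^sub>m \<Phi> (0\<^sub>m M M) = msum N (\<lambda>x. c x \<cdot>\<^sub>m \<Phi> (B x)) {}"
    using lin_map_carrier[OF lin, of "0\<^sub>m M M"] by (intro eq_matI) auto
  ultimately show ?case by simp
next
  case (insert x A)
  have Bx: "B x \<in> carrier_mat M M" using insert by auto
  have "msum M (\<lambda>x. c x \<cdot>\<^sub>m B x) (insert x A) = c x \<cdot>\<^sub>m B x + msum M (\<lambda>x. c x \<cdot>\<^sub>m B x) A"
    using insert Bx by (intro eq_matI) auto
  then have "\<Phi> (msum M (\<lambda>x. c x \<cdot>\<^sub>m B x) (insert x A)) = c x \<cdot>\<^sub>m \<Phi> (B x) + \<Phi> (msum M (\<lambda>x. c x \<cdot>\<^sub>m B x) A)"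
    using lin Bx by (simp add: lin_map_def)
  also have "\<dots> = msum N (\<lambda>x. c x \<cdot>\<^sub>m \<Phi> (B x)) (insert x A)"
    using insert lin_map_carrier[OF lin Bx] by (intro eq_matI) auto
  finally show ?case .
qed

lemma cptp_lin: "cptp M N \<Phi> \<Longrightarrow> lin_map M N \<Phi>"
  by (simp add: cptp_def)

lemma cptp_psd:
  assumes "cptp M N \<Phi>" "psd M X"
  shows "psd N (\<Phi> X)"
proof -
  have X: "X \<in> carrier_mat M M" using assms(2) by (rule psd_carrier)
  have "mat M M (\<lambda>(r,s). X $$ (r,s)) = X" using X by (intro eq_matI) auto
  moreover have "\<Phi> X \<in> carrier_mat N N" using lin_map_carrier[OF cptp_lin[OF assms(1)] X] .
  ultimately have "ampl 1 M N \<Phi> X = \<Phi> X"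
    unfolding ampl_def by (intro eq_matI) auto
  then show ?thesis using assms unfolding cptp_def by (metis mult_1)
qed

text \<open>Amplification by a two-dimensional system is applied to the rank one operator of the
  stacked vector (e,f); Q is the resulting 2 x 2 block matrix of the images of |e><e|, |e><f|,
  |f><e| and |f><f|.\<close>

lemma psd_stack:
  assumes cp: "cptp M N \<Phi>" and w: "w 0 = e" "w 1 = f"
  obtains Q where "psd (2 * N) Q"
    "\<And>a b j k. a < 2 \<Longrightarrow> b < 2 \<Longrightarrow> j < N \<Longrightarrow> k < N \<Longrightarrow>
       Q $$ (a * N + j, b * N + k) = \<Phi> (outer M (w a) (w b)) $$ (j,k)"
proof -
  define W where "W i = w (i div M) (i mod M)" for i
  define Q where "Q = ampl 2 M N \<Phi> (outer (2 * M) W W)"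
  show ?thesis
  proof
    show "psd (2 * N) Q" using cp psd_outer[of "2 * M" W] by (simp add: cptp_def Q_def)
  next
    fix a b j k :: nat assume ab: "a < 2" "b < 2" and jk: "j < N" "k < N"
    have "mat M M (\<lambda>(r,s). outer (2 * M) W W $$ (a * M + r, b * M + s)) = outer M (w a) (w b)"
      using ab by (intro eq_matI) (auto simp: outer_def W_def mult_add_less)
    then show "Q $$ (a * N + j, b * N + k) = \<Phi> (outer M (w a) (w b)) $$ (j,k)"
      using ab jk by (simp add: Q_def ampl_def mult_add_less)
  qed
qed

lemma cptp_outer_adjoint:
  assumes cp: "cptp M N \<Phi>" and jk: "j < N" "k < N"
  shows "\<Phi> (outer M e f) $$ (j,k) = cnj (\<Phi> (outer M f e) $$ (k,j))"
proof -
  define w where "w a = (if a = (0::nat) then e else f)" for a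
  obtain Q where Q: "psd (2 * N) Q"
    "\<And>a b j k. a < 2 \<Longrightarrow> b < 2 \<Longrightarrow> j < N \<Longrightarrow> k < N \<Longrightarrow>
       Q $$ (a * N + j, b * N + k) = \<Phi> (outer M (w a) (w b)) $$ (j,k)"
    using psd_stack[OF cp, of w e f] by (auto simp: w_def)
  have "Q $$ (0 * N + j, 1 * N + k) = cnj (Q $$ (1 * N + k, 0 * N + j))"
    using jk by (intro psd_hermitian[OF Q(1)]) auto
  then show ?thesis using Q(2)[of 0 1 j k] Q(2)[of 1 0 k j] jk by (simp add: w_def)
qed

text \<open>This is Tr(X A), with X given as a coordinate function. As a functional of A composed
  with \<Phi> it stands for the adjoint map applied to X, which is never defined as a map.\<close>

definition trm :: "nat \<Rightarrow> (nat \<Rightarrow> nat \<Rightarrow> complex) \<Rightarrow> complex mat \<Rightarrow> complex" where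
  "trm N X A = (\<Sum>i<N. \<Sum>j<N. X i j * A $$ (j,i))"

text \<open>With adj X the adjoint of X, positivity of the block matrix gives Tr X \<Phi>(|e><e|)
  adj X - 2 Re Tr X \<Phi>(|e><f|) + Tr \<Phi>(|f><f|) >= 0, and preservation of the trace turns the
  last term into the squared norm of f.\<close>

lemma cptp_two_positive:
  assumes cp: "cptp M N \<Phi>"
  shows "2 * Re (trm N X (\<Phi> (outer M e f)))
    \<le> (\<Sum>i<N. Re (qform N (\<Phi> (outer M e e)) (\<lambda>j. cnj (X i j)))) + (\<Sum>r<M. (cmod (f r))\<^sup>2)"
proof -
  define w where "w a = (if a = (0::nat) then e else f)" for a
  obtain Q where Q: "psd (2 * N) Q"
    "\<And>a b j k. a < 2 \<Longrightarrow> b < 2 \<Longrightarrow> j < N \<Longrightarrow> k < N \<Longrightarrow>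
       Q $$ (a * N + j, b * N + k) = \<Phi> (outer M (w a) (w b)) $$ (j,k)"
    using psd_stack[OF cp, of w e f] by (auto simp: w_def)
  \<comment> \<open>The test vector stacks the i-th column of the adjoint of X on top of minus the
    i-th basis vector; summing the quadratic forms over i produces the traces.\<close>
  define z where "z i k = (if k < N then cnj (X i k) else if k = N + i then -1 else 0)" for i k
  have qz: "qform (2 * N) Q (z i) = qform N (\<Phi> (outer M e e)) (\<lambda>j. cnj (X i j))
      - (\<Sum>j<N. X i j * \<Phi> (outer M e f) $$ (j,i)) - cnj (\<Sum>j<N. X i j * \<Phi> (outer M e f) $$ (j,i))
      + \<Phi> (outer M f f) $$ (i,i)" if "i < N" for i
  proof -
    define t where "t a b = (\<Sum>j<N. \<Sum>k<N. cnj (z i (a * N + j)) * \<Phi> (outer M (w a) (w b)) $$ (j,k) * z i (b * N + k))" for a b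
    have "qform (2 * N) Q (z i) = (\<Sum>a<2. \<Sum>j<N. \<Sum>b<2. \<Sum>k<N.
        cnj (z i (a * N + j)) * \<Phi> (outer M (w a) (w b)) $$ (j,k) * z i (b * N + k))"
      unfolding qform_def sum_mult_add by (intro sum.cong refl) (simp add: Q(2))
    also have "\<dots> = (\<Sum>a<2. \<Sum>b<2. t a b)"
      unfolding t_def by (intro sum.cong refl sum.swap)
    also have "\<dots> = t 0 0 + t 0 1 + t 1 0 + t 1 1"
      by (simp add: numeral_2_eq_2)
    also have "t 0 0 = qform N (\<Phi> (outer M e e)) (\<lambda>j. cnj (X i j))"
      unfolding t_def qform_def by (intro sum.cong refl) (simp add: z_def w_def)
    also have "t 0 1 = - (\<Sum>j<N. X i j * \<Phi> (outer M e f) $$ (j,i))"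
      unfolding t_def sum_negf[symmetric]
    proof (intro sum.cong refl)
      fix j assume "j \<in> {..<N}"
      then have "(\<Sum>k<N. cnj (z i (0 * N + j)) * \<Phi> (outer M (w 0) (w 1)) $$ (j,k) * z i (1 * N + k))
         = (\<Sum>k<N. if k = i then - (X i j * \<Phi> (outer M e f) $$ (j,k)) else 0)"
        by (intro sum.cong refl) (auto simp: z_def w_def)
      then show "(\<Sum>k<N. cnj (z i (0 * N + j)) * \<Phi> (outer M (w 0) (w 1)) $$ (j,k) * z i (1 * N + k))
         = - (X i j * \<Phi> (outer M e f) $$ (j,i))" using that by simp
    qed
    also have "t 1 0 = - cnj (\<Sum>j<N. X i j * \<Phi> (outer M e f) $$ (j,i))"
    proof -
      have "t 1 0 = (\<Sum>j<N. if j = i then (\<Sum>k<N. - cnj (X i k * \<Phi> (outer M e f) $$ (k,i))) else 0)"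
        unfolding t_def
      proof (intro sum.cong refl)
        fix j assume j: "j \<in> {..<N}"
        show "(\<Sum>k<N. cnj (z i (1 * N + j)) * \<Phi> (outer M (w 1) (w 0)) $$ (j,k) * z i (0 * N + k))
          = (if j = i then (\<Sum>k<N. - cnj (X i k * \<Phi> (outer M e f) $$ (k,i))) else 0)"
        proof (cases "j = i")
          case True
          have "cnj (z i (1 * N + j)) * \<Phi> (outer M (w 1) (w 0)) $$ (j,k) * z i (0 * N + k)
            = - cnj (X i k * \<Phi> (outer M e f) $$ (k,i))" if "k < N" for k
            using cptp_outer_adjoint[OF cp, of i k f e] that True j by (simp add: z_def w_def)
          then show ?thesis using True by (simp cong: sum.cong_simp)
        next
          case False
          then show ?thesis using j by (simp add: z_def)
        qed
      qed
      then show ?thesis using that by (simp add: sum_negf)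
    qed
    also have "t 1 1 = \<Phi> (outer M f f) $$ (i,i)"
    proof -
      have "t 1 1 = (\<Sum>j<N. if j = i then (\<Sum>k<N. if k = i then \<Phi> (outer M f f) $$ (j,k) else 0) else 0)"
        unfolding t_def by (intro sum.cong refl) (use that in \<open>auto simp: z_def w_def if_distrib[of "\<lambda>x. _ * x"] if_distrib[of uminus] cong: if_cong\<close>)
      then show ?thesis using that by simp
    qed
    finally show ?thesis by simp
  qed
  have tr: "(\<Sum>i<N. \<Phi> (outer M f f) $$ (i,i)) = complex_of_real (\<Sum>r<M. (cmod (f r))\<^sup>2)"
  proof -
    have "(\<Sum>i<N. \<Phi> (outer M f f) $$ (i,i)) = mtrace (\<Phi> (outer M f f))"
      using lin_map_carrier[OF cptp_lin[OF cp], of "outer M f f"] by (auto simp: mtrace_def)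
    also have "\<dots> = mtrace (outer M f f)" using cp by (simp add: cptp_def)
    also have "\<dots> = ip M f f" by (simp add: mtrace_def outer_def ip_def mult.commute)
    finally show ?thesis by (simp add: ip_self)
  qed
  have "0 \<le> (\<Sum>i<N. Re (qform (2 * N) Q (z i)))"
    using Q(1) by (intro sum_nonneg) (simp add: psd_iff_qform)
  also have "\<dots> = (\<Sum>i<N. Re (qform N (\<Phi> (outer M e e)) (\<lambda>j. cnj (X i j)))
      - 2 * Re (\<Sum>j<N. X i j * \<Phi> (outer M e f) $$ (j,i)) + Re (\<Phi> (outer M f f) $$ (i,i)))"
    by (intro sum.cong refl) (simp add: qz del: Re_sum cnj_sum)
  also have "\<dots> = (\<Sum>i<N. Re (qform N (\<Phi> (outer M e e)) (\<lambda>j. cnj (X i j))))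
      - 2 * Re (trm N X (\<Phi> (outer M e f))) + Re (\<Sum>i<N. \<Phi> (outer M f f) $$ (i,i))"
    by (simp add: sum.distrib sum_subtractf trm_def sum_distrib_left)
  finally show ?thesis unfolding tr by simp
qed

lemma trm_smult: "A \<in> carrier_mat N N \<Longrightarrow> trm N X (c \<cdot>\<^sub>m A) = c * trm N X A"
  unfolding trm_def sum_distrib_left by (intro sum.cong refl) auto

lemma trm_msum: "trm N X (msum N F A) = (\<Sum>x\<in>A. trm N X (F x))"
proof -
  have "trm N X (msum N F A) = (\<Sum>i<N. \<Sum>j<N. \<Sum>x\<in>A. X i j * F x $$ (j,i))"
    unfolding trm_def by (intro sum.cong refl) (simp add: sum_distrib_left)
  also have "\<dots> = (\<Sum>x\<in>A. trm N X (F x))" unfolding trm_def by (rule sum_rotate3)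
  finally show ?thesis .
qed

lemma outer_expand:
  "outer M e f = msum M (\<lambda>r. e r \<cdot>\<^sub>m outer M (\<lambda>k. if k = r then 1 else 0) f) {..<M}"
proof (rule eq_matI)
  fix i j assume "i < dim_row (msum M (\<lambda>r. e r \<cdot>\<^sub>m outer M (\<lambda>k. if k = r then 1 else 0) f) {..<M})"
    "j < dim_col (msum M (\<lambda>r. e r \<cdot>\<^sub>m outer M (\<lambda>k. if k = r then 1 else 0) f) {..<M})"
  then have ij: "i < M" "j < M" by auto
  have "(\<Sum>r<M. (e r \<cdot>\<^sub>m outer M (\<lambda>k. if k = r then 1 else 0) f) $$ (i,j))
    = (\<Sum>r<M. if r = i then e r * cnj (f j) else 0)"
    using ij by (intro sum.cong refl) (auto simp: outer_def)
  then show "outer M e f $$ (i,j) = msum M (\<lambda>r. e r \<cdot>\<^sub>m outer M (\<lambda>k. if k = r then 1 else 0) f) {..<M} $$ (i,j)"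
    using ij by (simp add: outer_def)
qed (auto simp: outer_def)

lemma trm_outer_expand:
  assumes cp: "cptp M N \<Phi>"
  shows "trm N X (\<Phi> (outer M e f)) = (\<Sum>r<M. e r * trm N X (\<Phi> (outer M (\<lambda>k. if k = r then 1 else 0) f)))"
proof -
  have car: "\<Phi> (outer M g f) \<in> carrier_mat N N" for g
    by (intro lin_map_carrier[OF cptp_lin[OF cp]]) simp
  have "\<Phi> (outer M e f) = msum N (\<lambda>r. e r \<cdot>\<^sub>m \<Phi> (outer M (\<lambda>k. if k = r then 1 else 0) f)) {..<M}"
    by (subst outer_expand, subst lin_map_msum[OF cptp_lin[OF cp]]) auto
  then show ?thesis by (simp add: trm_msum trm_smult[OF car])
qed

text \<open>Replacing f by z f, with z the trace to be bounded, makes the linear term 2 |z|^2 and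
  the norm term |z|^2, which is the optimal scaling in \<open>cptp_two_positive\<close>.\<close>

lemma cptp_cauchy_schwarz:
  assumes cp: "cptp M N \<Phi>" and f: "(\<Sum>r<M. (cmod (f r))\<^sup>2) = 1"
  shows "(cmod (trm N X (\<Phi> (outer M e f))))\<^sup>2
    \<le> (\<Sum>i<N. Re (qform N (\<Phi> (outer M e e)) (\<lambda>j. cnj (X i j))))"
proof -
  define z where "z = trm N X (\<Phi> (outer M e f))"
  have "outer M e (\<lambda>r. z * f r) = cnj z \<cdot>\<^sub>m outer M e f"
    by (intro eq_matI) (auto simp: outer_def)
  then have "\<Phi> (outer M e (\<lambda>r. z * f r)) = cnj z \<cdot>\<^sub>m \<Phi> (outer M e f)"
    using cptp_lin[OF cp] by (simp add: lin_map_def)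
  then have "trm N X (\<Phi> (outer M e (\<lambda>r. z * f r))) = cnj z * z"
    using lin_map_carrier[OF cptp_lin[OF cp], of "outer M e f"] by (simp add: trm_smult z_def)
  also have "\<dots> = complex_of_real ((cmod z)\<^sup>2)"
    by (simp add: mult_cnj_cmod mult.commute[of "cnj _"])
  finally have t: "Re (trm N X (\<Phi> (outer M e (\<lambda>r. z * f r)))) = (cmod z)\<^sup>2" by simp
  have n: "(\<Sum>r<M. (cmod (z * f r))\<^sup>2) = (cmod z)\<^sup>2"
    using f by (simp add: norm_mult power_mult_distrib sum_distrib_left[symmetric])
  show ?thesis
    using cptp_two_positive[OF cp, where X = X and e = e and f = "\<lambda>r. z * f r"]
    unfolding t n z_def[symmetric] by simp
qed

text \<open>The left side is the squared norm of the vector whose coordinates are conjugates of the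
  traces, that is, of adj Y f where Y is the adjoint map applied to X. The inequality is thus the
  Schwarz inequality for the adjoint map, tested at f; choosing that very vector as the second
  argument of \<open>cptp_two_positive\<close> makes S appear on both sides.\<close>

lemma cptp_schwarz:
  assumes cp: "cptp M N \<Phi>"
  shows "(\<Sum>r<M. (cmod (trm N X (\<Phi> (outer M (\<lambda>k. if k = r then 1 else 0) f))))\<^sup>2)
    \<le> (\<Sum>i<N. Re (qform N (\<Phi> (outer M f f)) (\<lambda>j. X j i)))"
proof -
  define T where "T r = trm N X (\<Phi> (outer M (\<lambda>k. if k = r then 1 else 0) f))" for r
  define S where "S = (\<Sum>r<M. (cmod (T r))\<^sup>2)"
  define v where "v r = cnj (T r)" for r
  have "trm N (\<lambda>i j. cnj (X j i)) (\<Phi> (outer M f v)) = cnj (trm N X (\<Phi> (outer M v f)))"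
  proof -
    have "trm N (\<lambda>i j. cnj (X j i)) (\<Phi> (outer M f v))
      = (\<Sum>i<N. \<Sum>j<N. cnj (X j i) * cnj (\<Phi> (outer M v f) $$ (i,j)))"
      unfolding trm_def
    proof (intro sum.cong refl)
      fix i j assume "i \<in> {..<N}" "j \<in> {..<N}"
      then have "\<Phi> (outer M f v) $$ (j,i) = cnj (\<Phi> (outer M v f) $$ (i,j))"
        by (intro cptp_outer_adjoint[OF cp]) auto
      then show "cnj (X j i) * \<Phi> (outer M f v) $$ (j,i) = cnj (X j i) * cnj (\<Phi> (outer M v f) $$ (i,j))"
        by simp
    qed
    also have "\<dots> = cnj (trm N X (\<Phi> (outer M v f)))"
      unfolding trm_def by (subst sum.swap) simp
    finally show ?thesis .
  qed
  also have "trm N X (\<Phi> (outer M v f)) = (\<Sum>r<M. v r * T r)"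
    unfolding T_def by (rule trm_outer_expand[OF cp])
  also have "\<dots> = complex_of_real S"
    unfolding S_def v_def of_real_sum
    by (intro sum.cong refl) (simp add: mult_cnj_cmod mult.commute[of "cnj _"])
  finally have t: "Re (trm N (\<lambda>i j. cnj (X j i)) (\<Phi> (outer M f v))) = S" by simp
  have n: "(\<Sum>r<M. (cmod (v r))\<^sup>2) = S" by (simp add: S_def v_def)
  have "2 * S \<le> (\<Sum>i<N. Re (qform N (\<Phi> (outer M f f)) (\<lambda>j. X j i))) + S"
    using cptp_two_positive[OF cp, where X = "\<lambda>i j. cnj (X j i)" and e = f and f = v]
    unfolding t n by simp
  then show ?thesis by (simp add: S_def T_def)
qed

text \<open>The left side is the minimum of the right side over x, attained at x = g / (1 + k). The
  triangle inequality reduces this to (A - k B)^2 >= 0 for the two norms A and B.\<close>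

lemma parallel_sum_le:
  assumes "k \<ge> (0::real)"
  shows "(cmod g)\<^sup>2 * (k / (1 + k)) \<le> (cmod (g - x))\<^sup>2 + k * (cmod x)\<^sup>2"
proof -
  define A B where "A = cmod (g - x)" and "B = cmod x"
  have "cmod g \<le> A + B" using norm_triangle_ineq[of "g - x" x] by (simp add: A_def B_def)
  then have "(cmod g)\<^sup>2 \<le> (A + B)\<^sup>2" by (intro power_mono) auto
  then have "(cmod g)\<^sup>2 * k \<le> (A + B)\<^sup>2 * k" using assms by (intro mult_right_mono) auto
  also have "\<dots> \<le> (A\<^sup>2 + k * B\<^sup>2) * (1 + k)"
    using zero_le_power2[of "A - k * B"] by (simp add: power2_eq_square algebra_simps)
  finally have "(cmod g)\<^sup>2 * k / (1 + k) \<le> A\<^sup>2 + k * B\<^sup>2"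
    using assms by (simp add: pos_divide_le_eq)
  then show ?thesis by (simp add: A_def B_def)
qed

text \<open>The minimum of a (1 - c)^2 + t c^2 is attained at c = a / (a + t). If both coefficients
  vanish, division by zero gives c = 0 and both sides are 0.\<close>

lemma parallel_sum_eq:
  assumes "a \<ge> 0" "t \<ge> (0::real)"
  shows "a * (1 - a / (a + t))\<^sup>2 + t * (a / (a + t))\<^sup>2 = a * t / (a + t)"
proof (cases "a + t = 0")
  case True
  then show ?thesis using assms by (simp add: add_nonneg_eq_0_iff)
next
  case False
  define q where "q = a + t"
  have "a * (1 - a / q)\<^sup>2 + (q - a) * (a / q)\<^sup>2 = a * (q - a) / q"
    using False unfolding q_def[symmetric] by (simp add: field_simps power2_eq_square)
  then show ?thesis by (simp add: q_def)
qed

text \<open>Below, \<open>G\<close> is the minimizing operator on the output side, \<open>H = 1 - G\<close>, and \<open>\<xi>\<close> is the image of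
  \<open>f\<close> under the operator that the adjoint of \<open>\<Phi>\<close> assigns to the adjoint of \<open>G\<close>.\<close>
lemma quadratic_monotone:
  assumes cp: "cptp M N \<Phi>" and f: "(\<Sum>r<M. (cmod (f r))\<^sup>2) = 1"
    and \<sigma>: "specdec M \<sigma> Z e s" "\<And>z. z \<in> Z \<Longrightarrow> s z \<ge> 0"
    and \<tau>: "specdec N (\<Phi> \<sigma>) Y v b" "\<And>y. y \<in> Y \<Longrightarrow> b y \<ge> 0"
    and \<rho>: "specdec N (\<Phi> (outer M f f)) X u a" "\<And>x. x \<in> X \<Longrightarrow> a x \<ge> 0"
    and T: "T \<ge> 0"
  shows "(\<Sum>z\<in>Z. (cmod (ip M (e z) f))\<^sup>2 * (T * s z / (1 + T * s z)))
    \<le> (\<Sum>x\<in>X. \<Sum>y\<in>Y. (cmod (ip N (u x) (v y)))\<^sup>2 * (a x * (T * b y) / (a x + T * b y)))"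
proof -
  note S = specdecD[OF \<sigma>(1)] and V = specdecD[OF \<tau>(1)] and U = specdecD[OF \<rho>(1)]
  have car: "\<Phi> (outer M g h) \<in> carrier_mat N N" for g h
    by (intro lin_map_carrier[OF cptp_lin[OF cp]]) simp
  \<comment> \<open>For each pair of eigenvectors this is the scalar minimizer from
    \<open>parallel_sum_eq\<close>.\<close>
  define c where "c x y = a x / (a x + T * b y)" for x y
  define I where "I x y = ip N (u x) (v y)" for x y
  define G where "G i j = (\<Sum>x\<in>X. \<Sum>y\<in>Y. of_real (c x y) * I x y * (u x i * cnj (v y j)))" for i j
  define H where "H i j = (if i = j then 1 else 0) - G i j" for i j
  define \<delta> where "\<delta> r k = (if k = r then 1 else (0::complex))" for r k :: nat
  define \<xi> where "\<xi> r = cnj (trm N G (\<Phi> (outer M (\<delta> r) f)))" for r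
  have trH: "trm N H (\<Phi> (outer M (\<delta> r) f)) = cnj (f r - \<xi> r)" if "r < M" for r
  proof -
    \<comment> \<open>The identity part of H contributes a bare trace, which \<Phi> preserves; so
      the vector belonging to H on the input side is f minus that of G.\<close>
    have "trm N H (\<Phi> (outer M (\<delta> r) f)) = mtrace (\<Phi> (outer M (\<delta> r) f)) - trm N G (\<Phi> (outer M (\<delta> r) f))"
      using car[of "\<delta> r" f]
      by (simp add: trm_def H_def left_diff_distrib sum_subtractf mtrace_def
          if_distrib[of "\<lambda>x. x * _"] cong: if_cong)
    also have "mtrace (\<Phi> (outer M (\<delta> r) f)) = mtrace (outer M (\<delta> r) f)" using cp by (simp add: cptp_def)
    also have "\<dots> = cnj (f r)"
      using that by (simp add: mtrace_def outer_def \<delta>_def if_distrib[of "\<lambda>x. x * _"] cong: if_cong)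
    finally show ?thesis by (simp add: \<xi>_def)
  qed
  have ip\<xi>: "trm N G (\<Phi> (outer M g f)) = ip M \<xi> g" for g
    unfolding trm_outer_expand[OF cp, of G g f] ip_def \<xi>_def \<delta>_def by (simp add: mult.commute)
  have 1: "(\<Sum>r<M. (cmod (f r - \<xi> r))\<^sup>2) \<le> (\<Sum>i<N. Re (qform N (\<Phi> (outer M f f)) (\<lambda>j. H j i)))"
  proof -
    have "(\<Sum>r<M. (cmod (f r - \<xi> r))\<^sup>2) = (\<Sum>r<M. (cmod (trm N H (\<Phi> (outer M (\<delta> r) f))))\<^sup>2)"
      by (intro sum.cong refl) (simp add: trH del: complex_cnj_diff)
    then show ?thesis using cptp_schwarz[OF cp, of H f] unfolding \<delta>_def by simp
  qed
  have Gu: "ip N (u x) (\<lambda>i. G i j) = (\<Sum>y\<in>Y. of_real (c x y) * I x y * cnj (v y j))" if x: "x \<in> X" for x j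
  proof -
    have "ip N (u x) (\<lambda>i. G i j) = (\<Sum>i<N. \<Sum>x'\<in>X. \<Sum>y\<in>Y. of_real (c x' y) * I x' y * cnj (v y j) * (u x' i * cnj (u x i)))"
      unfolding ip_def G_def sum_distrib_left by (intro sum.cong refl) (simp add: mult_ac)
    also have "\<dots> = (\<Sum>x'\<in>X. \<Sum>y\<in>Y. \<Sum>i<N. of_real (c x' y) * I x' y * cnj (v y j) * (u x' i * cnj (u x i)))"
      by (rule sum_rotate3[symmetric])
    also have "\<dots> = (\<Sum>x'\<in>X. if x' = x then (\<Sum>y\<in>Y. of_real (c x' y) * I x' y * cnj (v y j)) else 0)"
      unfolding sum_distrib_left[symmetric] using U(4) x by (intro sum.cong refl) (auto intro!: sum.cong)
    finally show ?thesis using x U(2) by simp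
  qed
  \<comment> \<open>Expanding \<open>u x\<close> in the eigenbasis \<open>v\<close> lets the
    identity merge with G, so that H has the coefficients \<open>1 - c x y\<close>.\<close>
  have uv: "cnj (u x j) = (\<Sum>y\<in>Y. I x y * cnj (v y j))" if "j < N" for x j
  proof -
    have "(\<Sum>y\<in>Y. I x y * cnj (v y j)) = (\<Sum>k<N. \<Sum>y\<in>Y. cnj (u x k) * (v y k * cnj (v y j)))"
      unfolding I_def ip_def sum_distrib_right by (subst sum.swap) (simp add: mult_ac)
    also have "\<dots> = (\<Sum>k<N. if k = j then cnj (u x k) else 0)"
      unfolding sum_distrib_left[symmetric] using specdec_complete[OF \<tau>(1)] that
      by (intro sum.cong refl) auto
    finally show ?thesis using that by simp
  qed
  have Hu: "ip N (u x) (\<lambda>i. H i j) = cnj (\<Sum>y\<in>Y. of_real (1 - c x y) * cnj (I x y) * v y j)"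
    if "x \<in> X" "j < N" for x j
  proof -
    have "ip N (u x) (\<lambda>i. H i j) = cnj (u x j) - ip N (u x) (\<lambda>i. G i j)"
      using that(2) by (simp add: ip_def H_def right_diff_distrib sum_subtractf if_distrib[of "\<lambda>x. _ * x"] cong: if_cong)
    also have "\<dots> = (\<Sum>y\<in>Y. of_real (1 - c x y) * I x y * cnj (v y j))"
      unfolding Gu[OF that(1)] uv[OF that(2)] sum_subtractf[symmetric]
      by (intro sum.cong refl) (simp add: algebra_simps)
    finally show ?thesis by simp
  qed
  have 2: "(\<Sum>i<N. Re (qform N (\<Phi> (outer M f f)) (\<lambda>j. H j i)))
     = (\<Sum>x\<in>X. \<Sum>y\<in>Y. (cmod (I x y))\<^sup>2 * (a x * (1 - c x y)\<^sup>2))"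
  proof -
    have "(\<Sum>i<N. Re (qform N (\<Phi> (outer M f f)) (\<lambda>j. H j i)))
      = (\<Sum>i<N. \<Sum>x\<in>X. a x * (cmod (\<Sum>y\<in>Y. of_real (1 - c x y) * cnj (I x y) * v y i))\<^sup>2)"
      unfolding qform_specdec[OF \<rho>(1)] by (intro sum.cong refl) (auto simp: Hu simp del: cnj_sum intro!: sum.cong)
    also have "\<dots> = (\<Sum>x\<in>X. a x * (\<Sum>i<N. (cmod (\<Sum>y\<in>Y. of_real (1 - c x y) * cnj (I x y) * v y i))\<^sup>2))"
      by (subst sum.swap) (simp add: sum_distrib_left)
    also have "\<dots> = (\<Sum>x\<in>X. a x * (\<Sum>y\<in>Y. (cmod (of_real (1 - c x y) * cnj (I x y)))\<^sup>2))"
      using norm_orthonormal_comb[OF V(2,4)] by simp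
    also have "\<dots> = (\<Sum>x\<in>X. \<Sum>y\<in>Y. (cmod (I x y))\<^sup>2 * (a x * (1 - c x y)\<^sup>2))"
      unfolding sum_distrib_left norm_mult power_mult_distrib norm_of_real
      by (intro sum.cong refl) (simp add: mult_ac)
    finally show ?thesis .
  qed
  have Gv: "ip N (v y) (\<lambda>j. cnj (G i j)) = cnj (\<Sum>x\<in>X. of_real (c x y) * I x y * u x i)" if y: "y \<in> Y" for y i
  proof -
    have "cnj (ip N (v y) (\<lambda>j. cnj (G i j)))
      = (\<Sum>j<N. \<Sum>x\<in>X. \<Sum>y'\<in>Y. of_real (c x y') * I x y' * u x i * (v y j * cnj (v y' j)))"
      unfolding ip_def G_def cnj_sum complex_cnj_mult complex_cnj_cnj sum_distrib_left complex_cnj_complex_of_real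
      by (intro sum.cong refl) (simp add: mult_ac)
    also have "\<dots> = (\<Sum>x\<in>X. \<Sum>y'\<in>Y. \<Sum>j<N. of_real (c x y') * I x y' * u x i * (v y j * cnj (v y' j)))"
      by (rule sum_rotate3[symmetric])
    also have "\<dots> = (\<Sum>x\<in>X. \<Sum>y'\<in>Y. if y' = y then of_real (c x y') * I x y' * u x i else 0)"
      unfolding sum_distrib_left[symmetric] using V(4) y by (intro sum.cong refl) auto
    also have "\<dots> = (\<Sum>x\<in>X. of_real (c x y) * I x y * u x i)" using V(2) y by simp
    finally show ?thesis by (metis complex_cnj_cnj)
  qed
  have 3: "(\<Sum>i<N. Re (qform N (\<Phi> \<sigma>) (\<lambda>j. cnj (G i j)))) = (\<Sum>x\<in>X. \<Sum>y\<in>Y. (cmod (I x y))\<^sup>2 * (b y * (c x y)\<^sup>2))"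
  proof -
    have "(\<Sum>i<N. Re (qform N (\<Phi> \<sigma>) (\<lambda>j. cnj (G i j))))
      = (\<Sum>i<N. \<Sum>y\<in>Y. b y * (cmod (\<Sum>x\<in>X. of_real (c x y) * I x y * u x i))\<^sup>2)"
      unfolding qform_specdec[OF \<tau>(1)] by (intro sum.cong refl) (auto simp: Gv simp del: cnj_sum intro!: sum.cong)
    also have "\<dots> = (\<Sum>y\<in>Y. b y * (\<Sum>i<N. (cmod (\<Sum>x\<in>X. of_real (c x y) * I x y * u x i))\<^sup>2))"
      by (subst sum.swap) (simp add: sum_distrib_left)
    also have "\<dots> = (\<Sum>y\<in>Y. b y * (\<Sum>x\<in>X. (cmod (of_real (c x y) * I x y))\<^sup>2))"
      using norm_orthonormal_comb[OF U(2,4)] by simp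
    also have "\<dots> = (\<Sum>x\<in>X. \<Sum>y\<in>Y. (cmod (I x y))\<^sup>2 * (b y * (c x y)\<^sup>2))"
      unfolding sum_distrib_left norm_mult power_mult_distrib norm_of_real
      by (subst sum.swap) (simp add: mult_ac)
    finally show ?thesis .
  qed
  have \<sigma>eq: "\<sigma> = msum M (\<lambda>z. of_real (s z) \<cdot>\<^sub>m outer M (e z) (e z)) Z"
    using S(1,5) by (intro eq_matI) (auto simp: outer_def mult_ac intro!: sum.cong)
  have "\<Phi> \<sigma> = msum N (\<lambda>z. of_real (s z) \<cdot>\<^sub>m \<Phi> (outer M (e z) (e z))) Z"
    by (subst \<sigma>eq, subst lin_map_msum[OF cptp_lin[OF cp] S(2)]) auto
  then have "qform N (\<Phi> \<sigma>) w = (\<Sum>z\<in>Z. of_real (s z) * qform N (\<Phi> (outer M (e z) (e z))) w)" for w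
    by (simp add: qform_msum qform_smult[OF car])
  then have "(\<Sum>i<N. Re (qform N (\<Phi> \<sigma>) (\<lambda>j. cnj (G i j))))
    = (\<Sum>i<N. \<Sum>z\<in>Z. s z * Re (qform N (\<Phi> (outer M (e z) (e z))) (\<lambda>j. cnj (G i j))))"
    by simp
  also have "\<dots> = (\<Sum>z\<in>Z. s z * (\<Sum>i<N. Re (qform N (\<Phi> (outer M (e z) (e z))) (\<lambda>j. cnj (G i j)))))"
    by (subst sum.swap) (simp add: sum_distrib_left)
  also have "\<dots> \<ge> (\<Sum>z\<in>Z. s z * (cmod (ip M (e z) \<xi>))\<^sup>2)"
  proof (intro sum_mono mult_left_mono)
    fix z assume "z \<in> Z"
    show "(cmod (ip M (e z) \<xi>))\<^sup>2 \<le> (\<Sum>i<N. Re (qform N (\<Phi> (outer M (e z) (e z))) (\<lambda>j. cnj (G i j))))"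
      using cptp_cauchy_schwarz[OF cp f, of G "e z"] unfolding ip\<xi> cnj_ip[symmetric, of M \<xi>] by simp
  qed (use \<sigma>(2) in auto)
  finally have 4: "(\<Sum>z\<in>Z. s z * (cmod (ip M (e z) \<xi>))\<^sup>2) \<le> (\<Sum>x\<in>X. \<Sum>y\<in>Y. (cmod (I x y))\<^sup>2 * (b y * (c x y)\<^sup>2))"
    unfolding 3 .
  \<comment> \<open>In the eigenbasis of \<sigma> the input problem decouples into scalar ones, and
    the components of \<xi> serve as trial values for all of them.\<close>
  have "(\<Sum>z\<in>Z. (cmod (ip M (e z) f))\<^sup>2 * (T * s z / (1 + T * s z)))
     \<le> (\<Sum>z\<in>Z. (cmod (ip M (e z) f - ip M (e z) \<xi>))\<^sup>2 + T * s z * (cmod (ip M (e z) \<xi>))\<^sup>2)"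
    by (intro sum_mono parallel_sum_le mult_nonneg_nonneg T \<sigma>(2))
  also have "\<dots> = (\<Sum>z\<in>Z. (cmod (ip M (e z) (\<lambda>r. f r - \<xi> r)))\<^sup>2) + T * (\<Sum>z\<in>Z. s z * (cmod (ip M (e z) \<xi>))\<^sup>2)"
    by (simp add: sum.distrib sum_distrib_left ip_def right_diff_distrib sum_subtractf mult_ac)
  also have "(\<Sum>z\<in>Z. (cmod (ip M (e z) (\<lambda>r. f r - \<xi> r)))\<^sup>2) = (\<Sum>r<M. (cmod (f r - \<xi> r))\<^sup>2)"
    by (rule parseval[OF \<sigma>(1), symmetric])
  also have "\<dots> + T * (\<Sum>z\<in>Z. s z * (cmod (ip M (e z) \<xi>))\<^sup>2)
     \<le> (\<Sum>x\<in>X. \<Sum>y\<in>Y. (cmod (I x y))\<^sup>2 * (a x * (1 - c x y)\<^sup>2))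
      + T * (\<Sum>x\<in>X. \<Sum>y\<in>Y. (cmod (I x y))\<^sup>2 * (b y * (c x y)\<^sup>2))"
    using 1 4 T unfolding 2 by (intro add_mono mult_left_mono)
  also have "\<dots> = (\<Sum>x\<in>X. \<Sum>y\<in>Y. (cmod (I x y))\<^sup>2 * (a x * (1 - c x y)\<^sup>2 + T * b y * (c x y)\<^sup>2))"
    unfolding sum_distrib_left sum.distrib[symmetric]
    by (intro sum.cong refl) (simp only: distrib_left mult_ac)
  also have "\<dots> = (\<Sum>x\<in>X. \<Sum>y\<in>Y. (cmod (I x y))\<^sup>2 * (a x * (T * b y) / (a x + T * b y)))"
    unfolding c_def using T \<tau>(2) \<rho>(2) by (intro sum.cong refl) (simp add: parallel_sum_eq)
  finally show ?thesis unfolding I_def .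
qed

section \<open>The Holevo bound for ensembles of pure states\<close>

text \<open>Both sides vanish at T = 0, and the derivative of their difference at t is the
  difference in \<open>quadratic_monotone\<close> divided by t. So the parallel sums integrate to
  logarithms.\<close>

lemma log_monotone:
  assumes cp: "cptp M N \<Phi>" and f: "(\<Sum>r<M. (cmod (f r))\<^sup>2) = 1"
    and \<sigma>: "specdec M \<sigma> Z e s" "\<And>z. z \<in> Z \<Longrightarrow> s z \<ge> 0"
    and \<tau>: "specdec N (\<Phi> \<sigma>) Y v b" "\<And>y. y \<in> Y \<Longrightarrow> b y \<ge> 0"
    and \<rho>: "specdec N (\<Phi> (outer M f f)) X u a" "\<And>x. x \<in> X \<Longrightarrow> a x \<ge> 0"
    and T: "T > 0"
  shows "(\<Sum>z\<in>Z. (cmod (ip M (e z) f))\<^sup>2 * ln (1 + T * s z))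
    \<le> (\<Sum>x\<in>X. \<Sum>y\<in>Y. (cmod (ip N (u x) (v y)))\<^sup>2 * (a x * (if a x = 0 then 0 else ln (a x + T * b y) - ln (a x))))"
proof -
  define w where "w z = (cmod (ip M (e z) f))\<^sup>2" for z
  define W where "W x y = (cmod (ip N (u x) (v y)))\<^sup>2" for x y
  define h where "h t = (\<Sum>x\<in>X. \<Sum>y\<in>Y. W x y * (a x * (if a x = 0 then 0 else ln (a x + t * b y) - ln (a x))))
    - (\<Sum>z\<in>Z. w z * ln (1 + t * s z))" for t
  define h' where "h' t = (\<Sum>x\<in>X. \<Sum>y\<in>Y. W x y * (a x * (if a x = 0 then 0 else b y / (a x + t * b y))))
    - (\<Sum>z\<in>Z. w z * (s z / (1 + t * s z)))" for t
  have der: "DERIV h t :> h' t" if t: "t \<ge> 0" for t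
  proof -
    have 1: "DERIV (\<lambda>t. w z * ln (1 + t * s z)) t :> w z * (s z / (1 + t * s z))" if z: "z \<in> Z" for z
    proof -
      have "1 + t * s z > 0" using t \<sigma>(2)[OF z] by (simp add: add_pos_nonneg)
      then show ?thesis by (auto intro!: derivative_eq_intros)
    qed
    have 2: "DERIV (\<lambda>t. W x y * (a x * (if a x = 0 then 0 else ln (a x + t * b y) - ln (a x)))) t
       :> W x y * (a x * (if a x = 0 then 0 else b y / (a x + t * b y)))" if xy: "x \<in> X" "y \<in> Y" for x y
    proof (cases "a x = 0")
      case False
      then have "a x + t * b y > 0" using t \<tau>(2)[OF xy(2)] \<rho>(2)[OF xy(1)] by (simp add: add_pos_nonneg)
      then show ?thesis using False by (auto intro!: derivative_eq_intros)
    qed auto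
    show ?thesis unfolding h_def h'_def by (intro DERIV_diff DERIV_sum 1 2)
  qed
  have nonneg: "h' t \<ge> 0" if t: "t > 0" for t
  proof -
    have "(\<Sum>z\<in>Z. w z * (t * s z / (1 + t * s z)))
      \<le> (\<Sum>x\<in>X. \<Sum>y\<in>Y. W x y * (a x * (t * b y) / (a x + t * b y)))"
      unfolding w_def W_def by (rule quadratic_monotone[OF cp f \<sigma> \<tau> \<rho> less_imp_le[OF t]])
    also have "\<dots> = t * (\<Sum>x\<in>X. \<Sum>y\<in>Y. W x y * (a x * (if a x = 0 then 0 else b y / (a x + t * b y))))"
      unfolding sum_distrib_left by (intro sum.cong refl) auto
    also have "(\<Sum>z\<in>Z. w z * (t * s z / (1 + t * s z))) = t * (\<Sum>z\<in>Z. w z * (s z / (1 + t * s z)))"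
      unfolding sum_distrib_left by (intro sum.cong refl) auto
    finally show ?thesis using t by (simp add: h'_def)
  qed
  \<comment> \<open>Division by t restricts the sign of the derivative to t > 0; at the end point 0
    only continuity is used.\<close>
  have "h 0 \<le> h T"
  proof (rule DERIV_nonneg_imp_increasing_open[where f = h])
    show "0 \<le> T" using T by simp
    show "\<exists>y. DERIV h x :> y \<and> 0 \<le> y" if "0 < x" "x < T" for x
      using der[of x] nonneg[of x] that by auto
    show "continuous_on {0..T} h"
      by (intro continuous_at_imp_continuous_on ballI DERIV_isCont[OF der]) auto
  qed
  moreover have "h 0 = 0" by (simp add: h_def)
  ultimately show ?thesis by (simp add: h_def w_def W_def)
qed

text \<open>Up to the regularization this says that the relative entropy of \<Phi>(f) to
  \<Phi>(\<sigma>) is at most that of f to \<sigma>; the entropy of f does not appear because f is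
  pure. The factor \<open>ln 2\<close> converts the entropy from base 2.\<close>

lemma log_monotone_regularized:
  assumes cp: "cptp M N \<Phi>" and f: "(\<Sum>r<M. (cmod (f r))\<^sup>2) = 1"
    and \<sigma>: "specdec M \<sigma> Z e s" "\<And>z. z \<in> Z \<Longrightarrow> s z \<ge> 0"
    and \<tau>: "specdec N (\<Phi> \<sigma>) Y v b" "\<And>y. y \<in> Y \<Longrightarrow> b y \<ge> 0"
    and \<epsilon>: "\<epsilon> > 0"
  shows "(\<Sum>z\<in>Z. (cmod (ip M (e z) f))\<^sup>2 * ln (\<epsilon> + s z))
    \<le> (\<Sum>y\<in>Y. Re (qform N (\<Phi> (outer M f f)) (v y)) * ln (\<epsilon> + b y)) + ln 2 * vn_entropy (\<Phi> (outer M f f))"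
proof -
  have psd: "psd N (\<Phi> (outer M f f))" by (rule cptp_psd[OF cp psd_outer])
  obtain u a where \<rho>: "specdec N (\<Phi> (outer M f f)) {..<N} u a" and a0: "\<And>x. x < N \<Longrightarrow> a x \<ge> 0"
    using specdec_psd_exists[OF psd] by blast
  note S = specdecD[OF \<sigma>(1)] and V = specdecD[OF \<tau>(1)] and U = specdecD[OF \<rho>]
  define W where "W x y = (cmod (ip N (u x) (v y)))\<^sup>2" for x y
  define w where "w z = (cmod (ip M (e z) f))\<^sup>2" for z
  have w1: "(\<Sum>z\<in>Z. w z) = 1" using parseval[OF \<sigma>(1), of f] f by (simp add: w_def)
  have W1: "(\<Sum>y\<in>Y. W x y) = 1" if "x < N" for x
  proof -
    have "(\<Sum>y\<in>Y. W x y) = (\<Sum>y\<in>Y. (cmod (ip N (v y) (u x)))\<^sup>2)"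
      unfolding W_def by (intro sum.cong refl) (simp add: cnj_ip[symmetric, of N "u x"])
    also have "\<dots> = (\<Sum>r<N. (cmod (u x r))\<^sup>2)" by (rule parseval[OF \<tau>(1), symmetric])
    also have "complex_of_real \<dots> = 1"
      unfolding ip_self[symmetric] ip_def using U(4)[of x x] that by (simp add: mult.commute)
    then have "(\<Sum>r<N. (cmod (u x r))\<^sup>2) = 1" by (metis of_real_eq_1_iff)
    finally show ?thesis .
  qed
  have "complex_of_real (\<Sum>x<N. a x) = mtrace (outer M f f)"
    using specdec_trace[OF \<rho>] cp by (simp add: cptp_def)
  also have "\<dots> = ip M f f" by (simp add: mtrace_def outer_def ip_def mult.commute)
  also have "\<dots> = 1" using f by (simp add: ip_self)
  finally have suma: "(\<Sum>x<N. a x) = 1" by (metis of_real_eq_1_iff)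
  have a1: "a x \<le> 1" if "x < N" for x
    using member_le_sum[of x "{..<N}" a] a0 that suma by auto
  \<comment> \<open>Here T = 1/\<epsilon>. Since \<open>a x\<close> is at most 1,
    \<open>a x * \<epsilon>\<close> may be enlarged to \<epsilon>, which frees the logarithm from
    x.\<close>
  have step: "a x * (if a x = 0 then 0 else ln (a x + 1 / \<epsilon> * b y) - ln (a x))
      \<le> a x * ln (\<epsilon> + b y) - a x * ln \<epsilon> + ln 2 * ent (a x)" if "x < N" "y \<in> Y" for x y
  proof (cases "a x = 0")
    case False
    then have ap: "a x > 0" using a0[OF that(1)] by simp
    have by0: "b y \<ge> 0" using \<tau>(2) that by simp
    have "a x + 1 / \<epsilon> * b y = (a x * \<epsilon> + b y) / \<epsilon>" using \<epsilon> by (simp add: field_simps)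
    also have "ln \<dots> = ln (a x * \<epsilon> + b y) - ln \<epsilon>"
      using \<epsilon> ap by0 by (intro ln_divide_pos add_pos_nonneg mult_pos_pos) auto
    also have "ln (a x * \<epsilon> + b y) \<le> ln (\<epsilon> + b y)"
      using \<epsilon> ap by0 a1[OF that(1)] by (subst ln_le_cancel_iff) (auto intro!: add_pos_nonneg mult_pos_pos simp: mult_le_cancel_right1)
    finally have "ln (a x + 1 / \<epsilon> * b y) - ln (a x) \<le> ln (\<epsilon> + b y) - ln \<epsilon> - ln (a x)" by simp
    then have "a x * (ln (a x + 1 / \<epsilon> * b y) - ln (a x)) \<le> a x * (ln (\<epsilon> + b y) - ln \<epsilon> - ln (a x))"
      using ap by (intro mult_left_mono) auto
    then show ?thesis using False by (simp add: ent_def log_def algebra_simps)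
  qed simp
  \<comment> \<open>The term \<open>ln \<epsilon>\<close> diverges in the limit, but it occurs with
    total weight 1 on both sides (\<open>w1\<close> here, \<open>suma\<close> below) and
    cancels.\<close>
  have "(\<Sum>z\<in>Z. w z * ln (\<epsilon> + s z)) - ln \<epsilon> = (\<Sum>z\<in>Z. w z * ln (\<epsilon> + s z)) - (\<Sum>z\<in>Z. w z) * ln \<epsilon>"
    by (simp add: w1)
  also have "\<dots> = (\<Sum>z\<in>Z. w z * ln (1 + 1 / \<epsilon> * s z))"
    unfolding sum_distrib_right sum_subtractf[symmetric]
  proof (intro sum.cong refl)
    fix z assume z: "z \<in> Z"
    have "1 + 1 / \<epsilon> * s z = (\<epsilon> + s z) / \<epsilon>" using \<epsilon> by (simp add: field_simps)
    also have "ln \<dots> = ln (\<epsilon> + s z) - ln \<epsilon>"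
      using \<epsilon> \<sigma>(2)[OF z] by (intro ln_divide_pos) auto
    finally show "w z * ln (\<epsilon> + s z) - w z * ln \<epsilon> = w z * ln (1 + 1 / \<epsilon> * s z)"
      by (simp add: right_diff_distrib)
  qed
  also have "\<dots> \<le> (\<Sum>x<N. \<Sum>y\<in>Y. W x y * (a x * (if a x = 0 then 0 else ln (a x + 1 / \<epsilon> * b y) - ln (a x))))"
    unfolding w_def W_def using \<epsilon> a0 by (intro log_monotone[OF cp f \<sigma> \<tau> \<rho>]) auto
  also have "\<dots> \<le> (\<Sum>x<N. \<Sum>y\<in>Y. W x y * (a x * ln (\<epsilon> + b y) - a x * ln \<epsilon> + ln 2 * ent (a x)))"
    by (intro sum_mono mult_left_mono step) (auto simp: W_def)
  also have "\<dots> = (\<Sum>x<N. (\<Sum>y\<in>Y. W x y * a x * ln (\<epsilon> + b y)) + (\<Sum>y\<in>Y. W x y) * (ln 2 * ent (a x) - a x * ln \<epsilon>))"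
    unfolding sum_distrib_right sum.distrib[symmetric] by (intro sum.cong refl) (simp add: algebra_simps)
  also have "\<dots> = (\<Sum>x<N. (\<Sum>y\<in>Y. W x y * a x * ln (\<epsilon> + b y)) + (ln 2 * ent (a x) - a x * ln \<epsilon>))"
    by (intro sum.cong refl) (simp add: W1)
  also have "\<dots> = (\<Sum>x<N. \<Sum>y\<in>Y. W x y * a x * ln (\<epsilon> + b y)) + ln 2 * vn_entropy (\<Phi> (outer M f f)) - ln \<epsilon>"
    unfolding specdec_entropy[OF \<rho>] using suma
    by (simp add: sum.distrib sum_subtractf sum_distrib_left[symmetric] sum_distrib_right[symmetric])
  also have "(\<Sum>x<N. \<Sum>y\<in>Y. W x y * a x * ln (\<epsilon> + b y)) = (\<Sum>y\<in>Y. Re (qform N (\<Phi> (outer M f f)) (v y)) * ln (\<epsilon> + b y))"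
    unfolding qform_specdec[OF \<rho>] Re_complex_of_real sum_distrib_right W_def
    by (subst sum.swap) (simp add: mult_ac)
  finally show ?thesis by (simp add: w_def)
qed

text \<open>Averaged over the ensemble, the weights at an eigenvector of \<sigma> or of
  \<Phi>(\<sigma>) add up to its eigenvalue, so \<open>log_monotone_regularized\<close> becomes a
  comparison of entropies.\<close>

theorem holevo_bound_pure:
  assumes cp: "cptp M N \<Phi>" and A: "finite A"
    and f: "\<And>x. x \<in> A \<Longrightarrow> (\<Sum>r<M. (cmod (f x r))\<^sup>2) = 1"
    and p: "\<And>x. x \<in> A \<Longrightarrow> p x \<ge> 0" "(\<Sum>x\<in>A. p x) = 1"
  shows "holevo N (\<lambda>x. \<Phi> (outer M (f x) (f x))) p A
    \<le> vn_entropy (msum M (\<lambda>x. of_real (p x) \<cdot>\<^sub>m outer M (f x) (f x)) A)"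
proof -
  define \<sigma> where "\<sigma> = msum M (\<lambda>x. of_real (p x) \<cdot>\<^sub>m outer M (f x) (f x)) A"
  have psd: "psd M \<sigma>" unfolding \<sigma>_def by (intro psd_msum psd_smult psd_outer p)
  have \<Phi>\<sigma>: "\<Phi> \<sigma> = msum N (\<lambda>x. of_real (p x) \<cdot>\<^sub>m \<Phi> (outer M (f x) (f x))) A"
    unfolding \<sigma>_def by (rule lin_map_msum[OF cptp_lin[OF cp] A]) simp
  have psd': "psd N (\<Phi> \<sigma>)" by (rule cptp_psd[OF cp psd])
  obtain e s where \<sigma>: "specdec M \<sigma> {..<M} e s" "\<And>z. z < M \<Longrightarrow> s z \<ge> 0"
    using specdec_psd_exists[OF psd] by blast
  obtain v b where \<tau>: "specdec N (\<Phi> \<sigma>) {..<N} v b" "\<And>z. z < N \<Longrightarrow> b z \<ge> 0"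
    using specdec_psd_exists[OF psd'] by blast
  have car: "\<Phi> (outer M (f x) (f x)) \<in> carrier_mat N N" for x
    by (intro lin_map_carrier[OF cptp_lin[OF cp]]) simp
  have s: "(\<Sum>x\<in>A. p x * (cmod (ip M (e z) (f x)))\<^sup>2) = s z" if "z < M" for z
  proof -
    have "s z = Re (qform M \<sigma> (e z))" using specdec_qform[OF \<sigma>(1)] that by simp
    also have "\<dots> = (\<Sum>x\<in>A. p x * (cmod (ip M (f x) (e z)))\<^sup>2)"
      unfolding \<sigma>_def qform_msum by (simp add: qform_smult[OF outer_carrier] qform_outer)
    finally show ?thesis by (simp add: cnj_ip[symmetric, of M "e z"])
  qed
  have b: "(\<Sum>x\<in>A. p x * Re (qform N (\<Phi> (outer M (f x) (f x))) (v y))) = b y" if "y < N" for y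
  proof -
    have "b y = Re (qform N (\<Phi> \<sigma>) (v y))" using specdec_qform[OF \<tau>(1)] that by simp
    then show ?thesis unfolding \<Phi>\<sigma> qform_msum by (simp add: qform_smult[OF car])
  qed
  define S where "S = (\<Sum>x\<in>A. p x * vn_entropy (\<Phi> (outer M (f x) (f x))))"
  have main: "- ln 2 * vn_entropy \<sigma> \<le> - ln 2 * vn_entropy (\<Phi> \<sigma>) + ln 2 * S + real N * \<epsilon>" if \<epsilon>: "\<epsilon> > 0" for \<epsilon>
  proof -
    have "- ln 2 * vn_entropy \<sigma> = (\<Sum>z<M. s z * ln (s z))"
      unfolding specdec_entropy[OF \<sigma>(1)] sum_distrib_left
      by (intro sum.cong refl) (simp add: ent_def log_def)
    also have "\<dots> \<le> (\<Sum>z<M. s z * ln (\<epsilon> + s z))"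
    proof (intro sum_mono)
      fix z assume "z \<in> {..<M}"
      then have "s z \<ge> 0" using \<sigma>(2) by simp
      then show "s z * ln (s z) \<le> s z * ln (\<epsilon> + s z)"
        using \<epsilon> by (cases "s z = 0") auto
    qed
    also have "\<dots> = (\<Sum>z<M. \<Sum>x\<in>A. p x * ((cmod (ip M (e z) (f x)))\<^sup>2 * ln (\<epsilon> + s z)))"
      by (intro sum.cong refl) (simp add: s[symmetric] sum_distrib_right mult_ac)
    also have "\<dots> = (\<Sum>x\<in>A. p x * (\<Sum>z<M. (cmod (ip M (e z) (f x)))\<^sup>2 * ln (\<epsilon> + s z)))"
      unfolding sum_distrib_left by (rule sum.swap)
    also have "\<dots> \<le> (\<Sum>x\<in>A. p x * ((\<Sum>y<N. Re (qform N (\<Phi> (outer M (f x) (f x))) (v y)) * ln (\<epsilon> + b y))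
        + ln 2 * vn_entropy (\<Phi> (outer M (f x) (f x)))))"
      using \<sigma>(2) \<tau>(2) \<epsilon> p(1) f
      by (intro sum_mono mult_left_mono log_monotone_regularized[OF cp _ \<sigma>(1) _ \<tau>(1)]) auto
    also have "\<dots> = (\<Sum>x\<in>A. \<Sum>y<N. p x * Re (qform N (\<Phi> (outer M (f x) (f x))) (v y)) * ln (\<epsilon> + b y)) + ln 2 * S"
      by (simp add: S_def sum_distrib_left sum.distrib distrib_left mult_ac)
    also have "(\<Sum>x\<in>A. \<Sum>y<N. p x * Re (qform N (\<Phi> (outer M (f x) (f x))) (v y)) * ln (\<epsilon> + b y))
      = (\<Sum>y<N. b y * ln (\<epsilon> + b y))"
      by (subst sum.swap) (simp add: b sum_distrib_right[symmetric])
    \<comment> \<open>From ln (1 + u) <= u with u = \<epsilon> / b, each eigenvalue costs at most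
      \<epsilon>; the total \<open>real N * \<epsilon>\<close> disappears in the limit.\<close>
    also have "\<dots> \<le> (\<Sum>y<N. b y * ln (b y) + \<epsilon>)"
    proof (intro sum_mono)
      fix y assume "y \<in> {..<N}"
      then have y0: "b y \<ge> 0" using \<tau>(2) by simp
      show "b y * ln (\<epsilon> + b y) \<le> b y * ln (b y) + \<epsilon>"
      proof (cases "b y = 0")
        case False
        then have yp: "b y > 0" using y0 by simp
        have "ln (\<epsilon> + b y) - ln (b y) = ln ((\<epsilon> + b y) / b y)"
          using yp \<epsilon> by (intro ln_divide_pos[symmetric]) auto
        also have "\<dots> \<le> (\<epsilon> + b y) / b y - 1"
          using yp \<epsilon> by (intro ln_le_minus_one) auto
        also have "\<dots> = \<epsilon> / b y" using yp by (simp add: field_simps)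
        finally have "b y * (ln (\<epsilon> + b y) - ln (b y)) \<le> b y * (\<epsilon> / b y)"
          using yp by (intro mult_left_mono) auto
        then show ?thesis using yp by (simp add: algebra_simps)
      qed (use \<epsilon> in simp)
    qed
    also have "\<dots> = - ln 2 * vn_entropy (\<Phi> \<sigma>) + real N * \<epsilon>"
      unfolding specdec_entropy[OF \<tau>(1)] sum_distrib_left
      by (simp add: sum.distrib ent_def log_def)
    finally show ?thesis by simp
  qed
  have "- ln 2 * vn_entropy \<sigma> \<le> - ln 2 * vn_entropy (\<Phi> \<sigma>) + ln 2 * S"
  proof (rule field_le_epsilon)
    fix \<eta> :: real assume "\<eta> > 0"
    then have "real N * (\<eta> / (real N + 1)) \<le> \<eta>" and "\<eta> / (real N + 1) > 0"
      by (auto simp: field_simps)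
    then show "- ln 2 * vn_entropy \<sigma> \<le> - ln 2 * vn_entropy (\<Phi> \<sigma>) + ln 2 * S + \<eta>"
      using main[of "\<eta> / (real N + 1)"] by linarith
  qed
  then have "ln 2 * (vn_entropy (\<Phi> \<sigma>) - S) \<le> ln 2 * vn_entropy \<sigma>"
    by (simp add: algebra_simps)
  then have "vn_entropy (\<Phi> \<sigma>) - S \<le> vn_entropy \<sigma>" by simp
  then show ?thesis
    unfolding holevo_def \<Phi>\<sigma>[symmetric] S_def[symmetric] \<sigma>_def[symmetric] .
qed

section \<open>Encoding maps\<close>

lemma psd_submatrix:
  assumes X: "psd m X" and h: "inj_on h {..<n}" "h ` {..<n} \<subseteq> {..<m}"
  shows "psd n (mat n n (\<lambda>(i,j). X $$ (h i, h j)))"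
proof -
  define V where "V v i = (if i \<in> h ` {..<n} then v (inv_into {..<n} h i) else 0)" for v :: "nat \<Rightarrow> complex" and i
  have V: "V v (h i) = v i" if "i < n" for v i using that h by (simp add: V_def)
  have red: "(\<Sum>i<m. F i) = (\<Sum>i<n. F (h i))" if "\<And>i. i \<notin> h ` {..<n} \<Longrightarrow> F i = 0" for F :: "nat \<Rightarrow> complex"
  proof -
    have "(\<Sum>i<m. F i) = (\<Sum>i\<in>h ` {..<n}. F i)"
      using h(2) that by (intro sum.mono_neutral_right) auto
    then show ?thesis using sum.reindex[OF h(1), of F] by simp
  qed
  have "qform n (mat n n (\<lambda>(i,j). X $$ (h i, h j))) v = qform m X (V v)" for v
  proof -
    have "qform m X (V v) = (\<Sum>i<n. \<Sum>s<m. cnj (V v (h i)) * X $$ (h i, s) * V v s)"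
      unfolding qform_def by (rule red) (simp add: V_def)
    also have "\<dots> = (\<Sum>i<n. \<Sum>j<n. cnj (V v (h i)) * X $$ (h i, h j) * V v (h j))"
      by (intro sum.cong refl red) (simp add: V_def)
    finally show ?thesis unfolding qform_def by (simp add: V)
  qed
  then show ?thesis using X by (simp add: psd_iff_qform)
qed

lemma mult_add_inj:
  assumes "(y::nat) < b" "y' < b" "x * b + y = x' * b + y'"
  shows "x = x' \<and> y = y'"
  using assms div_mod_mult_add by metis

lemma bij_mult_add_swap: "bij_betw (\<lambda>(y,x). x * b + y) ({..<b} \<times> {..<a}) {..<(a * b :: nat)}"
  by (rule bij_betwI[where g = "\<lambda>i. (i mod b, i div b)"])
     (auto simp: mult_add_less less_mult_imp_div_less intro!: mod_less_divisor intro: gr0I)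

lemma smult_index: "A \<in> carrier_mat N N \<Longrightarrow> i < N \<Longrightarrow> j < N \<Longrightarrow> (c \<cdot>\<^sub>m A) $$ (i,j) = c * A $$ (i,j)"
  by auto

text \<open>This is a partial trace up to relabelling: \<open>g\<close> splits each index into an
  environment part l and a kept part r. It is completely positive because each amplification is a
  sum of principal submatrices, one for each l.\<close>

lemma cptp_index_map:
  assumes L: "finite L" and g: "bij_betw (\<lambda>(l,r). g l r) (L \<times> {..<d}) {..<D}"
  shows "cptp D d (\<lambda>X. mat d d (\<lambda>(r,s). \<Sum>l\<in>L. X $$ (g l r, g l s)))"
proof -
  have gD: "g l r < D" if "l \<in> L" "r < d" for l r
    using g that by (auto simp: bij_betw_def)
  have ginj: "g l r = g l s \<Longrightarrow> r = s" if "l \<in> L" "r < d" "s < d" for l r s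
    using g that unfolding bij_betw_def inj_on_def by force
  have reindex: "(\<Sum>i<D. F i) = (\<Sum>l\<in>L. \<Sum>r<d. F (g l r))" for F :: "nat \<Rightarrow> complex"
    using sum.reindex_bij_betw[OF g, of F] by (simp add: sum.cartesian_product split_def)
  let ?\<Phi> = "\<lambda>X. mat d d (\<lambda>(r,s). \<Sum>l\<in>L. X $$ (g l r, g l s))"
  have "psd (k * d) (ampl k D d ?\<Phi> X)" if X: "psd (k * D) X" for k X
  proof -
    define h where "h l i = (i div d) * D + g l (i mod d)" for l i
    have hD: "h l i < k * D" and d: "d > 0" if "l \<in> L" "i < k * d" for l i
    proof -
      show "d > 0" using that by (cases d) auto
      then show "h l i < k * D"
        unfolding h_def using that gD by (intro mult_add_less) (auto simp: less_mult_imp_div_less)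
    qed
    have "ampl k D d ?\<Phi> X = msum (k * d) (\<lambda>l. mat (k * d) (k * d) (\<lambda>(i,j). X $$ (h l i, h l j))) L"
    proof (rule eq_matI)
      fix i j assume "i < dim_row (msum (k * d) (\<lambda>l. mat (k * d) (k * d) (\<lambda>(i,j). X $$ (h l i, h l j))) L)"
        "j < dim_col (msum (k * d) (\<lambda>l. mat (k * d) (k * d) (\<lambda>(i,j). X $$ (h l i, h l j))) L)"
      then have ij: "i < k * d" "j < k * d" by auto
      then have "d > 0" by (cases d) auto
      then have "i mod d < d" "j mod d < d" by auto
      then show "ampl k D d ?\<Phi> X $$ (i,j) = msum (k * d) (\<lambda>l. mat (k * d) (k * d) (\<lambda>(i,j). X $$ (h l i, h l j))) L $$ (i,j)"
        using ij gD by (simp add: ampl_def h_def)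
    qed (auto simp: ampl_def)
    also have "psd (k * d) \<dots>"
    proof (intro psd_msum psd_submatrix[OF X])
      fix l assume l: "l \<in> L"
      show "inj_on (h l) {..<k * d}"
      proof (rule inj_onI)
        fix i j assume ij: "i \<in> {..<k * d}" "j \<in> {..<k * d}" "h l i = h l j"
        have d: "d > 0" using d l ij by auto
        then have lt: "g l (i mod d) < D" "g l (j mod d) < D" using gD l by auto
        have "i div d = j div d" "g l (i mod d) = g l (j mod d)"
          using mult_add_inj[OF lt] ij(3) unfolding h_def by auto
        then have "i div d = j div d" "i mod d = j mod d" using ginj[OF l, of "i mod d" "j mod d"] d by auto
        then show "i = j" by (metis div_mult_mod_eq)
      qed
      show "h l ` {..<k * d} \<subseteq> {..<k * D}" using hD l by auto
    qed
    finally show ?thesis .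
  qed
  moreover have "lin_map D d ?\<Phi>"
    unfolding lin_map_def
  proof (intro conjI ballI allI)
    fix X Y :: "complex mat" assume XY: "X \<in> carrier_mat D D" "Y \<in> carrier_mat D D"
    have "(X + Y) $$ (g l r, g l s) = X $$ (g l r, g l s) + Y $$ (g l r, g l s)"
      if "l \<in> L" "r < d" "s < d" for l r s
      using XY that gD by simp
    then show "?\<Phi> (X + Y) = ?\<Phi> X + ?\<Phi> Y"
      by (intro eq_matI) (simp_all add: sum.distrib)
  next
    fix X :: "complex mat" and c assume X: "X \<in> carrier_mat D D"
    have "(c \<cdot>\<^sub>m X) $$ (g l r, g l s) = c * X $$ (g l r, g l s)"
      if "l \<in> L" "r < d" "s < d" for l r s
      using X that gD by simp
    then show "?\<Phi> (c \<cdot>\<^sub>m X) = c \<cdot>\<^sub>m ?\<Phi> X"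
      by (intro eq_matI) (simp_all add: sum_distrib_left)
  qed simp
  moreover have "mtrace (?\<Phi> X) = mtrace X" if "X \<in> carrier_mat D D" for X
  proof -
    have "mtrace (?\<Phi> X) = (\<Sum>r<d. \<Sum>l\<in>L. X $$ (g l r, g l r))" by (simp add: mtrace_def)
    also have "\<dots> = (\<Sum>i<D. X $$ (i,i))" unfolding reindex by (rule sum.swap)
    finally show ?thesis using that by (simp add: mtrace_def)
  qed
  ultimately show ?thesis by (auto simp: cptp_def)
qed

text \<open>Nonnegative eigenvalues with sum 0 all vanish. This settles outcomes of probability
  zero, where the conditional state is arbitrary.\<close>

lemma psd_trace_zero:
  assumes "psd N A" "Re (mtrace A) = 0"
  shows "A = 0\<^sub>m N N"
proof -
  obtain u b where sd: "specdec N A {..<N} u b" and b: "\<And>x. x < N \<Longrightarrow> b x \<ge> 0"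
    using specdec_psd_exists[OF assms(1)] by blast
  have "(\<Sum>x<N. b x) = 0" using specdec_trace[OF sd] assms(2) by simp
  then have "b x = 0" if "x < N" for x using b that by (subst (asm) sum_nonneg_eq_0_iff) auto
  then show ?thesis using specdecD(1,5)[OF sd] by (intro eq_matI) auto
qed

lemma density_ket_proj: "c < n \<Longrightarrow> density n (ket_proj n c)"
proof -
  assume c: "c < n"
  have "ket_proj n c = outer n (\<lambda>k. if k = c then 1 else 0) (\<lambda>k. if k = c then 1 else 0)"
    by (intro eq_matI) (auto simp: ket_proj_def outer_def)
  then have "psd n (ket_proj n c)" by (simp add: psd_outer)
  moreover have "mtrace (ket_proj n c) = (\<Sum>i<n. if i = c then 1 else 0)"
    by (simp add: mtrace_def ket_proj_def)
  ultimately show ?thesis using c by (simp add: density_def)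
qed

lemma enc_map_index:
  assumes v: "valid_encoding m dB dC q \<omega>" and i: "i < m" and b: "b < dB" "b' < dB" and c: "c < dC" "c' < dC"
  shows "enc_map dB dC q \<omega> i $$ (b * dC + c, b' * dC + c')
    = (if c = c' then of_real (q i c) * \<omega> i c $$ (b,b') else 0)"
proof -
  have car: "\<omega> i j \<in> carrier_mat dB dB" if "j < dC" for j
    using v i that by (auto simp: valid_encoding_def density_def psd_def)
  have ket: "ket_proj dC j \<in> carrier_mat dC dC" for j by (simp add: ket_proj_def)
  have lt: "b * dC + c < dB * dC" "b' * dC + c' < dB * dC" using b c by (auto intro: mult_add_less)
  have "enc_map dB dC q \<omega> i $$ (b * dC + c, b' * dC + c')
    = (\<Sum>j<dC. if j = c then (if c = c' then of_real (q i c) * \<omega> i c $$ (b,b') else 0) else 0)"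
    unfolding enc_map_def msum_index[OF lt]
  proof (intro sum.cong refl)
    fix j assume "j \<in> {..<dC}"
    then have j: "j < dC" by simp
    show "(of_real (q i j) \<cdot>\<^sub>m kron (\<omega> i j) (ket_proj dC j)) $$ (b * dC + c, b' * dC + c')
      = (if j = c then (if c = c' then of_real (q i c) * \<omega> i c $$ (b,b') else 0) else 0)"
      unfolding smult_index[OF kron_carrier[OF car[OF j] ket] lt] kron_index[OF car[OF j] ket lt]
      using b c by (auto simp: ket_proj_def)
  qed
  then show ?thesis using c by simp
qed

lemma rhoABC_index:
  assumes v: "valid_encoding m dB dC q \<omega>" and a: "a < m" "a' < m" and b: "b < dB" "b' < dB" and c: "c < dC" "c' < dC"
  shows "rhoABC m p dB dC q \<omega> $$ ((a * dB + b) * dC + c, (a' * dB + b') * dC + c')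
    = (if a = a' \<and> c = c' then of_real (p a * q a c) * \<omega> a c $$ (b,b') else 0)"
proof -
  have car: "enc_map dB dC q \<omega> i \<in> carrier_mat (dB * dC) (dB * dC)" for i by (simp add: enc_map_def)
  have ket: "ket_proj m j \<in> carrier_mat m m" for j by (simp add: ket_proj_def)
  have eq: "(a * dB + b) * dC + c = a * (dB * dC) + (b * dC + c)" "(a' * dB + b') * dC + c' = a' * (dB * dC) + (b' * dC + c')"
    by (simp_all add: algebra_simps)
  have lt: "b * dC + c < dB * dC" "b' * dC + c' < dB * dC" using b c by (auto intro: mult_add_less)
  have lt': "a * (dB * dC) + (b * dC + c) < m * (dB * dC)" "a' * (dB * dC) + (b' * dC + c') < m * (dB * dC)"
    using a lt by (auto intro: mult_add_less)
  have "rhoABC m p dB dC q \<omega> $$ ((a * dB + b) * dC + c, (a' * dB + b') * dC + c')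
    = (\<Sum>i<m. if i = a then (if a = a' \<and> c = c' then of_real (p a * q a c) * \<omega> a c $$ (b,b') else 0) else 0)"
    unfolding rhoABC_def eq mult.assoc[of m] msum_index[OF lt']
  proof (intro sum.cong refl)
    fix i assume "i \<in> {..<m}"
    then show "(of_real (p i) \<cdot>\<^sub>m kron (ket_proj m i) (enc_map dB dC q \<omega> i)) $$ (a * (dB * dC) + (b * dC + c), a' * (dB * dC) + (b' * dC + c'))
      = (if i = a then (if a = a' \<and> c = c' then of_real (p a * q a c) * \<omega> a c $$ (b,b') else 0) else 0)"
      unfolding smult_index[OF kron_carrier[OF ket car] lt'] kron_index[OF ket car lt']
      using lt a enc_map_index[OF v a(1) b c] by (auto simp: ket_proj_def)
  qed
  then show ?thesis using a by simp
qed

text \<open>The state is block diagonal in A and C, so the marginals without B are diagonal and the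
  others are direct sums over the values of C or of A and C. In the second claim S(AC) and S(C)
  cancel, leaving S(A) + S(BC) - S(ABC) = S(A:BC).\<close>

lemma encoding_entropies:
  assumes v: "valid_encoding m dB dC q \<omega>" and p: "\<And>i. i < m \<Longrightarrow> p i \<ge> 0"
  shows "mi_AC m p dB dC q \<omega> = (\<Sum>a<m. ent (p a)) + (\<Sum>c<dC. ent (\<Sum>a<m. p a * q a c)) - (\<Sum>a<m. \<Sum>c<dC. ent (p a * q a c))"
    and "mi_AC m p dB dC q \<omega> + cmi_ABC m p dB dC q \<omega> = (\<Sum>a<m. ent (p a))
      + (\<Sum>c<dC. vn_entropy (msum dB (\<lambda>a. of_real (p a * q a c) \<cdot>\<^sub>m \<omega> a c) {..<m}))
      - (\<Sum>a<m. \<Sum>c<dC. vn_entropy (of_real (p a * q a c) \<cdot>\<^sub>m \<omega> a c))"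
proof -
  define \<rho> where "\<rho> = rhoABC m p dB dC q \<omega>"
  have \<rho>: "\<rho> $$ ((a * dB + b) * dC + c, (a' * dB + b') * dC + c')
    = (if a = a' \<and> c = c' then of_real (p a * q a c) * \<omega> a c $$ (b,b') else 0)"
    if "a < m" "a' < m" "b < dB" "b' < dB" "c < dC" "c' < dC" for a a' b b' c c'
    unfolding \<rho>_def by (rule rhoABC_index[OF v that])
  have q: "q a c \<ge> 0" "psd dB (\<omega> a c)" "mtrace (\<omega> a c) = 1" if "a < m" "c < dC" for a c
    using v that by (auto simp: valid_encoding_def density_def)
  have q1: "(\<Sum>c<dC. q a c) = 1" if "a < m" for a using v that by (auto simp: valid_encoding_def)
  have tr: "(\<Sum>b<dB. \<omega> a c $$ (b,b)) = 1" if "a < m" "c < dC" for a c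
    using q[OF that] by (auto simp: mtrace_def psd_def)
  have psd: "psd dB (of_real (p a * q a c) \<cdot>\<^sub>m \<omega> a c)" if "a < m" "c < dC" for a c
    using q[OF that] p that by (intro psd_smult) auto
  have AC: "vn_entropy (ptrace_mid m dB dC \<rho>) = (\<Sum>a<m. \<Sum>c<dC. ent (p a * q a c))"
  proof -
    have "vn_entropy (ptrace_mid m dB dC \<rho>) = (\<Sum>i<m * dC. ent (p (i div dC) * q (i div dC) (i mod dC)))"
    proof (rule vn_entropy_diag)
      show "ptrace_mid m dB dC \<rho> \<in> carrier_mat (m * dC) (m * dC)" by (simp add: ptrace_mid_def)
      fix i j assume ij: "i < m * dC" "j < m * dC"
      then have "dC > 0" by (cases dC) auto
      then have dm: "i div dC < m" "j div dC < m" "i mod dC < dC" "j mod dC < dC"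
        using ij by (auto simp: less_mult_imp_div_less)
      have ij_eq: "i = j \<longleftrightarrow> i div dC = j div dC \<and> i mod dC = j mod dC" by (metis div_mult_mod_eq)
      have "ptrace_mid m dB dC \<rho> $$ (i,j) = (\<Sum>b<dB. if i = j then of_real (p (i div dC) * q (i div dC) (i mod dC)) * \<omega> (i div dC) (i mod dC) $$ (b,b) else 0)"
        using ij dm unfolding ptrace_mid_def by (auto simp: \<rho> ij_eq intro!: sum.cong)
      also have "\<dots> = (if i = j then complex_of_real (p (i div dC) * q (i div dC) (i mod dC)) else 0)"
        using tr dm by (simp add: sum_distrib_left[symmetric])
      finally show "ptrace_mid m dB dC \<rho> $$ (i,j) = (if i = j then complex_of_real (p (i div dC) * q (i div dC) (i mod dC)) else 0)" .
    qed
    then show ?thesis by (simp add: sum_mult_add)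
  qed
  have A: "vn_entropy (ptrace_mid m (dB * dC) 1 \<rho>) = (\<Sum>a<m. ent (p a))"
  proof (rule vn_entropy_diag)
    show "ptrace_mid m (dB * dC) 1 \<rho> \<in> carrier_mat m m" by (simp add: ptrace_mid_def)
    fix i j assume ij: "i < m" "j < m"
    have "ptrace_mid m (dB * dC) 1 \<rho> $$ (i,j) = (\<Sum>b<dB. \<Sum>c<dC. \<rho> $$ (i * (dB * dC) + (b * dC + c), j * (dB * dC) + (b * dC + c)))"
      using ij by (simp add: ptrace_mid_def sum_mult_add)
    also have "\<dots> = (\<Sum>b<dB. \<Sum>c<dC. \<rho> $$ ((i * dB + b) * dC + c, (j * dB + b) * dC + c))"
      by (simp add: algebra_simps)
    also have "\<dots> = (\<Sum>b<dB. \<Sum>c<dC. if i = j then of_real (p i * q i c) * \<omega> i c $$ (b,b) else 0)"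
      using ij by (intro sum.cong refl) (simp add: \<rho>)
    also have "\<dots> = (if i = j then (\<Sum>c<dC. of_real (p i * q i c) * (\<Sum>b<dB. \<omega> i c $$ (b,b))) else 0)"
      unfolding sum_distrib_left by (subst sum.swap) simp
    also have "\<dots> = (if i = j then complex_of_real (p i * (\<Sum>c<dC. q i c)) else 0)"
      using ij by (simp add: tr sum_distrib_left)
    also have "\<dots> = (if i = j then complex_of_real (p i) else 0)" using q1 ij by simp
    finally show "ptrace_mid m (dB * dC) 1 \<rho> $$ (i,j) = (if i = j then complex_of_real (p i) else 0)" .
  qed
  have C: "vn_entropy (ptrace_mid 1 (m * dB) dC \<rho>) = (\<Sum>c<dC. ent (\<Sum>a<m. p a * q a c))"
  proof (rule vn_entropy_diag)
    show "ptrace_mid 1 (m * dB) dC \<rho> \<in> carrier_mat dC dC" by (simp add: ptrace_mid_def)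
    fix i j assume ij: "i < dC" "j < dC"
    have "ptrace_mid 1 (m * dB) dC \<rho> $$ (i,j) = (\<Sum>a<m. \<Sum>b<dB. \<rho> $$ ((a * dB + b) * dC + i, (a * dB + b) * dC + j))"
      using ij by (simp add: ptrace_mid_def sum_mult_add)
    also have "\<dots> = (\<Sum>a<m. \<Sum>b<dB. if i = j then of_real (p a * q a i) * \<omega> a i $$ (b,b) else 0)"
      using ij by (intro sum.cong refl) (simp add: \<rho>)
    also have "\<dots> = (if i = j then complex_of_real (\<Sum>a<m. p a * q a i) else 0)"
      using ij tr by (simp add: sum_distrib_left[symmetric])
    finally show "ptrace_mid 1 (m * dB) dC \<rho> $$ (i,j) = (if i = j then complex_of_real (\<Sum>a<m. p a * q a i) else 0)" .
  qed
  have BC: "vn_entropy (ptrace_mid 1 m (dB * dC) \<rho>)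
    = (\<Sum>c<dC. vn_entropy (msum dB (\<lambda>a. of_real (p a * q a c) \<cdot>\<^sub>m \<omega> a c) {..<m}))"
  proof -
    have "vn_entropy (ptrace_mid 1 m (dB * dC) \<rho>)
      = (\<Sum>c\<in>{..<dC}. vn_entropy (msum dB (\<lambda>a. of_real (p a * q a c) \<cdot>\<^sub>m \<omega> a c) {..<m}))"
    proof (rule vn_entropy_block[where g = "\<lambda>c b. b * dC + c" and n = dB])
      show "bij_betw (\<lambda>(c,b). b * dC + c) ({..<dC} \<times> {..<dB}) {..<dB * dC}"
        by (rule bij_mult_add_swap)
      show "ptrace_mid 1 m (dB * dC) \<rho> \<in> carrier_mat (dB * dC) (dB * dC)" by (simp add: ptrace_mid_def)
    next
      fix c c' b b' assume cc: "c \<in> {..<dC}" "c' \<in> {..<dC}" and bb: "b < dB" "b' < dB"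
      then have lt: "b * dC + c < dB * dC" "b' * dC + c' < dB * dC" by (auto intro: mult_add_less)
      then have "ptrace_mid 1 m (dB * dC) \<rho> $$ (b * dC + c, b' * dC + c')
         = (\<Sum>a<m. \<rho> $$ (a * (dB * dC) + (b * dC + c), a * (dB * dC) + (b' * dC + c')))"
        by (simp add: ptrace_mid_def)
      also have "\<dots> = (\<Sum>a<m. \<rho> $$ ((a * dB + b) * dC + c, (a * dB + b') * dC + c'))"
        by (simp add: algebra_simps)
      also have "\<dots> = (\<Sum>a<m. if c = c' then of_real (p a * q a c) * \<omega> a c $$ (b,b') else 0)"
        using cc bb by (intro sum.cong refl) (simp add: \<rho>)
      also have "\<dots> = (if c = c' then msum dB (\<lambda>a. of_real (p a * q a c) \<cdot>\<^sub>m \<omega> a c) {..<m} $$ (b,b') else 0)"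
        using cc bb by (auto intro!: sum.cong simp: smult_index[OF psd_carrier[OF q(2)]])
      finally show "ptrace_mid 1 m (dB * dC) \<rho> $$ (b * dC + c, b' * dC + c')
        = (if c = c' then msum dB (\<lambda>a. of_real (p a * q a c) \<cdot>\<^sub>m \<omega> a c) {..<m} $$ (b,b') else 0)" .
    qed (auto intro!: psd_msum psd simp del: of_real_mult)
    then show ?thesis by simp
  qed
  have ABC: "vn_entropy \<rho> = (\<Sum>a<m. \<Sum>c<dC. vn_entropy (of_real (p a * q a c) \<cdot>\<^sub>m \<omega> a c))"
  proof -
    have "vn_entropy \<rho> = (\<Sum>z\<in>{..<m} \<times> {..<dC}. vn_entropy (of_real (p (fst z) * q (fst z) (snd z)) \<cdot>\<^sub>m \<omega> (fst z) (snd z)))"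
    proof (rule vn_entropy_block[where g = "\<lambda>z b. (fst z * dB + b) * dC + snd z" and n = dB])
      show "bij_betw (\<lambda>(z,b). (fst z * dB + b) * dC + snd z) (({..<m} \<times> {..<dC}) \<times> {..<dB}) {..<m * dB * dC}"
      proof (rule bij_betwI[where g = "\<lambda>i. ((i div dC div dB, i mod dC), i div dC mod dB)"])
        show "(\<lambda>i. ((i div dC div dB, i mod dC), i div dC mod dB)) \<in> {..<m * dB * dC} \<rightarrow> ({..<m} \<times> {..<dC}) \<times> {..<dB}"
        proof
          fix i assume i: "i \<in> {..<m * dB * dC}"
          then have "dC > 0" "dB > 0" by (cases dC; cases dB; auto)+
          moreover have "i div dC < m * dB" using i by (simp add: less_mult_imp_div_less)
          ultimately show "((i div dC div dB, i mod dC), i div dC mod dB) \<in> ({..<m} \<times> {..<dC}) \<times> {..<dB}"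
            by (simp add: less_mult_imp_div_less)
        qed
      qed (auto intro!: mult_add_less)
      show "\<rho> \<in> carrier_mat (m * dB * dC) (m * dB * dC)" by (simp add: \<rho>_def rhoABC_def)
    next
      fix z z' b b' assume zz: "z \<in> {..<m} \<times> {..<dC}" "z' \<in> {..<m} \<times> {..<dC}" and bb: "b < dB" "b' < dB"
      have "\<omega> (fst z) (snd z) \<in> carrier_mat dB dB" using zz by (intro psd_carrier q) auto
      then show "\<rho> $$ ((fst z * dB + b) * dC + snd z, (fst z' * dB + b') * dC + snd z')
        = (if z = z' then (of_real (p (fst z) * q (fst z) (snd z)) \<cdot>\<^sub>m \<omega> (fst z) (snd z)) $$ (b,b') else 0)"
        using zz bb by (auto simp: \<rho> prod_eq_iff)
    qed (auto intro!: psd simp del: of_real_mult)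
    then show ?thesis by (simp add: sum.cartesian_product split_def)
  qed
  show "mi_AC m p dB dC q \<omega> = (\<Sum>a<m. ent (p a)) + (\<Sum>c<dC. ent (\<Sum>a<m. p a * q a c)) - (\<Sum>a<m. \<Sum>c<dC. ent (p a * q a c))"
    unfolding mi_AC_def Let_def \<rho>_def[symmetric] A C AC ..
  show "mi_AC m p dB dC q \<omega> + cmi_ABC m p dB dC q \<omega> = (\<Sum>a<m. ent (p a))
      + (\<Sum>c<dC. vn_entropy (msum dB (\<lambda>a. of_real (p a * q a c) \<cdot>\<^sub>m \<omega> a c) {..<m}))
      - (\<Sum>a<m. \<Sum>c<dC. vn_entropy (of_real (p a * q a c) \<cdot>\<^sub>m \<omega> a c))"
    unfolding mi_AC_def cmi_ABC_def Let_def \<rho>_def[symmetric] A C AC BC ABC by simp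
qed

section \<open>Sequences of letters\<close>

lemma seqs_0 [simp]: "seqs m 0 = {[]}"
  by (auto simp: seqs_def)

lemma seqs_Suc: "seqs m (Suc n) = (\<lambda>(i,I). i # I) ` ({..<m} \<times> seqs m n)"
  by (auto simp: seqs_def length_Suc_conv image_iff)

lemma finite_seqs [simp]: "finite (seqs m n)"
  by (induction n) (auto simp: seqs_Suc)

lemma sum_seqs_Suc: "(\<Sum>I\<in>seqs m (Suc n). f I) = (\<Sum>i<m. \<Sum>I\<in>seqs m n. f (i # I))"
proof -
  have "(\<Sum>I\<in>seqs m (Suc n). f I) = (\<Sum>z\<in>{..<m} \<times> seqs m n. f (case z of (i,I) \<Rightarrow> i # I))"
    unfolding seqs_Suc by (subst sum.reindex) (auto simp: inj_on_def)
  then show ?thesis by (simp add: sum.cartesian_product split_def)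
qed

lemma seqs_append: "J \<in> seqs m a \<Longrightarrow> K \<in> seqs m b \<Longrightarrow> J @ K \<in> seqs m (a + b)"
  by (auto simp: seqs_def)

lemma sum_seqs_append: "(\<Sum>I\<in>seqs m (a + b). f I) = (\<Sum>J\<in>seqs m a. \<Sum>K\<in>seqs m b. f (J @ K))"
  by (induction a arbitrary: f) (simp_all add: sum_seqs_Suc)

lemma sum_seqs_snoc: "(\<Sum>I\<in>seqs m (Suc n). f I) = (\<Sum>J\<in>seqs m n. \<Sum>i<m. f (J @ [i]))"
  using sum_seqs_append[of f m n 1] by (simp add: sum_seqs_Suc)

lemma seqs_length: "I \<in> seqs m n \<Longrightarrow> length I = n"
  by (simp add: seqs_def)

lemma pI_simps [simp]: "pI p [] = 1" "pI p (i # I) = p i * pI p I" "pI p (J @ K) = pI p J * pI p K"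
  by (simp_all add: pI_def)

lemma pI_nonneg: "(\<And>i. i < m \<Longrightarrow> p i \<ge> 0) \<Longrightarrow> I \<in> seqs m n \<Longrightarrow> pI p I \<ge> 0"
  unfolding seqs_def pI_def by (fastforce intro!: prod_list_nonneg)

lemma sum_pI: "(\<Sum>i<m. p i) = 1 \<Longrightarrow> (\<Sum>I\<in>seqs m n. pI p I) = 1"
  by (induction n) (simp_all add: sum_seqs_Suc sum_distrib_left[symmetric])

text \<open>Averaging over prefixes of length k and then over one more letter is averaging over
  prefixes of length k + 1.\<close>

lemma telescope_seqs:
  fixes f :: "nat list \<Rightarrow> real"
  shows "(\<Sum>k<n. \<Sum>J\<in>seqs m k. pI p J * (f J - (\<Sum>i<m. p i * f (J @ [i])))) = f [] - (\<Sum>I\<in>seqs m n. pI p I * f I)"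
proof -
  have "(\<Sum>J\<in>seqs m k. pI p J * (f J - (\<Sum>i<m. p i * f (J @ [i]))))
      = (\<Sum>J\<in>seqs m k. pI p J * f J) - (\<Sum>J\<in>seqs m (Suc k). pI p J * f J)" for k
    unfolding sum_seqs_snoc by (simp add: right_diff_distrib sum_subtractf sum_distrib_left mult_ac)
  then show ?thesis
    using sum_lessThan_telescope'[of "\<lambda>k. \<Sum>J\<in>seqs m k. pI p J * f J" n] by simp
qed

section \<open>Product vectors and the average of product states\<close>

fun phi_vec :: "nat \<Rightarrow> (nat \<Rightarrow> complex vec) \<Rightarrow> nat list \<Rightarrow> nat \<Rightarrow> complex" where
  "phi_vec d \<phi> [] = (\<lambda>r. 1)"
| "phi_vec d \<phi> (i # I) = (\<lambda>r. \<phi> i $ (r div d ^ length I) * phi_vec d \<phi> I (r mod d ^ length I))"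

lemma proj_outer: "v \<in> carrier_vec d \<Longrightarrow> proj v = outer d (vec_index v) (vec_index v)"
  by (auto simp: proj_def outer_def)

lemma kron_outer: "kron (outer N e e) (outer M f f) = outer (N * M) (\<lambda>i. e (i div M) * f (i mod M)) (\<lambda>i. e (i div M) * f (i mod M))"
proof (rule eq_matI)
  fix i j assume "i < dim_row (outer (N * M) (\<lambda>i. e (i div M) * f (i mod M)) (\<lambda>i. e (i div M) * f (i mod M)))"
    "j < dim_col (outer (N * M) (\<lambda>i. e (i div M) * f (i mod M)) (\<lambda>i. e (i div M) * f (i mod M)))"
  then have ij: "i < N * M" "j < N * M" by (auto simp: outer_def)
  then have "M > 0" by (cases M) auto
  then have "i div M < N" "j div M < N" "i mod M < M" "j mod M < M"
    using ij by (auto simp: less_mult_imp_div_less)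
  then show "kron (outer N e e) (outer M f f) $$ (i,j)
    = outer (N * M) (\<lambda>i. e (i div M) * f (i mod M)) (\<lambda>i. e (i div M) * f (i mod M)) $$ (i,j)"
    unfolding kron_index[OF outer_carrier outer_carrier ij] using ij by (simp add: outer_def mult_ac)
qed (auto simp: kron_def outer_def)

lemma phiI_outer:
  assumes "\<And>i. i < m \<Longrightarrow> \<phi> i \<in> carrier_vec d" "set I \<subseteq> {..<m}"
  shows "phiI \<phi> I = outer (d ^ length I) (phi_vec d \<phi> I) (phi_vec d \<phi> I)"
  using assms(2)
proof (induction I)
  case Nil
  then show ?case by (auto simp: phiI_def outer_def)
next
  case (Cons i I)
  have "phiI \<phi> (i # I) = kron (proj (\<phi> i)) (phiI \<phi> I)" by (simp add: phiI_def)
  then show ?case using Cons assms(1) by (simp add: proj_outer[of "\<phi> i" d] kron_outer)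
qed

lemma phi_vec_norm:
  assumes "\<And>i. i < m \<Longrightarrow> (\<Sum>r<d. (cmod (\<phi> i $ r))\<^sup>2) = 1" "set I \<subseteq> {..<m}"
  shows "(\<Sum>r<d ^ length I. (cmod (phi_vec d \<phi> I r))\<^sup>2) = 1"
  using assms(2)
proof (induction I)
  case (Cons i I)
  have "(\<Sum>r<d * d ^ length I. (cmod (phi_vec d \<phi> (i # I) r))\<^sup>2)
    = (\<Sum>r<d. \<Sum>s<d ^ length I. (cmod (\<phi> i $ r))\<^sup>2 * (cmod (phi_vec d \<phi> I s))\<^sup>2)"
    unfolding sum_mult_add by (intro sum.cong refl) (simp add: norm_mult power_mult_distrib)
  also have "\<dots> = 1" using Cons assms(1) by (simp add: sum_product[symmetric])
  finally show ?case by simp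
qed simp

lemma ensemble_norm:
  assumes "ensemble d m \<phi> p" "i < m"
  shows "(\<Sum>r<d. (cmod (\<phi> i $ r))\<^sup>2) = 1"
proof -
  have "\<phi> i \<in> carrier_vec d" using assms by (simp add: ensemble_def)
  then have "\<phi> i \<bullet>c \<phi> i = complex_of_real (\<Sum>r<d. (cmod (\<phi> i $ r))\<^sup>2)"
    by (simp add: scalar_prod_def atLeast0LessThan mult_cnj_cmod)
  then show ?thesis using assms unfolding ensemble_def by (metis of_real_eq_1_iff)
qed

text \<open>The average of the product states is the n-fold tensor power of the ensemble state; the
  traces are carried through the induction because \<open>vn_entropy_kron\<close> weights the
  entropies by them.\<close>

lemma tensor_power_state:
  assumes ens: "ensemble d m \<phi> p"
  defines "\<sigma> \<equiv> \<lambda>n. msum (d ^ n) (\<lambda>I. of_real (pI p I) \<cdot>\<^sub>m phiI \<phi> I) (seqs m n)"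
  shows "psd (d ^ n) (\<sigma> n) \<and> mtrace (\<sigma> n) = 1 \<and> vn_entropy (\<sigma> n) = real n * ens_entropy d m \<phi> p"
proof (induction n)
  case 0
  have "\<sigma> 0 = 1\<^sub>m 1" by (intro eq_matI) (auto simp: \<sigma>_def phiI_def)
  moreover have "psd 1 (1\<^sub>m 1)" by (auto simp: psd_iff_qform qform_def)
  moreover have "vn_entropy (1\<^sub>m 1) = 0"
    by (subst vn_entropy_diag[where N = 1 and t = "\<lambda>_. 1"]) auto
  ultimately show ?case by (simp add: mtrace_def)
next
  case (Suc n)
  have \<phi>: "\<And>i. i < m \<Longrightarrow> \<phi> i \<in> carrier_vec d" and p: "\<And>i. i < m \<Longrightarrow> p i \<ge> 0" and p1: "(\<Sum>i<m. p i) = 1"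
    using ens by (auto simp: ensemble_def)
  note norm1 = ensemble_norm[OF ens]
  have pr: "proj (\<phi> i) \<in> carrier_mat d d" "psd d (proj (\<phi> i))" "mtrace (proj (\<phi> i)) = 1" if "i < m" for i
  proof -
    show "psd d (proj (\<phi> i))" "proj (\<phi> i) \<in> carrier_mat d d"
      unfolding proj_outer[OF \<phi>[OF that]] by (simp_all add: psd_outer)
    have "mtrace (proj (\<phi> i)) = ip d (vec_index (\<phi> i)) (vec_index (\<phi> i))"
      unfolding proj_outer[OF \<phi>[OF that]] by (simp add: mtrace_def outer_def ip_def mult.commute)
    then show "mtrace (proj (\<phi> i)) = 1" using norm1[OF that] by (simp add: ip_self)
  qed
  define \<rho> where "\<rho> = ens_state d m \<phi> p"
  have \<rho>: "psd d \<rho>" unfolding \<rho>_def ens_state_def by (intro psd_msum psd_smult pr p) auto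
  have tr: "mtrace \<rho> = 1"
  proof -
    have "mtrace \<rho> = (\<Sum>i<m. complex_of_real (p i))"
      unfolding \<rho>_def ens_state_def using pr by (subst mtrace_msum[where N = d]) (auto simp: mtrace_smult[OF pr(1)])
    then show ?thesis using p1 by (metis of_real_1 of_real_sum)
  qed
  have phiI_car: "phiI \<phi> I \<in> carrier_mat (d ^ n) (d ^ n)" if "I \<in> seqs m n" for I
    using phiI_outer[of m \<phi> d I] \<phi> that by (auto simp: seqs_def)
  have "\<sigma> (Suc n) = kron \<rho> (\<sigma> n)"
  proof (rule eq_matI)
    have car: "kron \<rho> (\<sigma> n) \<in> carrier_mat (d * d ^ n) (d * d ^ n)"
      by (rule kron_carrier) (simp_all add: \<rho>_def ens_state_def \<sigma>_def)
    fix i j assume "i < dim_row (kron \<rho> (\<sigma> n))" "j < dim_col (kron \<rho> (\<sigma> n))"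
    then have ij: "i < d * d ^ n" "j < d * d ^ n" using car by auto
    then have "d > 0" by (cases d) auto
    then have dm: "i div d ^ n < d" "j div d ^ n < d" "i mod d ^ n < d ^ n" "j mod d ^ n < d ^ n"
      using ij by (auto simp: less_mult_imp_div_less)
    have "\<sigma> (Suc n) $$ (i,j) = (\<Sum>a<m. \<Sum>I\<in>seqs m n. (of_real (p a * pI p I) \<cdot>\<^sub>m kron (proj (\<phi> a)) (phiI \<phi> I)) $$ (i,j))"
      using ij unfolding \<sigma>_def by (simp add: sum_seqs_Suc phiI_def)
    also have "\<dots> = (\<Sum>a<m. \<Sum>I\<in>seqs m n. (of_real (p a) * proj (\<phi> a) $$ (i div d ^ n, j div d ^ n))
        * (of_real (pI p I) * phiI \<phi> I $$ (i mod d ^ n, j mod d ^ n)))"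
    proof (intro sum.cong refl)
      fix a I assume "a \<in> {..<m}" "I \<in> seqs m n"
      then have c: "proj (\<phi> a) \<in> carrier_mat d d" "phiI \<phi> I \<in> carrier_mat (d ^ n) (d ^ n)"
        using pr phiI_car by auto
      show "(of_real (p a * pI p I) \<cdot>\<^sub>m kron (proj (\<phi> a)) (phiI \<phi> I)) $$ (i,j)
        = (of_real (p a) * proj (\<phi> a) $$ (i div d ^ n, j div d ^ n)) * (of_real (pI p I) * phiI \<phi> I $$ (i mod d ^ n, j mod d ^ n))"
        unfolding smult_index[OF kron_carrier[OF c] ij] kron_index[OF c ij] by simp
    qed
    also have "\<dots> = (\<Sum>a<m. of_real (p a) * proj (\<phi> a) $$ (i div d ^ n, j div d ^ n))
        * (\<Sum>I\<in>seqs m n. of_real (pI p I) * phiI \<phi> I $$ (i mod d ^ n, j mod d ^ n))"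
      by (rule sum_product[symmetric])
    also have "(\<Sum>a<m. of_real (p a) * proj (\<phi> a) $$ (i div d ^ n, j div d ^ n)) = \<rho> $$ (i div d ^ n, j div d ^ n)"
      unfolding \<rho>_def ens_state_def msum_index[OF dm(1,2)]
      by (intro sum.cong refl, subst smult_index[OF pr(1)]) (use dm in auto)
    also have "(\<Sum>I\<in>seqs m n. of_real (pI p I) * phiI \<phi> I $$ (i mod d ^ n, j mod d ^ n)) = \<sigma> n $$ (i mod d ^ n, j mod d ^ n)"
      unfolding \<sigma>_def msum_index[OF dm(3,4)]
      by (intro sum.cong refl, subst smult_index[OF phiI_car]) (use dm in auto)
    also have "\<rho> $$ (i div d ^ n, j div d ^ n) * \<sigma> n $$ (i mod d ^ n, j mod d ^ n) = kron \<rho> (\<sigma> n) $$ (i,j)"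
      by (rule kron_index[symmetric, OF _ _ ij]) (simp_all add: \<rho>_def ens_state_def \<sigma>_def)
    finally show "\<sigma> (Suc n) $$ (i,j) = kron \<rho> (\<sigma> n) $$ (i,j)" .
  qed (simp_all add: \<sigma>_def \<rho>_def ens_state_def kron_def)
  moreover have "psd (d ^ Suc n) (\<sigma> (Suc n))"
    unfolding \<sigma>_def
  proof (intro psd_msum psd_smult pI_nonneg[OF p])
    fix I assume "I \<in> seqs m (Suc n)"
    then show "psd (d ^ Suc n) (phiI \<phi> I)"
      using phiI_outer[of m \<phi> d I] \<phi> psd_outer[of "d ^ Suc n" "phi_vec d \<phi> I"] by (auto simp: seqs_def)
  qed auto
  ultimately show ?case
    using Suc vn_entropy_kron[OF \<rho>, of "d ^ n" "\<sigma> n"] tr mtrace_kron[OF psd_carrier[OF \<rho>], of "\<sigma> n" "d ^ n"]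
    by (simp add: psd_carrier ens_entropy_def \<rho>_def[symmetric] algebra_simps)
qed

theorem holevo_le_entropy:
  assumes ens: "ensemble d m \<phi> p" and cp: "cptp (d ^ n) N \<Gamma>"
  shows "holevo N (\<lambda>I. \<Gamma> (phiI \<phi> I)) (pI p) (seqs m n) \<le> real n * ens_entropy d m \<phi> p"
proof -
  have \<phi>: "\<And>i. i < m \<Longrightarrow> \<phi> i \<in> carrier_vec d" and p: "\<And>i. i < m \<Longrightarrow> p i \<ge> 0" and p1: "(\<Sum>i<m. p i) = 1"
    using ens by (auto simp: ensemble_def)
  note norm1 = ensemble_norm[OF ens]
  have eq: "phiI \<phi> I = outer (d ^ n) (phi_vec d \<phi> I) (phi_vec d \<phi> I)" if "I \<in> seqs m n" for I
    using phiI_outer[of m \<phi> d I] \<phi> that by (auto simp: seqs_def)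
  have "holevo N (\<lambda>I. \<Gamma> (outer (d ^ n) (phi_vec d \<phi> I) (phi_vec d \<phi> I))) (pI p) (seqs m n)
    \<le> vn_entropy (msum (d ^ n) (\<lambda>I. of_real (pI p I) \<cdot>\<^sub>m outer (d ^ n) (phi_vec d \<phi> I) (phi_vec d \<phi> I)) (seqs m n))"
  proof (rule holevo_bound_pure[OF cp])
    fix I assume "I \<in> seqs m n"
    then show "(\<Sum>r<d ^ n. (cmod (phi_vec d \<phi> I r))\<^sup>2) = 1"
      using phi_vec_norm[where m = m and d = d and \<phi> = \<phi> and I = I] norm1 by (auto simp: seqs_def)
  qed (auto intro: pI_nonneg[OF p] sum_pI[OF p1])
  also have "msum (d ^ n) (\<lambda>I. of_real (pI p I) \<cdot>\<^sub>m outer (d ^ n) (phi_vec d \<phi> I) (phi_vec d \<phi> I)) (seqs m n)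
     = msum (d ^ n) (\<lambda>I. of_real (pI p I) \<cdot>\<^sub>m phiI \<phi> I) (seqs m n)"
    by (simp add: msum_def eq cong: sum.cong)
  also have "holevo N (\<lambda>I. \<Gamma> (outer (d ^ n) (phi_vec d \<phi> I) (phi_vec d \<phi> I))) (pI p) (seqs m n)
     = holevo N (\<lambda>I. \<Gamma> (phiI \<phi> I)) (pI p) (seqs m n)"
    by (simp add: holevo_def msum_def eq cong: sum.cong)
  finally show ?thesis using tensor_power_state[OF ens, of n] by simp
qed

section \<open>Encodings from operators and letter decoders\<close>

lemma msum_cong: "(\<And>x. x \<in> A \<Longrightarrow> f x = g x) \<Longrightarrow> msum n f A = msum n g A"
  by (simp add: msum_def cong: sum.cong)

text \<open>An encoding may be described by positive operators \<open>W a c\<close> whose trace is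
  the conditional probability of c, with c in any finite set. The entropies can then be stated
  without normalized states or numbered register values.\<close>

lemma encoding_from_operators:
  fixes W :: "nat \<Rightarrow> 'c \<Rightarrow> complex mat" and C :: "'c set"
  assumes C: "finite C" and dB: "dB > 0" and p: "\<And>a. a < m \<Longrightarrow> p a \<ge> 0"
    and psd: "\<And>a c. a < m \<Longrightarrow> c \<in> C \<Longrightarrow> psd dB (W a c)"
    and tr: "\<And>a. a < m \<Longrightarrow> (\<Sum>c\<in>C. Re (mtrace (W a c))) = 1"
  obtains q \<omega> e where "bij_betw e {..<card C} C" "valid_encoding m dB (card C) q \<omega>"
    "mi_AC m p dB (card C) q \<omega> = (\<Sum>a<m. ent (p a)) + (\<Sum>c\<in>C. ent (\<Sum>a<m. p a * Re (mtrace (W a c))))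
       - (\<Sum>a<m. \<Sum>c\<in>C. ent (p a * Re (mtrace (W a c))))"
    "mi_AC m p dB (card C) q \<omega> + cmi_ABC m p dB (card C) q \<omega> = (\<Sum>a<m. ent (p a))
       + (\<Sum>c\<in>C. vn_entropy (msum dB (\<lambda>a. of_real (p a) \<cdot>\<^sub>m W a c) {..<m}))
       - (\<Sum>a<m. \<Sum>c\<in>C. vn_entropy (of_real (p a) \<cdot>\<^sub>m W a c))"
    "\<And>a b b' c. a < m \<Longrightarrow> b < dB \<Longrightarrow> b' < dB \<Longrightarrow> c < card C \<Longrightarrow>
       enc_map dB (card C) q \<omega> a $$ (b * card C + c, b' * card C + c) = W a (e c) $$ (b,b')"
proof -
  obtain e where e: "bij_betw e {..<card C} C"
    using ex_bij_betw_nat_finite[OF C] by (auto simp: atLeast0LessThan)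
  have eC: "e c \<in> C" if "c < card C" for c using e that by (auto simp: bij_betw_def)
  define q where "q a c = Re (mtrace (W a (e c)))" for a c
  \<comment> \<open>At probability zero any density will do; the projector onto the first basis
    vector exists because \<open>dB > 0\<close>.\<close>
  define \<omega> where "\<omega> a c = (if q a c = 0 then ket_proj dB 0 else of_real (1 / q a c) \<cdot>\<^sub>m W a (e c))" for a c
  have q0: "q a c \<ge> 0" if "a < m" "c < card C" for a c
    unfolding q_def using psd_mtrace_nonneg[OF psd] eC that by auto
  have dens: "density dB (\<omega> a c)" if "a < m" "c < card C" for a c
  proof (cases "q a c = 0")
    case True
    then show ?thesis using density_ket_proj[OF dB] by (simp add: \<omega>_def)
  next
    case False
    have W: "psd dB (W a (e c))" using psd eC that by auto
    have "mtrace (of_real (1 / q a c) \<cdot>\<^sub>m W a (e c)) = complex_of_real (1 / q a c) * complex_of_real (q a c)"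
      unfolding q_def using mtrace_smult[OF psd_carrier[OF W]] psd_mtrace_real[OF W] by metis
    also have "\<dots> = 1" using False by simp
    finally show ?thesis
      using False psd_smult[OF W, of "1 / q a c"] q0[OF that] by (simp add: \<omega>_def density_def)
  qed
  have q\<omega>: "of_real (q a c) \<cdot>\<^sub>m \<omega> a c = W a (e c)" if "a < m" "c < card C" for a c
  proof -
    have W: "psd dB (W a (e c))" using psd eC that by auto
    note Wc = psd_carrier[OF W]
    show ?thesis
    proof (cases "q a c = 0")
      case True
      then have "W a (e c) = 0\<^sub>m dB dB" using psd_trace_zero[OF W] by (simp add: q_def)
      then show ?thesis using True by (intro eq_matI) (auto simp: \<omega>_def ket_proj_def)
    next
      case False
      then show ?thesis using Wc by (intro eq_matI) (auto simp: \<omega>_def)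
    qed
  qed
  have re: "(\<Sum>c<card C. F (e c)) = (\<Sum>c\<in>C. F c)" for F :: "'c \<Rightarrow> real"
    by (rule sum.reindex_bij_betw[OF e])
  have v: "valid_encoding m dB (card C) q \<omega>"
    unfolding valid_encoding_def using q0 dens tr re[of "\<lambda>c. Re (mtrace (W _ c))"] by (auto simp: q_def)
  have pq: "of_real (p a * q a c) \<cdot>\<^sub>m \<omega> a c = of_real (p a) \<cdot>\<^sub>m W a (e c)"
    if "a < m" "c < card C" for a c
    unfolding q\<omega>[OF that, symmetric] by (intro eq_matI) (auto simp: mult_ac)
  show ?thesis
  proof (rule that[OF e v])
    show "mi_AC m p dB (card C) q \<omega> = (\<Sum>a<m. ent (p a)) + (\<Sum>c\<in>C. ent (\<Sum>a<m. p a * Re (mtrace (W a c))))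
       - (\<Sum>a<m. \<Sum>c\<in>C. ent (p a * Re (mtrace (W a c))))"
      using encoding_entropies(1)[OF v, of p] p unfolding q_def
      by (simp add: re[of "\<lambda>c. ent (\<Sum>a<m. p a * Re (mtrace (W a c)))"] re[of "\<lambda>c. ent (p _ * Re (mtrace (W _ c)))"])
    have "(\<Sum>c<card C. vn_entropy (msum dB (\<lambda>a. of_real (p a * q a c) \<cdot>\<^sub>m \<omega> a c) {..<m}))
      = (\<Sum>c<card C. vn_entropy (msum dB (\<lambda>a. of_real (p a) \<cdot>\<^sub>m W a (e c)) {..<m}))"
      by (intro sum.cong refl arg_cong[where f = vn_entropy] msum_cong pq) auto
    also have "\<dots> = (\<Sum>c\<in>C. vn_entropy (msum dB (\<lambda>a. of_real (p a) \<cdot>\<^sub>m W a c) {..<m}))"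
      by (rule re)
    finally have 1: "(\<Sum>c<card C. vn_entropy (msum dB (\<lambda>a. of_real (p a * q a c) \<cdot>\<^sub>m \<omega> a c) {..<m}))
      = (\<Sum>c\<in>C. vn_entropy (msum dB (\<lambda>a. of_real (p a) \<cdot>\<^sub>m W a c) {..<m}))" .
    have "(\<Sum>a<m. \<Sum>c<card C. vn_entropy (of_real (p a * q a c) \<cdot>\<^sub>m \<omega> a c))
      = (\<Sum>a<m. \<Sum>c<card C. vn_entropy (of_real (p a) \<cdot>\<^sub>m W a (e c)))"
      by (intro sum.cong refl arg_cong[where f = vn_entropy] pq) auto
    also have "\<dots> = (\<Sum>a<m. \<Sum>c\<in>C. vn_entropy (of_real (p a) \<cdot>\<^sub>m W a c))"
      by (intro sum.cong refl re)
    finally show "mi_AC m p dB (card C) q \<omega> + cmi_ABC m p dB (card C) q \<omega> = (\<Sum>a<m. ent (p a))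
       + (\<Sum>c\<in>C. vn_entropy (msum dB (\<lambda>a. of_real (p a) \<cdot>\<^sub>m W a c) {..<m}))
       - (\<Sum>a<m. \<Sum>c\<in>C. vn_entropy (of_real (p a) \<cdot>\<^sub>m W a c))"
      using encoding_entropies(2)[OF v, of p] p 1 by simp
  next
    fix a b b' c assume a: "a < m" and b: "b < dB" "b' < dB" and c: "c < card C"
    have "\<omega> a c \<in> carrier_mat dB dB" using dens[OF a c] by (simp add: density_def psd_def)
    then have "of_real (q a c) * \<omega> a c $$ (b,b') = (of_real (q a c) \<cdot>\<^sub>m \<omega> a c) $$ (b,b')"
      using b by simp
    then show "enc_map dB (card C) q \<omega> a $$ (b * card C + c, b' * card C + c) = W a (e c) $$ (b,b')"
      unfolding enc_map_index[OF v a b c c] q\<omega>[OF a c] by simp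
  qed
qed

text \<open>The basis index of \<open>(\<complex>\<^sup>d)\<^sup>\<otimes>\<^sup>n \<otimes> \<H>\<^sub>C\<close> whose \<open>k\<close>-th letter is \<open>r\<close>, with
  \<open>x\<close> before it, \<open>z\<close> after it and register value \<open>y\<close>.\<close>
definition letter_index :: "nat \<Rightarrow> nat \<Rightarrow> nat \<Rightarrow> nat \<Rightarrow> nat \<times> nat \<times> nat \<Rightarrow> nat \<Rightarrow> nat" where
  "letter_index d n dc k = (\<lambda>(x,z,y) r. ((x * d + r) * d ^ (n - k - 1) + z) * dc + y)"

definition letter_env :: "nat \<Rightarrow> nat \<Rightarrow> nat \<Rightarrow> nat \<Rightarrow> (nat \<times> nat \<times> nat) set" where
  "letter_env d n dc k = {..<d ^ k} \<times> {..<d ^ (n - k - 1)} \<times> {..<dc}"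

definition letter_state :: "nat \<Rightarrow> nat \<Rightarrow> nat \<Rightarrow> nat \<Rightarrow> complex mat \<Rightarrow> complex mat" where
  "letter_state d n dc k X = mat d d (\<lambda>(r,s). \<Sum>l\<in>letter_env d n dc k.
     X $$ (letter_index d n dc k l r, letter_index d n dc k l s))"

lemma finite_letter_env [simp]: "finite (letter_env d n dc k)"
  by (simp add: letter_env_def)

lemma power_split:
  fixes d :: nat
  assumes "k < n"
  shows "d ^ n = d ^ k * d * d ^ (n - k - 1)"
proof -
  have "n = Suc k + (n - k - 1)" using assms by simp
  then have "d ^ n = d ^ (Suc k + (n - k - 1))" by (rule arg_cong)
  then show ?thesis by (simp only: power_add power_Suc2)
qed

lemma letter_index_less:
  assumes "k < n" "l \<in> letter_env d n dc k" "r < d"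
  shows "letter_index d n dc k l r < d ^ n * dc"
  using assms unfolding letter_env_def letter_index_def power_split[OF assms(1)]
  by (auto intro!: mult_add_less)

lemma letter_index_inj:
  assumes "l \<in> letter_env d n dc k" "r < d" "l' \<in> letter_env d n dc k" "r' < d"
    and "letter_index d n dc k l r = letter_index d n dc k l' r'"
  shows "l = l' \<and> r = r'"
proof -
  obtain x z y x' z' y' where l: "l = (x,z,y)" "l' = (x',z',y')" by (cases l, cases l')
  have lt: "z < d ^ (n - k - 1)" "y < dc" "z' < d ^ (n - k - 1)" "y' < dc"
    using assms(1,3) by (auto simp: letter_env_def l)
  have 1: "(x * d + r) * d ^ (n - k - 1) + z = (x' * d + r') * d ^ (n - k - 1) + z' \<and> y = y'"
    using assms(5) lt unfolding letter_index_def l by (intro mult_add_inj[where b = dc]) auto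
  have 2: "x * d + r = x' * d + r' \<and> z = z'"
    using 1 lt by (intro mult_add_inj[where b = "d ^ (n - k - 1)"]) auto
  have 3: "x = x' \<and> r = r'"
    using 2 assms(2,4) by (intro mult_add_inj[where b = d]) auto
  from 1 2 3 show ?thesis by (simp add: l)
qed

lemma card_letter_env:
  assumes "k < n"
  shows "card (letter_env d n dc k) * d = d ^ n * dc"
  unfolding power_split[OF assms] by (simp add: letter_env_def card_cartesian_product mult_ac)

text \<open>Merging the partial traces over the register and the other letters into a single sum
  over \<open>letter_env\<close> brings the fidelity hypothesis into the form of
  \<open>cptp_index_map\<close>.\<close>

lemma keep_mid_letter_state:
  assumes "k < n" "X \<in> carrier_mat (d ^ n * dc) (d ^ n * dc)"
  shows "keep_mid (d ^ k) d (d ^ (n - k - 1)) (ptrace_mid (d ^ n) dc 1 X) = letter_state d n dc k X"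
proof (rule eq_matI)
  fix r s assume "r < dim_row (letter_state d n dc k X)" "s < dim_col (letter_state d n dc k X)"
  then have rs: "r < d" "s < d" by (auto simp: letter_state_def)
  have lt: "(x * d + i) * d ^ (n - k - 1) + z < d ^ n" if "x < d ^ k" "i < d" "z < d ^ (n - k - 1)" for x i z
    using that unfolding power_split[OF assms(1)] by (intro mult_add_less)
  have "keep_mid (d ^ k) d (d ^ (n - k - 1)) (ptrace_mid (d ^ n) dc 1 X) $$ (r,s)
    = (\<Sum>x<d ^ k. \<Sum>z<d ^ (n - k - 1). \<Sum>y<dc. X $$ (letter_index d n dc k (x,z,y) r, letter_index d n dc k (x,z,y) s))"
    using rs unfolding keep_mid_def
    by (auto simp: ptrace_mid_def lt letter_index_def simp del: One_nat_def diff_diff_left intro!: sum.cong)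
  also have "\<dots> = letter_state d n dc k X $$ (r,s)"
    using rs by (simp add: letter_state_def letter_env_def sum.cartesian_product split_def)
  finally show "keep_mid (d ^ k) d (d ^ (n - k - 1)) (ptrace_mid (d ^ n) dc 1 X) $$ (r,s) = letter_state d n dc k X $$ (r,s)" .
qed (simp_all add: keep_mid_def letter_state_def)

text \<open>The decoder reads c from the register, keeps the letter at position
  \<open>\<kappa> c\<close> and traces out everything else. It reads only entries that are diagonal
  in the register, so the premise relating X and Y concerns these alone.\<close>

lemma letter_decoder:
  assumes \<kappa>: "\<And>c. c < dC \<Longrightarrow> \<kappa> c < n"
  shows "\<exists>D. cptp (d ^ n * dc * dC) d D \<and>
    (\<forall>X Y. (\<forall>b<d ^ n * dc. \<forall>b'<d ^ n * dc. \<forall>c<dC. X $$ (b * dC + c, b' * dC + c) = Y c $$ (b,b')) \<longrightarrow>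
      D X = msum d (\<lambda>c. letter_state d n dc (\<kappa> c) (Y c)) {..<dC})"
proof -
  define L where "L = (SIGMA c:{..<dC}. letter_env d n dc (\<kappa> c))"
  define g where "g l r = letter_index d n dc (\<kappa> (fst l)) (snd l) r * dC + fst l" for l r
  have fin: "finite L" by (simp add: L_def)
  have inj: "inj_on (\<lambda>(l,r). g l r) (L \<times> {..<d})"
  proof (rule inj_onI)
    fix z z' assume z: "z \<in> L \<times> {..<d}" "z' \<in> L \<times> {..<d}" "(\<lambda>(l,r). g l r) z = (\<lambda>(l,r). g l r) z'"
    obtain c l r c' l' r' where zz: "z = ((c,l),r)" "z' = ((c',l'),r')" by (cases z; cases z'; cases "fst z"; cases "fst z'") auto
    have *: "(c,l) \<in> L" "(c',l') \<in> L" "r \<in> {..<d}" "r' \<in> {..<d}" "g (c,l) r = g (c',l') r'"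
      using z by (auto simp: zz)
    then have "letter_index d n dc (\<kappa> c) l r = letter_index d n dc (\<kappa> c') l' r' \<and> c = c'"
      unfolding g_def L_def by (intro mult_add_inj[where b = dC]) auto
    then have "c = c' \<and> l = l' \<and> r = r'"
      using letter_index_inj[of l d n dc "\<kappa> c" r l' r'] * by (auto simp: L_def)
    then show "z = z'" by (simp add: zz)
  qed
  have sub: "(\<lambda>(l,r). g l r) ` (L \<times> {..<d}) \<subseteq> {..<d ^ n * dc * dC}"
    using letter_index_less[OF \<kappa>] by (auto simp: g_def L_def intro!: mult_add_less)
  \<comment> \<open>Surjectivity follows by counting: for every c the environment has the size that
    fills one full block.\<close>
  have "card ((\<lambda>(l,r). g l r) ` (L \<times> {..<d})) = card L * d"
    by (simp add: card_image[OF inj] card_cartesian_product)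
  also have "card L = (\<Sum>c<dC. card (letter_env d n dc (\<kappa> c)))" by (simp add: L_def)
  also have "\<dots> * d = (\<Sum>c<dC. d ^ n * dc)"
    unfolding sum_distrib_right by (intro sum.cong refl card_letter_env \<kappa>) auto
  finally have "card ((\<lambda>(l,r). g l r) ` (L \<times> {..<d})) = card {..<d ^ n * dc * dC}" by (simp add: mult_ac)
  then have "bij_betw (\<lambda>(l,r). g l r) (L \<times> {..<d}) {..<d ^ n * dc * dC}"
    using inj card_subset_eq[OF _ sub] by (simp add: bij_betw_def)
  from cptp_index_map[OF fin this]
  have cp: "cptp (d ^ n * dc * dC) d (\<lambda>X. mat d d (\<lambda>(r,s). \<Sum>l\<in>L. X $$ (g l r, g l s)))" .
  have eq: "mat d d (\<lambda>(r,s). \<Sum>l\<in>L. X $$ (g l r, g l s)) = msum d (\<lambda>c. letter_state d n dc (\<kappa> c) (Y c)) {..<dC}"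
    if XY: "\<And>b b' c. b < d ^ n * dc \<Longrightarrow> b' < d ^ n * dc \<Longrightarrow> c < dC \<Longrightarrow> X $$ (b * dC + c, b' * dC + c) = Y c $$ (b,b')"
    for X :: "complex mat" and Y :: "nat \<Rightarrow> complex mat"
  proof (rule eq_matI)
    fix r s assume "r < dim_row (msum d (\<lambda>c. letter_state d n dc (\<kappa> c) (Y c)) {..<dC})"
      "s < dim_col (msum d (\<lambda>c. letter_state d n dc (\<kappa> c) (Y c)) {..<dC})"
    then have rs: "r < d" "s < d" by auto
    have "(\<Sum>l\<in>L. X $$ (g l r, g l s))
      = (\<Sum>c<dC. \<Sum>l\<in>letter_env d n dc (\<kappa> c). X $$ (g (c,l) r, g (c,l) s))"
      unfolding L_def by (subst sum.Sigma) (auto simp: split_def)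
    also have "\<dots> = (\<Sum>c<dC. \<Sum>l\<in>letter_env d n dc (\<kappa> c).
        Y c $$ (letter_index d n dc (\<kappa> c) l r, letter_index d n dc (\<kappa> c) l s))"
      using rs by (intro sum.cong refl) (simp add: g_def XY letter_index_less[OF \<kappa>])
    finally show "mat d d (\<lambda>(r,s). \<Sum>l\<in>L. X $$ (g l r, g l s)) $$ (r,s)
      = msum d (\<lambda>c. letter_state d n dc (\<kappa> c) (Y c)) {..<dC} $$ (r,s)"
      using rs by (simp add: letter_state_def)
  qed auto
  show ?thesis
  proof (rule exI, rule conjI[OF cp], intro allI impI)
    fix X :: "complex mat" and Y :: "nat \<Rightarrow> complex mat"
    assume "\<forall>b<d ^ n * dc. \<forall>b'<d ^ n * dc. \<forall>c<dC. X $$ (b * dC + c, b' * dC + c) = Y c $$ (b,b')"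
    then show "mat d d (\<lambda>(r,s). \<Sum>l\<in>L. X $$ (g l r, g l s)) = msum d (\<lambda>c. letter_state d n dc (\<kappa> c) (Y c)) {..<dC}"
      by (intro eq) blast
  qed
qed

lemma fid_qform:
  assumes "\<psi> \<in> carrier_vec d" "A \<in> carrier_mat d d"
  shows "fid \<psi> A = Re (qform d A (vec_index \<psi>))"
proof -
  have "mtrace (proj \<psi> * A) = (\<Sum>i<d. \<Sum>j<d. \<psi> $ i * cnj (\<psi> $ j) * A $$ (j,i))"
    using assms(2) unfolding proj_outer[OF assms(1)]
    by (simp add: mtrace_def outer_def scalar_prod_def atLeast0LessThan)
  also have "\<dots> = (\<Sum>j<d. \<Sum>i<d. \<psi> $ i * cnj (\<psi> $ j) * A $$ (j,i))" by (rule sum.swap)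
  also have "\<dots> = qform d A (vec_index \<psi>)"
    unfolding qform_def by (intro sum.cong refl) simp
  finally show ?thesis by (simp add: fid_def)
qed

section \<open>The averaged encoding\<close>

text \<open>This is the compression of X by the projector onto register value j, the least
  significant digit of the index. The full dimension is kept, so that operators with j announced and
  with j withheld live on the same space.\<close>

definition blk :: "nat \<Rightarrow> nat \<Rightarrow> nat \<Rightarrow> complex mat \<Rightarrow> complex mat" where
  "blk D dc j X = mat D D (\<lambda>(r,s). if r mod dc = j \<and> s mod dc = j then X $$ (r,s) else 0)"

lemma blk_carrier [simp]: "blk D dc j X \<in> carrier_mat D D"
  by (simp add: blk_def)

lemma blk_msum: "blk D dc j (msum D f A) = msum D (\<lambda>x. blk D dc j (f x)) A"
  by (intro eq_matI) (auto simp: blk_def)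

lemma blk_smult: "X \<in> carrier_mat D D \<Longrightarrow> blk D dc j (c \<cdot>\<^sub>m X) = c \<cdot>\<^sub>m blk D dc j X"
  by (intro eq_matI) (auto simp: blk_def)

lemma psd_blk:
  assumes "psd D X"
  shows "psd D (blk D dc j X)"
proof -
  have "qform D (blk D dc j X) v = qform D X (\<lambda>r. if r mod dc = j then v r else 0)" for v
    unfolding qform_def by (intro sum.cong refl) (auto simp: blk_def)
  then show ?thesis using assms by (simp add: psd_iff_qform)
qed

lemma sum_mtrace_blk:
  assumes "X \<in> carrier_mat D D" "dc > 0"
  shows "(\<Sum>j<dc. mtrace (blk D dc j X)) = mtrace X"
proof -
  have "(\<Sum>j<dc. mtrace (blk D dc j X)) = (\<Sum>r<D. \<Sum>j<dc. if r mod dc = j then X $$ (r,r) else 0)"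
    by (subst sum.swap) (simp add: mtrace_def blk_def)
  then show ?thesis using assms by (auto simp: mtrace_def)
qed

text \<open>X is the direct sum of its register blocks, and padding a block with zeros adds no
  entropy. This is why announcing j leaves S(A:BC) unchanged.\<close>

lemma vn_entropy_blk:
  assumes X: "psd (N * dc) X"
    and off: "\<And>b b' j j'. b < N \<Longrightarrow> b' < N \<Longrightarrow> j < dc \<Longrightarrow> j' < dc \<Longrightarrow> j \<noteq> j' \<Longrightarrow> X $$ (b * dc + j, b' * dc + j') = 0"
  shows "vn_entropy X = (\<Sum>j<dc. vn_entropy (blk (N * dc) dc j X))"
proof -
  define Y where "Y j = mat N N (\<lambda>(b,b'). X $$ (b * dc + j, b' * dc + j))" for j
  have Y: "psd N (Y j)" if "j < dc" for j
    unfolding Y_def using that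
    by (intro psd_submatrix[OF X, of "\<lambda>b. b * dc + j"]) (auto simp: inj_on_def intro!: mult_add_less)
  have "vn_entropy X = (\<Sum>j\<in>{..<dc}. vn_entropy (Y j))"
    by (rule vn_entropy_block[where g = "\<lambda>j b. b * dc + j" and n = N])
       (use Y off psd_carrier[OF X] in \<open>auto simp: bij_mult_add_swap Y_def\<close>)
  moreover have "vn_entropy (blk (N * dc) dc j X) = vn_entropy (Y j)" if j: "j < dc" for j
  proof -
    have "vn_entropy (blk (N * dc) dc j X) = (\<Sum>i\<in>{..<dc}. vn_entropy (if i = j then Y j else 0\<^sub>m N N))"
      by (rule vn_entropy_block[where g = "\<lambda>j b. b * dc + j" and n = N])
         (use Y j in \<open>auto simp: bij_mult_add_swap Y_def blk_def mult_add_less psd_zero\<close>)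
    also have "\<dots> = (\<Sum>i<dc. if i = j then vn_entropy (Y j) else 0)"
      by (intro sum.cong refl) simp
    finally show ?thesis using j by simp
  qed
  ultimately show ?thesis by simp
qed

lemma letter_state_carrier [simp]: "letter_state d n dc k X \<in> carrier_mat d d"
  by (simp add: letter_state_def)

lemma letter_state_smult:
  assumes "k < n" "X \<in> carrier_mat (d ^ n * dc) (d ^ n * dc)"
  shows "letter_state d n dc k (c \<cdot>\<^sub>m X) = c \<cdot>\<^sub>m letter_state d n dc k X"
  using assms(2) by (intro eq_matI)
    (auto simp: letter_state_def letter_index_less[OF assms(1)] sum_distrib_left intro!: sum.cong)

lemma letter_state_msum:
  assumes "k < n"
  shows "letter_state d n dc k (msum (d ^ n * dc) f A) = msum d (\<lambda>x. letter_state d n dc k (f x)) A"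
proof (rule eq_matI)
  fix r s assume "r < dim_row (msum d (\<lambda>x. letter_state d n dc k (f x)) A)"
    "s < dim_col (msum d (\<lambda>x. letter_state d n dc k (f x)) A)"
  then have rs: "r < d" "s < d" by auto
  have "letter_state d n dc k (msum (d ^ n * dc) f A) $$ (r,s)
    = (\<Sum>l\<in>letter_env d n dc k. \<Sum>x\<in>A. f x $$ (letter_index d n dc k l r, letter_index d n dc k l s))"
    using rs by (simp add: letter_state_def letter_index_less[OF assms])
  also have "\<dots> = (\<Sum>x\<in>A. \<Sum>l\<in>letter_env d n dc k. f x $$ (letter_index d n dc k l r, letter_index d n dc k l s))"
    by (rule sum.swap)
  finally show "letter_state d n dc k (msum (d ^ n * dc) f A) $$ (r,s)
    = msum d (\<lambda>x. letter_state d n dc k (f x)) A $$ (r,s)"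
    using rs by (simp add: letter_state_def)
qed (simp_all add: letter_state_def)

text \<open>The letter state traces out the register, so the blocks for the values j recombine:
  announcing j does not alter the decoded letter.\<close>

lemma letter_state_blk:
  assumes "k < n"
  shows "msum d (\<lambda>j. letter_state d n dc k (blk (d ^ n * dc) dc j X)) {..<dc} = letter_state d n dc k X"
proof (rule eq_matI)
  fix r s assume "r < dim_row (letter_state d n dc k X)" "s < dim_col (letter_state d n dc k X)"
  then have rs: "r < d" "s < d" by (auto simp: letter_state_def)
  have "(\<Sum>j<dc. blk (d ^ n * dc) dc j X $$ (letter_index d n dc k l r, letter_index d n dc k l s))
     = X $$ (letter_index d n dc k l r, letter_index d n dc k l s)" if l: "l \<in> letter_env d n dc k" for l
  proof -
    obtain x z y where xzy: "l = (x,z,y)" by (cases l)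
    have y: "y < dc" using l by (simp add: letter_env_def xzy)
    have "(\<Sum>j<dc. blk (d ^ n * dc) dc j X $$ (letter_index d n dc k l r, letter_index d n dc k l s))
      = (\<Sum>j<dc. if j = y then X $$ (letter_index d n dc k l r, letter_index d n dc k l s) else 0)"
      using letter_index_less[OF assms l rs(1)] letter_index_less[OF assms l rs(2)] y
      by (intro sum.cong refl) (auto simp: blk_def, auto simp: letter_index_def xzy)
    then show ?thesis using y by simp
  qed
  then have "(\<Sum>l\<in>letter_env d n dc k. \<Sum>j<dc. blk (d ^ n * dc) dc j X $$ (letter_index d n dc k l r, letter_index d n dc k l s))
    = letter_state d n dc k X $$ (r,s)"
    using rs by (simp add: letter_state_def)
  then show "msum d (\<lambda>j. letter_state d n dc k (blk (d ^ n * dc) dc j X)) {..<dc} $$ (r,s) = letter_state d n dc k X $$ (r,s)"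
    using rs by (subst (asm) sum.swap) (simp add: letter_state_def)
qed (simp_all add: letter_state_def)

section \<open>Mean states over the continuations of a prefix\<close>

locale block_code =
  fixes m n N dc :: nat and p :: "nat \<Rightarrow> real" and G :: "nat list \<Rightarrow> complex mat"
  assumes p_nonneg: "i < m \<Longrightarrow> p i \<ge> 0" and p_sum: "(\<Sum>i<m. p i) = 1"
    and n_pos: "n > 0" and N_pos: "N > 0" and dc_pos: "dc > 0"
    and G_psd: "I \<in> seqs m n \<Longrightarrow> psd (N * dc) (G I)"
    and G_trace: "I \<in> seqs m n \<Longrightarrow> mtrace (G I) = 1"
    and G_block: "I \<in> seqs m n \<Longrightarrow> b < N \<Longrightarrow> b' < N \<Longrightarrow> j < dc \<Longrightarrow> j' < dc \<Longrightarrow> j \<noteq> j' \<Longrightarrow>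
      G I $$ (b * dc + j, b' * dc + j') = 0"
begin

definition sig :: "nat list \<Rightarrow> complex mat" where
  "sig J = msum (N * dc) (\<lambda>K. of_real (pI p K) \<cdot>\<^sub>m G (J @ K)) (seqs m (n - length J))"

definition blks :: "nat list \<Rightarrow> nat \<Rightarrow> complex mat" where
  "blks J j = blk (N * dc) dc j (sig J)"

text \<open>This is the conditional probability of register value j given the prefix J; on full
  sequences it becomes p(j|I).\<close>

definition P :: "nat list \<Rightarrow> nat \<Rightarrow> real" where
  "P J j = Re (mtrace (blks J j))"

lemma append_seqs: "J \<in> seqs m k \<Longrightarrow> k \<le> n \<Longrightarrow> K \<in> seqs m (n - length J) \<Longrightarrow> J @ K \<in> seqs m n"
  using seqs_append[of J m k K "n - k"] by (simp add: seqs_length)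

lemma snoc_seqs: "J \<in> seqs m k \<Longrightarrow> a < m \<Longrightarrow> J @ [a] \<in> seqs m (Suc k)"
  by (auto simp: seqs_def)

lemma sig_psd: "J \<in> seqs m k \<Longrightarrow> k \<le> n \<Longrightarrow> psd (N * dc) (sig J)"
  unfolding sig_def by (intro psd_msum psd_smult G_psd append_seqs pI_nonneg[OF p_nonneg])

lemma sig_carrier [simp]: "sig J \<in> carrier_mat (N * dc) (N * dc)"
  by (simp add: sig_def)

lemma sig_trace:
  assumes "J \<in> seqs m k" "k \<le> n"
  shows "mtrace (sig J) = 1"
proof -
  have *: "G (J @ K) \<in> carrier_mat (N * dc) (N * dc)" "mtrace (G (J @ K)) = 1" if "K \<in> seqs m (n - length J)" for K
    using append_seqs[OF assms that] G_psd G_trace psd_carrier by auto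
  have "mtrace (sig J) = (\<Sum>K\<in>seqs m (n - length J). complex_of_real (pI p K))"
    unfolding sig_def using * by (subst mtrace_msum[where N = "N * dc"]) (auto simp: mtrace_smult[OF *(1)])
  then show ?thesis using sum_pI[OF p_sum, of "n - length J"] by (metis of_real_1 of_real_sum)
qed

lemma sig_block:
  assumes "J \<in> seqs m k" "k \<le> n" "b < N" "b' < N" "j < dc" "j' < dc" "j \<noteq> j'"
  shows "sig J $$ (b * dc + j, b' * dc + j') = 0"
proof -
  have lt: "b * dc + j < N * dc" "b' * dc + j' < N * dc" using assms by (auto intro: mult_add_less)
  show ?thesis unfolding sig_def msum_index[OF lt]
  proof (intro sum.neutral ballI)
    fix K assume "K \<in> seqs m (n - length J)"
    then have I: "J @ K \<in> seqs m n" using append_seqs assms by blast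
    show "(of_real (pI p K) \<cdot>\<^sub>m G (J @ K)) $$ (b * dc + j, b' * dc + j') = 0"
      unfolding smult_index[OF psd_carrier[OF G_psd[OF I]] lt] using G_block[OF I] assms by simp
  qed
qed

lemma sig_step:
  assumes "J \<in> seqs m k" "k < n"
  shows "sig J = msum (N * dc) (\<lambda>a. of_real (p a) \<cdot>\<^sub>m sig (J @ [a])) {..<m}"
proof (rule eq_matI)
  fix r s assume "r < dim_row (msum (N * dc) (\<lambda>a. of_real (p a) \<cdot>\<^sub>m sig (J @ [a])) {..<m})"
    "s < dim_col (msum (N * dc) (\<lambda>a. of_real (p a) \<cdot>\<^sub>m sig (J @ [a])) {..<m})"
  then have rs: "r < N * dc" "s < N * dc" by auto
  have len: "length J = k" using assms(1) by (rule seqs_length)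
  have Suc: "n - k = Suc (n - Suc k)" using assms(2) by simp
  have car: "G (J @ a # K) \<in> carrier_mat (N * dc) (N * dc)" if "a < m" "K \<in> seqs m (n - Suc k)" for a K
    using append_seqs[OF snoc_seqs[OF assms(1) that(1)], of K] that assms(2) len G_psd psd_carrier by auto
  have "sig J $$ (r,s) = (\<Sum>a<m. \<Sum>K\<in>seqs m (n - Suc k). (of_real (p a * pI p K) \<cdot>\<^sub>m G (J @ a # K)) $$ (r,s))"
    using rs by (simp add: sig_def len Suc sum_seqs_Suc)
  also have "\<dots> = (\<Sum>a<m. of_real (p a) * sig (J @ [a]) $$ (r,s))"
    using rs len unfolding sig_def
    by (auto intro!: sum.cong simp: sum_distrib_left smult_index[OF car])
  finally show "sig J $$ (r,s) = msum (N * dc) (\<lambda>a. of_real (p a) \<cdot>\<^sub>m sig (J @ [a])) {..<m} $$ (r,s)"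
    using rs by (simp add: smult_index[OF sig_carrier])
qed (simp_all add: sig_def)

lemma sig_full:
  assumes "I \<in> seqs m n"
  shows "sig I = G I"
proof -
  have "sig I = msum (N * dc) (\<lambda>K. of_real (pI p K) \<cdot>\<^sub>m G (I @ K)) {[]}"
    using assms by (simp add: sig_def seqs_length)
  also have "\<dots> = G I" using psd_carrier[OF G_psd[OF assms]] by (intro eq_matI) auto
  finally show ?thesis .
qed

lemma blks_carrier [simp]: "blks J j \<in> carrier_mat (N * dc) (N * dc)"
  by (simp add: blks_def)

lemma blks_psd: "J \<in> seqs m k \<Longrightarrow> k \<le> n \<Longrightarrow> psd (N * dc) (blks J j)"
  unfolding blks_def by (intro psd_blk sig_psd)

lemma blks_step:
  assumes "J \<in> seqs m k" "k < n"
  shows "blks J j = msum (N * dc) (\<lambda>a. of_real (p a) \<cdot>\<^sub>m blks (J @ [a]) j) {..<m}"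
  unfolding blks_def by (subst sig_step[OF assms]) (simp add: blk_msum blk_smult)

lemma P_nonneg: "J \<in> seqs m k \<Longrightarrow> k \<le> n \<Longrightarrow> P J j \<ge> 0"
  unfolding P_def by (rule psd_mtrace_nonneg[OF blks_psd])

lemma P_sum: "J \<in> seqs m k \<Longrightarrow> k \<le> n \<Longrightarrow> (\<Sum>j<dc. P J j) = 1"
  unfolding P_def blks_def Re_sum[symmetric]
  using sum_mtrace_blk[OF sig_carrier dc_pos, of J] sig_trace by simp

lemma P_step: "J \<in> seqs m k \<Longrightarrow> k < n \<Longrightarrow> P J j = (\<Sum>a<m. p a * P (J @ [a]) j)"
  unfolding P_def
  by (subst blks_step, assumption, assumption, subst mtrace_msum[where N = "N * dc"])
     (auto simp: mtrace_smult[OF blks_carrier])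

lemma vn_blks: "J \<in> seqs m k \<Longrightarrow> k \<le> n \<Longrightarrow> vn_entropy (sig J) = (\<Sum>j<dc. vn_entropy (blks J j))"
  unfolding blks_def by (rule vn_entropy_blk[OF sig_psd]) (auto intro: sig_block)

text \<open>The length k is stored beside the prefix J so that the decoder finds the position of the
  encoded letter as the first component; positions count from 0, so a letter appended to J stands at
  position k.\<close>

definition reg :: "((nat \<times> nat list) \<times> nat option) set" where
  "reg = (SIGMA k:{..<n}. seqs m k) \<times> insert None (Some ` {..<dc})"

lemma finite_reg: "finite reg"
  by (simp add: reg_def)

lemma sum_reg:
  "(\<Sum>c\<in>reg. F c) = (\<Sum>k<n. \<Sum>J\<in>seqs m k. F ((k,J),None) + (\<Sum>j<dc. F ((k,J),Some j)))"
  for F :: "_ \<Rightarrow> 'b :: comm_monoid_add"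
proof -
  have "(\<Sum>c\<in>reg. F c) = (\<Sum>z\<in>(SIGMA k:{..<n}. seqs m k). \<Sum>v\<in>insert None (Some ` {..<dc}). F (z,v))"
    unfolding reg_def by (subst sum.cartesian_product) (simp add: split_def)
  also have "\<dots> = (\<Sum>z\<in>(SIGMA k:{..<n}. seqs m k). F (z,None) + (\<Sum>j<dc. F (z,Some j)))"
    by (intro sum.cong refl) (simp add: sum.reindex)
  also have "\<dots> = (\<Sum>k<n. \<Sum>J\<in>seqs m k. F ((k,J),None) + (\<Sum>j<dc. F ((k,J),Some j)))"
    by (subst sum.Sigma) (auto simp: split_def)
  finally show ?thesis .
qed

text \<open>The factor \<open>1 / real n\<close> is the uniform choice of the length, and
  \<open>pI p J\<close> the product distribution on prefixes of that length.\<close>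

definition wt :: "nat list \<Rightarrow> real" where
  "wt J = pI p J / real n"

lemma wt_nonneg: "J \<in> seqs m k \<Longrightarrow> wt J \<ge> 0"
  unfolding wt_def by (intro divide_nonneg_nonneg pI_nonneg[OF p_nonneg]) auto

lemma wt_sum: "(\<Sum>k<n. \<Sum>J\<in>seqs m k. wt J) = 1"
  using n_pos by (simp add: wt_def sum_divide_distrib[symmetric] sum_pI[OF p_sum])

lemma wt_telescope:
  "(\<Sum>k<n. \<Sum>J\<in>seqs m k. wt J * (f J - (\<Sum>a<m. p a * f (J @ [a])))) = (f [] - (\<Sum>I\<in>seqs m n. pI p I * f I)) / real n"
  unfolding telescope_seqs[where n = n and m = m and p = p and f = f, symmetric] wt_def by (simp add: sum_divide_distrib)

text \<open>Register value \<open>((k, J), Some j)\<close> announces the prefix and \<open>j\<close>; \<open>((k, J), None)\<close>, of total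
  weight \<open>t\<close>, announces that \<open>j\<close> is withheld.\<close>
definition opr :: "real \<Rightarrow> nat \<Rightarrow> (nat \<times> nat list) \<times> nat option \<Rightarrow> complex mat" where
  "opr t a c = (case snd c of
     None \<Rightarrow> complex_of_real (t * wt (snd (fst c))) \<cdot>\<^sub>m sig (snd (fst c) @ [a])
   | Some j \<Rightarrow> complex_of_real ((1 - t) * wt (snd (fst c))) \<cdot>\<^sub>m blks (snd (fst c) @ [a]) j)"

lemma opr_simps:
  "opr t a ((k,J),None) = of_real (t * wt J) \<cdot>\<^sub>m sig (J @ [a])"
  "opr t a ((k,J),Some j) = of_real ((1 - t) * wt J) \<cdot>\<^sub>m blks (J @ [a]) j"
  by (simp_all add: opr_def)

text \<open>A register weight y that does not depend on the letter carries no information about it;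
  it contributes only its share of -S(A), and these shares later cancel S(A).\<close>

lemma ent_scale: "y \<ge> 0 \<Longrightarrow> ent y - (\<Sum>a<m. ent (p a * y)) = - y * (\<Sum>a<m. ent (p a))"
proof -
  assume y: "y \<ge> 0"
  have "(\<Sum>a<m. ent (p a * y)) = (\<Sum>a<m. p a * ent y + y * ent (p a))"
    using p_nonneg y by (intro sum.cong refl) (simp add: ent_mult)
  also have "\<dots> = ent y + y * (\<Sum>a<m. ent (p a))"
    using p_sum by (simp add: sum.distrib sum_distrib_left sum_distrib_right[symmetric])
  finally show ?thesis by simp
qed

lemma msum_scale:
  assumes "\<And>a. a < m \<Longrightarrow> B a \<in> carrier_mat (N * dc) (N * dc)"
  shows "msum (N * dc) (\<lambda>a. of_real (p a) \<cdot>\<^sub>m (of_real y \<cdot>\<^sub>m B a)) {..<m}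
    = of_real y \<cdot>\<^sub>m msum (N * dc) (\<lambda>a. of_real (p a) \<cdot>\<^sub>m B a) {..<m}"
  using assms by (intro eq_matI) (auto simp: sum_distrib_left mult_ac smult_index[OF smult_carrier_mat[OF assms]] smult_index[OF assms] intro!: sum.cong)

lemma sum_vn_scale:
  assumes "\<And>a. a < m \<Longrightarrow> psd (N * dc) (B a)" "y \<ge> 0"
  shows "(\<Sum>a<m. vn_entropy (of_real (p a) \<cdot>\<^sub>m (of_real y \<cdot>\<^sub>m B a)))
    = y * (\<Sum>a<m. p a * vn_entropy (B a)) + (\<Sum>a<m. ent (p a * y) * Re (mtrace (B a)))"
proof -
  have "vn_entropy (of_real (p a) \<cdot>\<^sub>m (of_real y \<cdot>\<^sub>m B a))
    = y * (p a * vn_entropy (B a)) + ent (p a * y) * Re (mtrace (B a))" if a: "a < m" for a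
  proof -
    have "of_real (p a) \<cdot>\<^sub>m (of_real y \<cdot>\<^sub>m B a) = of_real (p a * y) \<cdot>\<^sub>m B a"
      by (intro eq_matI) auto
    then show ?thesis
      using vn_entropy_smult[OF assms(1)[OF a], of "p a * y"] p_nonneg[OF a] assms(2) by (simp add: mult_ac)
  qed
  then show ?thesis by (simp add: sum.distrib sum_distrib_left)
qed

text \<open>\<open>gain c\<close> is the contribution of register value c to S(BC) - S(ABC).
  Withheld and announced values yield the same entropy difference V, with weights x and y whose sum
  is \<open>wt J\<close>; hence t drops out.\<close>

lemma opr_entropy_gain:
  assumes J: "J \<in> seqs m k" "k < n" and t: "0 \<le> t" "t \<le> 1"
  defines "gain \<equiv> \<lambda>c. vn_entropy (msum (N * dc) (\<lambda>a. of_real (p a) \<cdot>\<^sub>m opr t a c) {..<m})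
    - (\<Sum>a<m. vn_entropy (of_real (p a) \<cdot>\<^sub>m opr t a c))"
  shows "gain ((k,J),None) + (\<Sum>j<dc. gain ((k,J),Some j))
    = wt J * (vn_entropy (sig J) - (\<Sum>a<m. p a * vn_entropy (sig (J @ [a])))) - wt J * (\<Sum>a<m. ent (p a))"
proof -
  define x y where "x = t * wt J" and "y = (1 - t) * wt J"
  have xy: "x \<ge> 0" "y \<ge> 0"
    unfolding x_def y_def using t wt_nonneg[OF J(1)] by (auto intro: mult_nonneg_nonneg)
  have xy_sum: "x + y = wt J" by (simp add: x_def y_def algebra_simps)
  have Ja: "J @ [a] \<in> seqs m (Suc k)" if "a < m" for a using snoc_seqs[OF J(1) that] .
  have Sk: "Suc k \<le> n" using J by simp
  define V where "V = vn_entropy (sig J) - (\<Sum>a<m. p a * vn_entropy (sig (J @ [a])))"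
  have 1: "gain ((k,J),None) = x * V + (ent x - (\<Sum>a<m. ent (p a * x)))"
  proof -
    have "msum (N * dc) (\<lambda>a. of_real (p a) \<cdot>\<^sub>m opr t a ((k,J),None)) {..<m} = of_real x \<cdot>\<^sub>m sig J"
      unfolding opr_simps x_def[symmetric] by (subst msum_scale) (simp_all add: sig_step[OF J, symmetric])
    then have "vn_entropy (msum (N * dc) (\<lambda>a. of_real (p a) \<cdot>\<^sub>m opr t a ((k,J),None)) {..<m})
      = x * vn_entropy (sig J) + ent x"
      using vn_entropy_smult[OF sig_psd[OF J(1)], of x] sig_trace[OF J(1)] J xy by simp
    moreover have "(\<Sum>a<m. vn_entropy (of_real (p a) \<cdot>\<^sub>m opr t a ((k,J),None)))
      = x * (\<Sum>a<m. p a * vn_entropy (sig (J @ [a]))) + (\<Sum>a<m. ent (p a * x))"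
      unfolding opr_simps x_def[symmetric]
      by (subst sum_vn_scale) (use xy sig_psd[OF Ja Sk] sig_trace[OF Ja Sk] in auto)
    ultimately show ?thesis by (simp add: gain_def V_def algebra_simps)
  qed
  have 2: "gain ((k,J),Some j) = y * (vn_entropy (blks J j) - (\<Sum>a<m. p a * vn_entropy (blks (J @ [a]) j)))
    + (ent y * P J j - (\<Sum>a<m. ent (p a * y) * P (J @ [a]) j))" for j
  proof -
    have "msum (N * dc) (\<lambda>a. of_real (p a) \<cdot>\<^sub>m opr t a ((k,J),Some j)) {..<m} = of_real y \<cdot>\<^sub>m blks J j"
      unfolding opr_simps y_def[symmetric] by (subst msum_scale) (simp_all add: blks_step[OF J, symmetric])
    then have "vn_entropy (msum (N * dc) (\<lambda>a. of_real (p a) \<cdot>\<^sub>m opr t a ((k,J),Some j)) {..<m})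
      = y * vn_entropy (blks J j) + ent y * P J j"
      using vn_entropy_smult[OF blks_psd[OF J(1)], of y] J xy by (simp add: P_def)
    moreover have "(\<Sum>a<m. vn_entropy (of_real (p a) \<cdot>\<^sub>m opr t a ((k,J),Some j)))
      = y * (\<Sum>a<m. p a * vn_entropy (blks (J @ [a]) j)) + (\<Sum>a<m. ent (p a * y) * P (J @ [a]) j)"
      unfolding opr_simps y_def[symmetric] P_def
      by (subst sum_vn_scale) (use xy blks_psd[OF Ja Sk] in auto)
    ultimately show ?thesis by (simp add: gain_def algebra_simps)
  qed
  have "(\<Sum>j<dc. gain ((k,J),Some j)) = y * ((\<Sum>j<dc. vn_entropy (blks J j)) - (\<Sum>j<dc. \<Sum>a<m. p a * vn_entropy (blks (J @ [a]) j)))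
    + (ent y * (\<Sum>j<dc. P J j) - (\<Sum>j<dc. \<Sum>a<m. ent (p a * y) * P (J @ [a]) j))"
    unfolding 2 by (simp add: sum.distrib sum_subtractf sum_distrib_left right_diff_distrib)
  also have "(\<Sum>j<dc. \<Sum>a<m. p a * vn_entropy (blks (J @ [a]) j)) = (\<Sum>a<m. p a * vn_entropy (sig (J @ [a])))"
    by (subst sum.swap) (simp add: sum_distrib_left[symmetric] vn_blks[OF Ja Sk])
  also have "(\<Sum>j<dc. \<Sum>a<m. ent (p a * y) * P (J @ [a]) j) = (\<Sum>a<m. ent (p a * y))"
    by (subst sum.swap) (simp add: sum_distrib_left[symmetric] P_sum[OF Ja Sk])
  also have "(\<Sum>j<dc. P J j) = 1" using P_sum[OF J(1)] J(2) by simp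
  also have "(\<Sum>j<dc. vn_entropy (blks J j)) = vn_entropy (sig J)" using vn_blks[OF J(1)] J(2) by simp
  finally have 3: "(\<Sum>j<dc. gain ((k,J),Some j)) = y * V + (ent y - (\<Sum>a<m. ent (p a * y)))"
    by (simp add: V_def)
  have "gain ((k,J),None) + (\<Sum>j<dc. gain ((k,J),Some j)) = (x + y) * V - (x + y) * (\<Sum>a<m. ent (p a))"
    unfolding 1 3 ent_scale[OF xy(1)] ent_scale[OF xy(2)] by (simp add: algebra_simps)
  then show ?thesis unfolding xy_sum V_def .
qed

lemma opr_trace:
  assumes J: "J \<in> seqs m k" "k < n" and a: "a < m"
  shows "Re (mtrace (opr t a ((k,J),None))) = t * wt J"
    and "Re (mtrace (opr t a ((k,J),Some j))) = (1 - t) * wt J * P (J @ [a]) j"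
  using sig_trace[OF snoc_seqs[OF J(1) a]] J(2)
  by (simp_all add: opr_simps mtrace_smult[OF sig_carrier] mtrace_smult[OF blks_carrier] P_def)

text \<open>The analogous contribution to S(C) - S(AC). For \<open>None\<close> the register weight
  is independent of the letter, so only the announced share 1 - t carries information about
  j.\<close>

lemma opr_classical_gain:
  assumes J: "J \<in> seqs m k" "k < n" and t: "0 \<le> t" "t \<le> 1"
  defines "gain \<equiv> \<lambda>c. ent (\<Sum>a<m. p a * Re (mtrace (opr t a c))) - (\<Sum>a<m. ent (p a * Re (mtrace (opr t a c))))"
  defines "h \<equiv> \<lambda>J. \<Sum>j<dc. ent (P J j)"
  shows "gain ((k,J),None) + (\<Sum>j<dc. gain ((k,J),Some j))
    = (1 - t) * (wt J * (h J - (\<Sum>a<m. p a * h (J @ [a])))) - wt J * (\<Sum>a<m. ent (p a))"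
proof -
  define x y where "x = t * wt J" and "y = (1 - t) * wt J"
  have xy: "x \<ge> 0" "y \<ge> 0"
    unfolding x_def y_def using t wt_nonneg[OF J(1)] by (auto intro: mult_nonneg_nonneg)
  have xy_sum: "x + y = wt J" by (simp add: x_def y_def algebra_simps)
  have Ja: "J @ [a] \<in> seqs m (Suc k)" if "a < m" for a using snoc_seqs[OF J(1) that] .
  have Sk: "Suc k \<le> n" using J by simp
  have 1: "gain ((k,J),None) = ent x - (\<Sum>a<m. ent (p a * x))"
    unfolding gain_def using p_sum by (simp add: opr_trace[OF J] x_def sum_distrib_right[symmetric])
  have 2: "gain ((k,J),Some j) = y * (ent (P J j) - (\<Sum>a<m. p a * ent (P (J @ [a]) j)))
    + (ent y * P J j - (\<Sum>a<m. ent (p a * y) * P (J @ [a]) j))" for j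
  proof -
    have "(\<Sum>a<m. p a * Re (mtrace (opr t a ((k,J),Some j)))) = y * P J j"
      unfolding P_step[OF J] by (simp add: opr_trace[OF J] y_def sum_distrib_left mult_ac)
    then have "ent (\<Sum>a<m. p a * Re (mtrace (opr t a ((k,J),Some j)))) = y * ent (P J j) + ent y * P J j"
      using ent_mult[OF xy(2) P_nonneg[OF J(1), of j]] J(2) by simp
    moreover have "ent (p a * Re (mtrace (opr t a ((k,J),Some j)))) = y * (p a * ent (P (J @ [a]) j)) + ent (p a * y) * P (J @ [a]) j"
      if "a < m" for a
      using ent_mult[OF mult_nonneg_nonneg[OF p_nonneg[OF that] xy(2)] P_nonneg[OF Ja[OF that] Sk, of j]] that
      by (simp add: opr_trace[OF J] y_def mult_ac)
    ultimately show ?thesis by (simp add: gain_def sum.distrib sum_distrib_left right_diff_distrib)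
  qed
  have "(\<Sum>j<dc. gain ((k,J),Some j)) = y * ((\<Sum>j<dc. ent (P J j)) - (\<Sum>j<dc. \<Sum>a<m. p a * ent (P (J @ [a]) j)))
    + (ent y * (\<Sum>j<dc. P J j) - (\<Sum>j<dc. \<Sum>a<m. ent (p a * y) * P (J @ [a]) j))"
    unfolding 2 by (simp add: sum.distrib sum_subtractf sum_distrib_left right_diff_distrib)
  also have "(\<Sum>j<dc. \<Sum>a<m. p a * ent (P (J @ [a]) j)) = (\<Sum>a<m. p a * h (J @ [a]))"
    unfolding h_def sum_distrib_left by (rule sum.swap)
  also have "(\<Sum>j<dc. \<Sum>a<m. ent (p a * y) * P (J @ [a]) j) = (\<Sum>a<m. ent (p a * y))"
    by (subst sum.swap) (simp add: sum_distrib_left[symmetric] P_sum[OF Ja Sk])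
  also have "(\<Sum>j<dc. P J j) = 1" using P_sum[OF J(1)] J(2) by simp
  finally have 3: "(\<Sum>j<dc. gain ((k,J),Some j)) = y * (h J - (\<Sum>a<m. p a * h (J @ [a]))) + (ent y - (\<Sum>a<m. ent (p a * y)))"
    by (simp add: h_def)
  have "gain ((k,J),None) + (\<Sum>j<dc. gain ((k,J),Some j))
     = y * (h J - (\<Sum>a<m. p a * h (J @ [a]))) - (x + y) * (\<Sum>a<m. ent (p a))"
    unfolding 1 3 ent_scale[OF xy(1)] ent_scale[OF xy(2)] by (simp add: algebra_simps)
  then show ?thesis unfolding xy_sum unfolding y_def by (simp add: mult_ac)
qed

lemma opr_psd:
  assumes t: "0 \<le> t" "t \<le> 1" and a: "a < m" and c: "c \<in> reg"
  shows "psd (N * dc) (opr t a c)"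
proof -
  obtain k J v where c': "c = ((k,J),v)" "k < n" "J \<in> seqs m k"
    using c unfolding reg_def by auto
  have Sk: "Suc k \<le> n" using c' by simp
  show ?thesis
    using t wt_nonneg[OF c'(3)] sig_psd[OF snoc_seqs[OF c'(3) a] Sk] blks_psd[OF snoc_seqs[OF c'(3) a] Sk]
    unfolding c'(1) by (cases v) (auto simp: opr_simps simp del: of_real_mult intro!: psd_smult)
qed

lemma opr_total_trace:
  assumes a: "a < m"
  shows "(\<Sum>c\<in>reg. Re (mtrace (opr t a c))) = 1"
proof -
  have "(\<Sum>c\<in>reg. Re (mtrace (opr t a c))) = (\<Sum>k<n. \<Sum>J\<in>seqs m k. wt J)"
    unfolding sum_reg
  proof (intro sum.cong refl)
    fix k J assume "k \<in> {..<n}" and J: "J \<in> seqs m k"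
    then have k: "k < n" by simp
    then have "(\<Sum>j<dc. P (J @ [a]) j) = 1" using P_sum[OF snoc_seqs[OF J a]] by simp
    then show "Re (mtrace (opr t a ((k,J),None))) + (\<Sum>j<dc. Re (mtrace (opr t a ((k,J),Some j)))) = wt J"
      by (simp only: opr_trace[OF J k a] sum_distrib_left[symmetric]) (simp add: algebra_simps)
  qed
  then show ?thesis using wt_sum by simp
qed

theorem averaged_encoding:
  assumes t: "0 \<le> t" "t \<le> 1"
  obtains q \<omega> e where "bij_betw e {..<card reg} reg" "valid_encoding m (N * dc) (card reg) q \<omega>"
    "mi_AC m p (N * dc) (card reg) q \<omega>
      = (1 - t) * (((\<Sum>j<dc. ent (P [] j)) - (\<Sum>I\<in>seqs m n. pI p I * (\<Sum>j<dc. ent (P I j)))) / real n)"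
    "mi_AC m p (N * dc) (card reg) q \<omega> + cmi_ABC m p (N * dc) (card reg) q \<omega>
      = holevo (N * dc) G (pI p) (seqs m n) / real n"
    "\<And>a b b' c. a < m \<Longrightarrow> b < N * dc \<Longrightarrow> b' < N * dc \<Longrightarrow> c < card reg \<Longrightarrow>
       enc_map (N * dc) (card reg) q \<omega> a $$ (b * card reg + c, b' * card reg + c) = opr t a (e c) $$ (b,b')"
proof -
  let ?D = "N * dc"
  have D_pos: "N * dc > 0" using N_pos dc_pos by simp
  obtain q \<omega> e where e: "bij_betw e {..<card reg} reg" and v: "valid_encoding m ?D (card reg) q \<omega>"
    and mi: "mi_AC m p ?D (card reg) q \<omega> = (\<Sum>a<m. ent (p a)) + (\<Sum>c\<in>reg. ent (\<Sum>a<m. p a * Re (mtrace (opr t a c))))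
       - (\<Sum>a<m. \<Sum>c\<in>reg. ent (p a * Re (mtrace (opr t a c))))"
    and tot: "mi_AC m p ?D (card reg) q \<omega> + cmi_ABC m p ?D (card reg) q \<omega> = (\<Sum>a<m. ent (p a))
       + (\<Sum>c\<in>reg. vn_entropy (msum ?D (\<lambda>a. of_real (p a) \<cdot>\<^sub>m opr t a c) {..<m}))
       - (\<Sum>a<m. \<Sum>c\<in>reg. vn_entropy (of_real (p a) \<cdot>\<^sub>m opr t a c))"
    and enc: "\<And>a b b' c. a < m \<Longrightarrow> b < ?D \<Longrightarrow> b' < ?D \<Longrightarrow> c < card reg \<Longrightarrow>
       enc_map ?D (card reg) q \<omega> a $$ (b * card reg + c, b' * card reg + c) = opr t a (e c) $$ (b,b')"
    by (rule encoding_from_operators[where C = reg and W = "opr t" and dB = "N * dc" and m = m and p = p])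
      (rule finite_reg, rule D_pos, erule p_nonneg, erule (1) opr_psd[OF t], erule opr_total_trace,
        (rule that; assumption))
  define H where "H = (\<Sum>a<m. ent (p a))"
  \<comment> \<open>The prefix weights sum to 1, so the shares of -S(A) add up to -H and cancel the
    leading H; what remains telescopes.\<close>
  have flat: "(\<Sum>k<n. \<Sum>J\<in>seqs m k. g k J - wt J * H) = (\<Sum>k<n. \<Sum>J\<in>seqs m k. g k J) - H"
    for g :: "nat \<Rightarrow> nat list \<Rightarrow> real"
    using wt_sum by (simp add: sum_subtractf sum_distrib_right[symmetric])
  have "mi_AC m p ?D (card reg) q \<omega>
    = H + (\<Sum>c\<in>reg. ent (\<Sum>a<m. p a * Re (mtrace (opr t a c))) - (\<Sum>a<m. ent (p a * Re (mtrace (opr t a c)))))"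
    unfolding mi H_def by (subst sum.swap) (simp add: sum_subtractf)
  also have "\<dots> = H + (\<Sum>k<n. \<Sum>J\<in>seqs m k. (1 - t) * (wt J * ((\<Sum>j<dc. ent (P J j))
      - (\<Sum>a<m. p a * (\<Sum>j<dc. ent (P (J @ [a]) j))))) - wt J * H)"
    unfolding sum_reg H_def
    by (intro arg_cong2[where f = "(+)"] refl sum.cong opr_classical_gain t) auto
  also have "\<dots> = (1 - t) * (\<Sum>k<n. \<Sum>J\<in>seqs m k. wt J * ((\<Sum>j<dc. ent (P J j))
      - (\<Sum>a<m. p a * (\<Sum>j<dc. ent (P (J @ [a]) j)))))"
    unfolding flat by (simp add: sum_distrib_left)
  also have "\<dots> = (1 - t) * (((\<Sum>j<dc. ent (P [] j)) - (\<Sum>I\<in>seqs m n. pI p I * (\<Sum>j<dc. ent (P I j)))) / real n)"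
    unfolding wt_telescope[of "\<lambda>J. \<Sum>j<dc. ent (P J j)"] ..
  finally have 1: "mi_AC m p ?D (card reg) q \<omega>
      = (1 - t) * (((\<Sum>j<dc. ent (P [] j)) - (\<Sum>I\<in>seqs m n. pI p I * (\<Sum>j<dc. ent (P I j)))) / real n)" .
  have "mi_AC m p ?D (card reg) q \<omega> + cmi_ABC m p ?D (card reg) q \<omega>
    = H + (\<Sum>c\<in>reg. vn_entropy (msum ?D (\<lambda>a. of_real (p a) \<cdot>\<^sub>m opr t a c) {..<m})
        - (\<Sum>a<m. vn_entropy (of_real (p a) \<cdot>\<^sub>m opr t a c)))"
    unfolding tot H_def by (subst sum.swap) (simp add: sum_subtractf)
  also have "\<dots> = H + (\<Sum>k<n. \<Sum>J\<in>seqs m k. wt J * (vn_entropy (sig J)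
      - (\<Sum>a<m. p a * vn_entropy (sig (J @ [a])))) - wt J * H)"
    unfolding sum_reg H_def
    by (intro arg_cong2[where f = "(+)"] refl sum.cong opr_entropy_gain t) auto
  also have "\<dots> = (vn_entropy (sig []) - (\<Sum>I\<in>seqs m n. pI p I * vn_entropy (sig I))) / real n"
    unfolding flat wt_telescope[of "\<lambda>J. vn_entropy (sig J)"] by simp
  also have "(\<Sum>I\<in>seqs m n. pI p I * vn_entropy (sig I)) = (\<Sum>I\<in>seqs m n. pI p I * vn_entropy (G I))"
    by (intro sum.cong refl) (simp add: sig_full)
  finally have 2: "mi_AC m p ?D (card reg) q \<omega> + cmi_ABC m p ?D (card reg) q \<omega>
      = holevo (N * dc) G (pI p) (seqs m n) / real n"
    by (simp add: holevo_def sig_def)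
  show ?thesis by (rule that[OF e v 1 2 enc])
qed

end

section \<open>Fidelity of the averaged encoding\<close>

context block_code
begin

lemma P_empty: "P [] j = (\<Sum>I\<in>seqs m n. pI p I * P I j)"
proof -
  have car: "G I \<in> carrier_mat (N * dc) (N * dc)" if "I \<in> seqs m n" for I
    using psd_carrier[OF G_psd[OF that]] .
  have "blks [] j = msum (N * dc) (\<lambda>I. of_real (pI p I) \<cdot>\<^sub>m blks I j) (seqs m n)"
    unfolding blks_def sig_def[of "[]"] blk_msum
    by (simp, intro msum_cong) (simp add: blk_smult car sig_full)
  then show ?thesis
    unfolding P_def by (simp, subst mtrace_msum[where N = "N * dc"]) (auto simp: mtrace_smult[OF blks_carrier])
qed

text \<open>The shares t and 1 - t recombine, since announced blocks sum to the unannounced state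
  after the register is traced out; so the fidelity does not depend on t.\<close>

lemma opr_letter:
  assumes N: "N = d ^ n" and k: "k < n"
  shows "Re (qform d (letter_state d n dc k (opr t a ((k,J),None))) \<psi>)
      + (\<Sum>j<dc. Re (qform d (letter_state d n dc k (opr t a ((k,J),Some j))) \<psi>))
    = wt J * Re (qform d (letter_state d n dc k (sig (J @ [a]))) \<psi>)"
proof -
  define Q where "Q X = Re (qform d (letter_state d n dc k X) \<psi>)" for X
  have Q: "Q (of_real y \<cdot>\<^sub>m X) = y * Q X" if "X \<in> carrier_mat (N * dc) (N * dc)" for X y
    using letter_state_smult[OF k, where d = d, folded N, OF that] by (simp add: Q_def qform_smult)
  have "Q (sig (J @ [a])) = (\<Sum>j<dc. Q (blks (J @ [a]) j))"
  proof -
    have "letter_state d n dc k (sig (J @ [a])) = msum d (\<lambda>j. letter_state d n dc k (blks (J @ [a]) j)) {..<dc}"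
      unfolding blks_def letter_state_blk[OF k, where d = d, folded N] ..
    then show ?thesis by (simp add: Q_def qform_msum)
  qed
  then show ?thesis
    unfolding Q_def[symmetric] opr_simps Q[OF sig_carrier] Q[OF blks_carrier] sum_distrib_left[symmetric]
    by (simp add: algebra_simps)
qed

lemma sig_letter:
  assumes N: "N = d ^ n" and k: "k < n" and J: "J \<in> seqs m l" "l \<le> n"
  shows "Re (qform d (letter_state d n dc k (sig J)) \<psi>)
    = (\<Sum>K\<in>seqs m (n - l). pI p K * Re (qform d (letter_state d n dc k (G (J @ K))) \<psi>))"
proof -
  have car: "G (J @ K) \<in> carrier_mat (N * dc) (N * dc)" if "K \<in> seqs m (n - l)" for K
    using psd_carrier[OF G_psd[OF append_seqs[OF J]], of K] that J seqs_length by auto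
  show ?thesis
    unfolding sig_def letter_state_msum[OF k, where d = d, folded N] qform_msum seqs_length[OF J(1)] Re_sum
    by (intro sum.cong refl)
      (simp add: letter_state_smult[OF k, where d = d, folded N, OF car] qform_smult[OF letter_state_carrier])
qed

text \<open>Every sequence splits as J, then the letter a at position k, then a tail K. The mean
  over K is hidden in \<open>sig\<close>, and J and k are recorded in the register, so the two
  averages are the same sum.\<close>

lemma averaged_fidelity:
  assumes N: "N = d ^ n"
  shows "(\<Sum>a<m. p a * (\<Sum>c\<in>reg. Re (qform d (letter_state d n dc (fst (fst c)) (opr t a c)) (\<psi> a))))
    = (\<Sum>I\<in>seqs m n. pI p I * (1 / real n) * (\<Sum>k<n. Re (qform d (letter_state d n dc k (G I)) (\<psi> (I ! k)))))"
proof -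
  define Q where "Q k a X = Re (qform d (letter_state d n dc k X) (\<psi> a))" for k a X
  have step: "(\<Sum>J\<in>seqs m k. \<Sum>a<m. p a * (wt J * Q k a (sig (J @ [a]))))
    = (\<Sum>I\<in>seqs m n. pI p I * (1 / real n) * Q k (I ! k) (G I))" if k: "k < n" for k
  proof -
    have n: "n = k + Suc (n - Suc k)" using k by simp
    have "(\<Sum>I\<in>seqs m n. pI p I * (1 / real n) * Q k (I ! k) (G I))
      = (\<Sum>J\<in>seqs m k. \<Sum>a<m. \<Sum>K\<in>seqs m (n - Suc k).
          pI p (J @ a # K) * (1 / real n) * Q k ((J @ a # K) ! k) (G (J @ a # K)))"
      by (subst n, subst sum_seqs_append, subst sum_seqs_Suc) simp
    also have "\<dots> = (\<Sum>J\<in>seqs m k. \<Sum>a<m. p a * (wt J * Q k a (sig (J @ [a]))))"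
    proof (intro sum.cong refl)
      fix J a assume J: "J \<in> seqs m k" and a: "a \<in> {..<m}"
      have Ja: "J @ [a] \<in> seqs m (Suc k)" using snoc_seqs[OF J] a by simp
      have "Q k a (sig (J @ [a])) = (\<Sum>K\<in>seqs m (n - Suc k). pI p K * Q k a (G (J @ a # K)))"
        unfolding Q_def using sig_letter[OF N k Ja] k by simp
      moreover have "(J @ a # K) ! k = a" for K using seqs_length[OF J] by (simp add: nth_append)
      ultimately show "(\<Sum>K\<in>seqs m (n - Suc k). pI p (J @ a # K) * (1 / real n) * Q k ((J @ a # K) ! k) (G (J @ a # K)))
        = p a * (wt J * Q k a (sig (J @ [a])))"
        by (simp add: wt_def sum_distrib_left mult_ac)
    qed
    finally show ?thesis by simp
  qed
  have "(\<Sum>a<m. p a * (\<Sum>c\<in>reg. Q (fst (fst c)) a (opr t a c)))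
    = (\<Sum>a<m. p a * (\<Sum>k<n. \<Sum>J\<in>seqs m k. wt J * Q k a (sig (J @ [a]))))"
    unfolding sum_reg Q_def by (intro sum.cong refl arg_cong2[where f = "(*)"]) (simp add: opr_letter[OF N])
  also have "\<dots> = (\<Sum>a<m. \<Sum>k<n. \<Sum>J\<in>seqs m k. p a * (wt J * Q k a (sig (J @ [a]))))"
    by (simp add: sum_distrib_left)
  also have "\<dots> = (\<Sum>k<n. \<Sum>J\<in>seqs m k. \<Sum>a<m. p a * (wt J * Q k a (sig (J @ [a]))))"
    by (subst sum.swap, rule sum.cong[OF refl], rule sum.swap)
  also have "\<dots> = (\<Sum>k<n. \<Sum>I\<in>seqs m n. pI p I * (1 / real n) * Q k (I ! k) (G I))"
    by (intro sum.cong refl step) simp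
  also have "\<dots> = (\<Sum>I\<in>seqs m n. pI p I * (1 / real n) * (\<Sum>k<n. Q k (I ! k) (G I)))"
    by (subst sum.swap) (simp add: sum_distrib_left)
  finally show ?thesis unfolding Q_def .
qed

end

text \<open>The entropy of I cancels, and the mutual information takes the form H(j) - H(j|I), which
  is what the telescoped \<open>averaged_encoding\<close> delivers.\<close>

lemma classical_mi_product:
  assumes p: "\<And>I. I \<in> A \<Longrightarrow> P I \<ge> 0" and w: "\<And>I j. I \<in> A \<Longrightarrow> j \<in> B \<Longrightarrow> w I j \<ge> 0"
    and w1: "\<And>I. I \<in> A \<Longrightarrow> (\<Sum>j\<in>B. w I j) = 1"
  shows "classical_mi (\<lambda>(I,j). P I * w I j) A B
    = (\<Sum>j\<in>B. ent (\<Sum>I\<in>A. P I * w I j)) - (\<Sum>I\<in>A. P I * (\<Sum>j\<in>B. ent (w I j)))"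
proof -
  have sh: "shannon f S = (\<Sum>x\<in>S. ent (f x))" for f :: "'x \<Rightarrow> real" and S
    by (simp add: shannon_def ent_def sum_negf)
  have "(\<Sum>z\<in>A \<times> B. ent (case z of (I,j) \<Rightarrow> P I * w I j)) = (\<Sum>I\<in>A. \<Sum>j\<in>B. ent (P I * w I j))"
    by (simp add: sum.cartesian_product split_def)
  also have "\<dots> = (\<Sum>I\<in>A. P I * (\<Sum>j\<in>B. ent (w I j)) + (\<Sum>j\<in>B. w I j) * ent (P I))"
    unfolding sum_distrib_left sum_distrib_right sum.distrib[symmetric]
    by (intro sum.cong refl) (simp add: ent_mult p w)
  also have "\<dots> = (\<Sum>I\<in>A. P I * (\<Sum>j\<in>B. ent (w I j))) + (\<Sum>I\<in>A. ent (P I))"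
    by (simp add: sum.distrib w1)
  finally have joint: "(\<Sum>z\<in>A \<times> B. ent (case z of (I,j) \<Rightarrow> P I * w I j))
    = (\<Sum>I\<in>A. P I * (\<Sum>j\<in>B. ent (w I j))) + (\<Sum>I\<in>A. ent (P I))" .
  have "(\<Sum>I\<in>A. ent (\<Sum>j\<in>B. P I * w I j)) = (\<Sum>I\<in>A. ent (P I))"
    by (simp add: sum_distrib_left[symmetric] w1)
  then show ?thesis by (simp add: classical_mi_def sh joint)
qed

theorem theorem7p1:
  fixes d m n dc :: nat
    and \<phi> :: "nat \<Rightarrow> complex vec" and p :: "nat \<Rightarrow> real"
    and R \<epsilon> :: real
    and \<Gamma> :: "complex mat \<Rightarrow> complex mat"
    and pc :: "nat list \<Rightarrow> nat \<Rightarrow> real" and phit :: "nat list \<Rightarrow> nat \<Rightarrow> complex mat"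
  assumes ens: "ensemble d m \<phi> p"
    and n_pos: "n \<ge> 1" and R_nonneg: "R \<ge> 0" and eps_pos: "\<epsilon> > 0"
    and Gamma_cptp: "cptp (d^n) (d^n * dc) \<Gamma>"
    and classical_reg: "\<forall>I \<in> seqs m n. (\<forall>j<dc. pc I j \<ge> 0 \<and> density (d^n) (phit I j))
         \<and> (\<Sum>j<dc. pc I j) = 1
         \<and> \<Gamma> (phiI \<phi> I) = msum (d^n * dc)
              (\<lambda>j. complex_of_real (pc I j) \<cdot>\<^sub>m kron (phit I j) (ket_proj dc j)) {..<dc}"
    and rate: "classical_mi (\<lambda>(I,j). pI p I * pc I j) (seqs m n) {..<dc} \<ge> real n * R"
    and fidelity: "(\<Sum>I\<in>seqs m n. pI p I * (1 / real n) *
         (\<Sum>k<n. fid (\<phi> (I ! k))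
            (keep_mid (d^k) d (d^(n - k - 1)) (ptrace_mid (d^n) dc 1 (\<Gamma> (phiI \<phi> I))))))
         \<ge> 1 - \<epsilon>"
  shows "ereal (ens_entropy d m \<phi> p) \<ge> X_eps d m \<phi> p \<epsilon> R
    \<and> ereal (holevo (d^n * dc) (\<lambda>I. \<Gamma> (phiI \<phi> I)) (pI p) (seqs m n))
        \<ge> ereal (real n) * X_eps d m \<phi> p \<epsilon> R"
proof -
  have \<phi>: "\<And>i. i < m \<Longrightarrow> \<phi> i \<in> carrier_vec d" and p: "\<And>i. i < m \<Longrightarrow> p i \<ge> 0" and p1: "(\<Sum>i<m. p i) = 1"
    using ens by (auto simp: ensemble_def)
  have "m > 0" using p1 by (cases m) auto
  then have d: "d > 0" using ensemble_norm[OF ens, of 0] by (cases d) auto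
  have "seqs m n \<noteq> {}" using sum_pI[OF p1, of n] by auto
  then have dc: "dc > 0" using classical_reg by (cases dc) auto
  have phiI_eq: "phiI \<phi> I = outer (d ^ n) (phi_vec d \<phi> I) (phi_vec d \<phi> I)" if "I \<in> seqs m n" for I
    using phiI_outer[of m \<phi> d I] \<phi> that by (auto simp: seqs_def)
  have entry: "\<Gamma> (phiI \<phi> I) $$ (b * dc + j, b' * dc + j')
      = (if j = j' then complex_of_real (pc I j) * phit I j $$ (b,b') else 0)"
    if I: "I \<in> seqs m n" and "b < d ^ n" "b' < d ^ n" "j < dc" "j' < dc" for I b b' j j'
  proof -
    \<comment> \<open>Each output of \<Gamma> is viewed as an encoding of a one-letter alphabet, so
      that \<open>enc_map_index\<close> gives its entries.\<close>
    have "valid_encoding 1 (d ^ n) dc (\<lambda>_. pc I) (\<lambda>_. phit I)"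
      using classical_reg I by (auto simp: valid_encoding_def)
    moreover have "\<Gamma> (phiI \<phi> I) = enc_map (d ^ n) dc (\<lambda>_. pc I) (\<lambda>_. phit I) 0"
      using classical_reg I by (simp add: enc_map_def)
    ultimately show ?thesis using enc_map_index[of 1 "d ^ n" dc "\<lambda>_. pc I" "\<lambda>_. phit I" 0] that by simp
  qed
  interpret bc: block_code m n "d ^ n" dc p "\<lambda>I. \<Gamma> (phiI \<phi> I)"
  proof
    fix I assume I: "I \<in> seqs m n"
    show "psd (d ^ n * dc) (\<Gamma> (phiI \<phi> I))"
      unfolding phiI_eq[OF I] by (rule cptp_psd[OF Gamma_cptp psd_outer])
    have "mtrace (\<Gamma> (phiI \<phi> I)) = mtrace (phiI \<phi> I)"
      unfolding phiI_eq[OF I] using Gamma_cptp by (simp add: cptp_def)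
    also have "\<dots> = ip (d ^ n) (phi_vec d \<phi> I) (phi_vec d \<phi> I)"
      unfolding phiI_eq[OF I] by (simp add: mtrace_def outer_def ip_def mult.commute)
    also have "\<dots> = 1"
      using phi_vec_norm[where m = m and d = d and \<phi> = \<phi> and I = I] ensemble_norm[OF ens] I
      by (auto simp: ip_self seqs_def simp del: of_real_sum)
    finally show "mtrace (\<Gamma> (phiI \<phi> I)) = 1" .
  qed (use p p1 n_pos d dc entry in auto)
  have P: "bc.P I j = pc I j" if I: "I \<in> seqs m n" and j: "j < dc" for I j
  proof -
    have "mtrace (bc.blks I j) = (\<Sum>b<d ^ n. \<Sum>i<dc. blk (d ^ n * dc) dc j (\<Gamma> (phiI \<phi> I)) $$ (b * dc + i, b * dc + i))"
      by (simp add: bc.blks_def bc.sig_full[OF I] mtrace_def sum_mult_add carrier_matD(1)[OF blk_carrier])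
    also have "\<dots> = (\<Sum>b<d ^ n. \<Sum>i<dc. if i = j then complex_of_real (pc I j) * phit I j $$ (b,b) else 0)"
      by (intro sum.cong refl) (auto simp: blk_def mult_add_less entry[OF I])
    also have "\<dots> = complex_of_real (pc I j) * (\<Sum>b<d ^ n. phit I j $$ (b,b))"
      using j by (simp add: sum_distrib_left)
    also have "(\<Sum>b<d ^ n. phit I j $$ (b,b)) = 1"
    proof -
      have "density (d ^ n) (phit I j)" using classical_reg I j by blast
      then show ?thesis by (auto simp: density_def psd_def mtrace_def)
    qed
    finally show ?thesis by (simp add: bc.P_def)
  qed
  let ?D = "d ^ n * dc" and ?C = "card bc.reg" and ?\<chi> = "holevo (d ^ n * dc) (\<lambda>I. \<Gamma> (phiI \<phi> I)) (pI p) (seqs m n)"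
  define \<mu> where "\<mu> = classical_mi (\<lambda>(I,j). pI p I * pc I j) (seqs m n) {..<dc}"
  have \<mu>: "\<mu> = (\<Sum>j<dc. ent (bc.P [] j)) - (\<Sum>I\<in>seqs m n. pI p I * (\<Sum>j<dc. ent (bc.P I j)))"
    unfolding \<mu>_def using classical_reg
    by (subst classical_mi_product) (auto simp: bc.P_empty P intro: pI_nonneg[OF p])
  \<comment> \<open>The choice solves (1 - t) \<mu> = n R. If \<mu> = 0, the rate hypothesis
    together with R >= 0 forces R = 0, and t = 0 works.\<close>
  define t where "t = (if \<mu> = 0 then 0 else 1 - real n * R / \<mu>)"
  have \<mu>R: "\<mu> \<ge> real n * R" using rate by (simp add: \<mu>_def)
  have nR: "real n * R \<ge> 0" using R_nonneg by simp
  have t: "0 \<le> t" "t \<le> 1" using \<mu>R nR by (auto simp: t_def divide_le_eq)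
  have tR: "(1 - t) * (\<mu> / real n) = R"
    using \<mu>R nR n_pos R_nonneg by (auto simp: t_def mult_le_0_iff)
  obtain q \<omega> e where e: "bij_betw e {..<?C} bc.reg"
    and v: "valid_encoding m ?D ?C q \<omega>"
    and mi: "mi_AC m p ?D ?C q \<omega>
      = (1 - t) * (((\<Sum>j<dc. ent (bc.P [] j)) - (\<Sum>I\<in>seqs m n. pI p I * (\<Sum>j<dc. ent (bc.P I j)))) / real n)"
    and tot: "mi_AC m p ?D ?C q \<omega> + cmi_ABC m p ?D ?C q \<omega>
      = ?\<chi> / real n"
    and enc: "\<And>a b b' c. a < m \<Longrightarrow> b < ?D \<Longrightarrow> b' < ?D \<Longrightarrow> c < ?C \<Longrightarrow>
       enc_map ?D ?C q \<omega> a $$ (b * ?C + c, b' * ?C + c) = bc.opr t a (e c) $$ (b,b')"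
    by (rule bc.averaged_encoding[OF t]) (rule that; assumption)
  have ek: "fst (fst (e c)) < n" if "c < ?C" for c
  proof -
    have "e c \<in> bc.reg" using e that by (auto simp: bij_betw_def)
    then show ?thesis by (auto simp: bc.reg_def)
  qed
  obtain D where D: "cptp (?D * ?C) d D"
    and DX: "\<forall>X Y. (\<forall>b<d ^ n * dc. \<forall>b'<d ^ n * dc. \<forall>c<?C.
        X $$ (b * ?C + c, b' * ?C + c) = Y c $$ (b,b')) \<longrightarrow>
      D X = msum d (\<lambda>c. letter_state d n dc (fst (fst (e c))) (Y c)) {..<?C}"
    using letter_decoder[of "?C" "\<lambda>c. fst (fst (e c))" n d dc, OF ek] by blast
  have fidD: "fid (\<phi> a) (D (enc_map ?D ?C q \<omega> a))
     = (\<Sum>c\<in>bc.reg. Re (qform d (letter_state d n dc (fst (fst c)) (bc.opr t a c)) (vec_index (\<phi> a))))" if a: "a < m" for a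
  proof -
    have "D (enc_map ?D ?C q \<omega> a)
      = msum d (\<lambda>c. letter_state d n dc (fst (fst (e c))) (bc.opr t a (e c))) {..<?C}"
      by (intro DX[rule_format] enc[OF a])
    then have "fid (\<phi> a) (D (enc_map ?D ?C q \<omega> a))
      = (\<Sum>c<?C. Re (qform d (letter_state d n dc (fst (fst (e c))) (bc.opr t a (e c))) (vec_index (\<phi> a))))"
      using fid_qform[OF \<phi>[OF a] msum_carrier] by (simp add: qform_msum)
    also have "\<dots> = (\<Sum>c\<in>bc.reg. Re (qform d (letter_state d n dc (fst (fst c)) (bc.opr t a c)) (vec_index (\<phi> a))))"
      by (rule sum.reindex_bij_betw[OF e])
    finally show ?thesis .
  qed
  have car: "\<Gamma> (phiI \<phi> I) \<in> carrier_mat (d ^ n * dc) (d ^ n * dc)" if "I \<in> seqs m n" for I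
    using psd_carrier[OF bc.G_psd[OF that]] .
  have "(\<Sum>a<m. p a * fid (\<phi> a) (D (enc_map ?D ?C q \<omega> a)))
    = (\<Sum>a<m. p a * (\<Sum>c\<in>bc.reg. Re (qform d (letter_state d n dc (fst (fst c)) (bc.opr t a c)) (vec_index (\<phi> a)))))"
    by (intro sum.cong refl) (simp add: fidD)
  also have "\<dots> = (\<Sum>I\<in>seqs m n. pI p I * (1 / real n)
      * (\<Sum>k<n. Re (qform d (letter_state d n dc k (\<Gamma> (phiI \<phi> I))) (vec_index (\<phi> (I ! k))))))"
    by (rule bc.averaged_fidelity) simp
  also have "\<dots> = (\<Sum>I\<in>seqs m n. pI p I * (1 / real n) * (\<Sum>k<n. fid (\<phi> (I ! k))
      (keep_mid (d^k) d (d^(n - k - 1)) (ptrace_mid (d^n) dc 1 (\<Gamma> (phiI \<phi> I))))))"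
  proof (intro sum.cong refl arg_cong2[where f = "(*)"])
    fix I k assume I: "I \<in> seqs m n" and k: "k \<in> {..<n}"
    then have "I ! k \<in> set I" by (intro nth_mem) (simp add: seqs_length)
    then have "I ! k < m" using I by (auto simp: seqs_def)
    then show "Re (qform d (letter_state d n dc k (\<Gamma> (phiI \<phi> I))) (vec_index (\<phi> (I ! k))))
      = fid (\<phi> (I ! k)) (keep_mid (d^k) d (d^(n - k - 1)) (ptrace_mid (d^n) dc 1 (\<Gamma> (phiI \<phi> I))))"
      using keep_mid_letter_state[OF _ car[OF I], of k] k fid_qform[OF \<phi> letter_state_carrier] by simp
  qed
  finally have "(\<Sum>a<m. p a * fid (\<phi> a) (D (enc_map ?D ?C q \<omega> a))) \<ge> 1 - \<epsilon>"
    using fidelity by simp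
  moreover have miR: "mi_AC m p ?D ?C q \<omega> = R"
    using tR unfolding mi \<mu> .
  ultimately have "in_T d m \<phi> p \<epsilon> R ?D ?C q \<omega>"
    using v D by (auto simp: in_T_def)
  then have "M_eps d m \<phi> p \<epsilon> R \<le> ereal (cmi_ABC m p ?D ?C q \<omega>)"
    unfolding M_eps_def by (intro Inf_lower) auto
  then have "X_eps d m \<phi> p \<epsilon> R \<le> ereal R + ereal (cmi_ABC m p ?D ?C q \<omega>)"
    unfolding X_eps_def by (intro add_left_mono)
  also have "\<dots> = ereal (?\<chi> / real n)"
    using tot miR by simp
  finally have X: "X_eps d m \<phi> p \<epsilon> R \<le> ereal (?\<chi> / real n)" .
  have "ereal (real n) * X_eps d m \<phi> p \<epsilon> R
    \<le> ereal (real n) * ereal (?\<chi> / real n)"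
    by (rule ereal_mult_left_mono[OF X]) simp
  also have "\<dots> = ereal (?\<chi>)"
    using n_pos by simp
  finally have second: "ereal (real n) * X_eps d m \<phi> p \<epsilon> R
    \<le> ereal (?\<chi>)" .
  have "?\<chi> / real n \<le> ens_entropy d m \<phi> p"
    using holevo_le_entropy[OF ens Gamma_cptp] n_pos by (simp add: divide_le_eq mult.commute)
  then have "X_eps d m \<phi> p \<epsilon> R \<le> ereal (ens_entropy d m \<phi> p)"
    using X by (meson ereal_less_eq(3) order_trans)
  with second show ?thesis by simp
qed

end
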